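(* Let $A$ be a $C^*$-algebra, let $E\subseteq A$ be a closed $*$-subspace, and let $\mathcal{E}\subseteq\mathcal{A}$ be $*$-subspaces with $\mathcal{E}\subseteq E$ dense in $E$ and $\mathcal{A}\subseteq A$ dense in $A$. Suppose there exists a norm-defining approximate order unit for $\mathcal{A}$ contained in $\mathcal{E}$. Then for every $n\geq1$ the map $$\rho: M_n(A)^*_h/M_n(E)^\perp_h\to M_n(E)^*_h,\qquad \rho(\phi+M_n(E)^\perp_h)=\phi|_{M_n(E)_h},$$ induced by restriction, is an isometric order isomorphism.
   Context: A $*$-subspace is a linear subspace closed under the involution. For a $*$-subspace $V\subseteq A$ of a $C^*$-algebra, $M_n(V)$ carries the norm, involution and order inherited from the $C^*$-algebra $M_n(A)$: $M_n(V)_h$ is the set of self-adjoint elements and $M_n(V)_+=M_n(V)\cap M_n(A)_+$. For $e\in V$ write $e^n=\mathrm{diag}(e,\dots,e)\in M_n(V)$. An approximate order unit for $V$ is a net $\{e_\lambda\}_{\lambda\in\Lambda}$ with $e_\lambda\in V_+$ for all $\lambda$; $e_\lambda\leq e_\mu$ whenever $\lambda\leq\mu$; and for each $x\in V_h$ there are a real $t>0$ and $\lambda\in\Lambda$ with $-te_\lambda\leq x\leq te_\lambda$. It is norm-defining if for every $n$ and every $x\in M_n(V)$, $$\|x\|=\inf\left\{t:\begin{pmatrix}te_\lambda^n & x \\ x^* & te_\lambda^n\end{pmatrix}\in M_{2n}(V)_+\text{ for some }\lambda\in\Lambda\right\}.$$ $M_n(E)^*$ and $M_n(A)^*$ are the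 Banach space duals of $M_n(E)$ and $M_n(A)$; the subscript $h$ denotes the real subspace of hermitian functionals ($\phi(x^* )=\overline{\phi(x)}$), which is identified isometrically with the dual of the real Banach space of self-adjoint elements; the subscript $+$ denotes functionals that are nonnegative on the positive cone. The annihilator is $M_n(E)^\perp=\{\eta\in M_n(A)^*\mid\eta(x)=0\ \forall x\in M_n(E)\}$. The quotient carries the quotient norm and the order whose positive cone is the image of $M_n(A)^*_+$ under the quotient map, i.e. $\phi+M_n(E)^\perp_h\geq0$ iff $\phi+\eta\geq0$ for some $\eta\in M_n(E)^\perp_h$. An order isomorphism is a linear bijection that, together with its inverse, preserves positive cones. *)

theory Defs
  imports "HOL-Analysis.Analysis" "Jordan_Normal_Form.Matrix"
begin

section \<open>C*-algebras\<close>

text \<open>No unit is assumed; completeness and submultiplicativity of the norm come from the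
  superclasses.\<close>

class cstar_algebra = banach + real_normed_algebra +
  fixes scaleC :: "complex \<Rightarrow> 'a \<Rightarrow> 'a"  (infixr \<open>*\<^sub>C\<close> 75)
    and star :: "'a \<Rightarrow> 'a"
  assumes scaleC_add_right: "c *\<^sub>C (x + y) = c *\<^sub>C x + c *\<^sub>C y"
    and scaleC_add_left: "(c + d) *\<^sub>C x = c *\<^sub>C x + d *\<^sub>C x"
    and scaleC_scaleC: "c *\<^sub>C (d *\<^sub>C x) = (c * d) *\<^sub>C x"
    and scaleC_of_real: "complex_of_real r *\<^sub>C x = r *\<^sub>R x"
    and mult_scaleC_left: "(c *\<^sub>C x) * y = c *\<^sub>C (x * y)"
    and mult_scaleC_right: "x * (c *\<^sub>C y) = c *\<^sub>C (x * y)"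
    and norm_scaleC: "norm (c *\<^sub>C x) = cmod c * norm x"
    and star_star: "star (star x) = x"
    and star_add: "star (x + y) = star x + star y"
    and star_scaleC: "star (c *\<^sub>C x) = cnj c *\<^sub>C star x"
    and star_mult: "star (x * y) = star y * star x"
    and cstar_identity: "norm (star x * x) = (norm x)\<^sup>2"

instantiation complex :: cstar_algebra
begin
definition scaleC_complex :: "complex \<Rightarrow> complex \<Rightarrow> complex" where "scaleC_complex = (*)"
definition star_complex :: "complex \<Rightarrow> complex" where "star_complex = cnj"
instance
  by standard
    (simp_all add: scaleC_complex_def star_complex_def algebra_simps norm_mult
      scaleR_conv_of_real power2_eq_square)
end

definition self_adjoint :: "'a::cstar_algebra \<Rightarrow> bool" where
  "self_adjoint x \<longleftrightarrow> star x = x"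

definition pos :: "'a::cstar_algebra set" where
  "pos = {star b * b | b. True}"

definition cle :: "'a::cstar_algebra \<Rightarrow> 'a \<Rightarrow> bool"  (infix \<open>\<sqsubseteq>\<^sub>A\<close> 50) where
  "x \<sqsubseteq>\<^sub>A y \<longleftrightarrow> y - x \<in> pos"

definition star_subspace :: "'a::cstar_algebra set \<Rightarrow> bool" where
  "star_subspace V \<longleftrightarrow> 0 \<in> V \<and> (\<forall>x\<in>V. \<forall>y\<in>V. x + y \<in> V) \<and>
     (\<forall>c. \<forall>x\<in>V. c *\<^sub>C x \<in> V) \<and> (\<forall>x\<in>V. star x \<in> V)"


section \<open>Matrices over a C*-algebra\<close>

definition mats :: "nat \<Rightarrow> 'a set \<Rightarrow> 'a mat set" where
  "mats n V = {x \<in> carrier_mat n n. \<forall>i<n. \<forall>j<n. x $$ (i, j) \<in> V}"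

definition mat_scaleC :: "complex \<Rightarrow> 'a::cstar_algebra mat \<Rightarrow> 'a mat" where
  "mat_scaleC c x = map_mat (\<lambda>a. c *\<^sub>C a) x"

definition mat_star :: "'a::cstar_algebra mat \<Rightarrow> 'a mat" where
  "mat_star x = map_mat star (transpose_mat x)"

definition amp :: "nat \<Rightarrow> 'a::zero \<Rightarrow> 'a mat" where
  "amp n e = mat n n (\<lambda>(i, j). if i = j then e else 0)"

definition mats_pos :: "nat \<Rightarrow> 'a::cstar_algebra set \<Rightarrow> 'a mat set" where
  "mats_pos n V = mats n V \<inter> {mat_star y * y | y. y \<in> carrier_mat n n}"

definition is_cstar_norm :: "nat \<Rightarrow> ('a::cstar_algebra mat \<Rightarrow> real) \<Rightarrow> bool" where
  "is_cstar_norm n N \<longleftrightarrow>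
     (\<forall>x\<in>carrier_mat n n. 0 \<le> N x \<and> (N x = 0 \<longleftrightarrow> x = 0\<^sub>m n n)) \<and>
     (\<forall>x\<in>carrier_mat n n. \<forall>y\<in>carrier_mat n n. N (x + y) \<le> N x + N y) \<and>
     (\<forall>c. \<forall>x\<in>carrier_mat n n. N (mat_scaleC c x) = cmod c * N x) \<and>
     (\<forall>x\<in>carrier_mat n n. \<forall>y\<in>carrier_mat n n. N (x * y) \<le> N x * N y) \<and>
     (\<forall>x\<in>carrier_mat n n. N (mat_star x * x) = (N x)\<^sup>2) \<and>
     (\<forall>X. (\<forall>k. X k \<in> carrier_mat n n) \<and>
          (\<forall>\<epsilon>>0. \<exists>K::nat. \<forall>i\<ge>K. \<forall>j\<ge>K. N (X i - X j) < \<epsilon>) \<longrightarrow>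
          (\<exists>L\<in>carrier_mat n n. (\<lambda>k. N (X k - L)) \<longlonglongrightarrow> 0))"

text \<open>The norm of the C*-algebra of \<open>n \<times> n\<close> matrices over \<open>'a\<close>: these matrices carry
  exactly one complete C*-norm.\<close>

definition mat_norm :: "'a::cstar_algebra mat \<Rightarrow> real" where
  "mat_norm x = (THE r. \<exists>N. is_cstar_norm (dim_row x) N \<and> r = N x)"


section \<open>Approximate order units\<close>

definition directed_set :: "'i set \<Rightarrow> ('i \<Rightarrow> 'i \<Rightarrow> bool) \<Rightarrow> bool" where
  "directed_set \<Lambda> rel \<longleftrightarrow> \<Lambda> \<noteq> {} \<and> (\<forall>l\<in>\<Lambda>. rel l l) \<and>
     (\<forall>l\<in>\<Lambda>. \<forall>m\<in>\<Lambda>. \<forall>k\<in>\<Lambda>. rel l m \<longrightarrow> rel m k \<longrightarrow> rel l k) \<and>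
     (\<forall>l\<in>\<Lambda>. \<forall>m\<in>\<Lambda>. \<exists>k\<in>\<Lambda>. rel l k \<and> rel m k)"

definition approximate_order_unit ::
  "'a::cstar_algebra set \<Rightarrow> 'i set \<Rightarrow> ('i \<Rightarrow> 'i \<Rightarrow> bool) \<Rightarrow> ('i \<Rightarrow> 'a) \<Rightarrow> bool" where
  "approximate_order_unit V \<Lambda> rel e \<longleftrightarrow> directed_set \<Lambda> rel \<and>
     (\<forall>l\<in>\<Lambda>. e l \<in> V \<inter> pos) \<and>
     (\<forall>l\<in>\<Lambda>. \<forall>m\<in>\<Lambda>. rel l m \<longrightarrow> e l \<sqsubseteq>\<^sub>A e m) \<and>
     (\<forall>x\<in>V. self_adjoint x \<longrightarrow>
        (\<exists>t>0. \<exists>l\<in>\<Lambda>. - (t *\<^sub>R e l) \<sqsubseteq>\<^sub>A x \<and> x \<sqsubseteq>\<^sub>A t *\<^sub>R e l))"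

text \<open>The infimum is taken in the extended reals, so that it is \<open>\<infinity>\<close> over the empty set.
  The bound \<open>0 \<le> t\<close> only matters when some \<open>e l\<close> is zero: then every real \<open>t\<close> would be
  admissible for \<open>x = 0\<close>.\<close>

definition norm_defining ::
  "'a::cstar_algebra set \<Rightarrow> 'i set \<Rightarrow> ('i \<Rightarrow> 'a) \<Rightarrow> bool" where
  "norm_defining V \<Lambda> e \<longleftrightarrow>
     (\<forall>n\<ge>1. \<forall>x\<in>mats n V. ereal (mat_norm x) =
        Inf (ereal ` {t. 0 \<le> t \<and> (\<exists>l\<in>\<Lambda>.
          four_block_mat (amp n (t *\<^sub>R e l)) x (mat_star x) (amp n (t *\<^sub>R e l))
            \<in> mats_pos (2 * n) V)}))"


section \<open>Ordered normed real vector spaces\<close>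

record 'v ordered_normed_space =
  vectors :: "'v set"
  vadd :: "'v \<Rightarrow> 'v \<Rightarrow> 'v"
  vscale :: "real \<Rightarrow> 'v \<Rightarrow> 'v"
  vnorm :: "'v \<Rightarrow> real"
  pos_cone :: "'v set"

definition vcoset :: "'v ordered_normed_space \<Rightarrow> 'v set \<Rightarrow> 'v \<Rightarrow> 'v set" where
  "vcoset X W x = vadd X x ` W"

text \<open>The summand \<open>w\<close> in the scalar multiplication makes \<open>0 \<cdot> C\<close> the coset \<open>W\<close> rather
  than \<open>{0}\<close>.\<close>

definition quotient_space ::
  "'v ordered_normed_space \<Rightarrow> 'v set \<Rightarrow> 'v set ordered_normed_space" where
  "quotient_space X W =
     \<lparr> vectors = vcoset X W ` vectors X,
       vadd = (\<lambda>C D. {vadd X x y | x y. x \<in> C \<and> y \<in> D}),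
       vscale = (\<lambda>r C. {vadd X (vscale X r x) w | x w. x \<in> C \<and> w \<in> W}),
       vnorm = (\<lambda>C. Inf (vnorm X ` C)),
       pos_cone = vcoset X W ` pos_cone X \<rparr>"

definition isometric_order_isomorphism ::
  "('v \<Rightarrow> 'w) \<Rightarrow> 'v ordered_normed_space \<Rightarrow> 'w ordered_normed_space \<Rightarrow> bool" where
  "isometric_order_isomorphism f X Y \<longleftrightarrow>
     bij_betw f (vectors X) (vectors Y) \<and>
     (\<forall>x\<in>vectors X. \<forall>y\<in>vectors X. f (vadd X x y) = vadd Y (f x) (f y)) \<and>
     (\<forall>r. \<forall>x\<in>vectors X. f (vscale X r x) = vscale Y r (f x)) \<and>
     (\<forall>x\<in>vectors X. vnorm Y (f x) = vnorm X x) \<and>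
     (\<forall>x\<in>vectors X. f x \<in> pos_cone Y \<longleftrightarrow> x \<in> pos_cone X)"


section \<open>Duals of matrix spaces\<close>

text \<open>Functionals on \<open>mats n V\<close> are represented by functions vanishing outside \<open>mats n V\<close>.\<close>

definition mat_dual :: "nat \<Rightarrow> 'a::cstar_algebra set \<Rightarrow> ('a mat \<Rightarrow> complex) set" where
  "mat_dual n V = {\<phi>.
     (\<forall>x. x \<notin> mats n V \<longrightarrow> \<phi> x = 0) \<and>
     (\<forall>x\<in>mats n V. \<forall>y\<in>mats n V. \<phi> (x + y) = \<phi> x + \<phi> y) \<and>
     (\<forall>c. \<forall>x\<in>mats n V. \<phi> (mat_scaleC c x) = c * \<phi> x) \<and>
     (\<exists>K. \<forall>x\<in>mats n V. cmod (\<phi> x) \<le> K * mat_norm x)}"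

definition dual_norm :: "nat \<Rightarrow> 'a::cstar_algebra set \<Rightarrow> ('a mat \<Rightarrow> complex) \<Rightarrow> real" where
  "dual_norm n V \<phi> = Sup {cmod (\<phi> x) | x. x \<in> mats n V \<and> mat_norm x \<le> 1}"

definition hermitian_functionals ::
  "nat \<Rightarrow> 'a::cstar_algebra set \<Rightarrow> ('a mat \<Rightarrow> complex) set" where
  "hermitian_functionals n V = {\<phi> \<in> mat_dual n V. \<forall>x\<in>mats n V. \<phi> (mat_star x) = cnj (\<phi> x)}"

definition dual_h ::
  "nat \<Rightarrow> 'a::cstar_algebra set \<Rightarrow> ('a mat \<Rightarrow> complex) ordered_normed_space" where
  "dual_h n V =
     \<lparr> vectors = hermitian_functionals n V,
       vadd = (\<lambda>\<phi> \<psi> x. \<phi> x + \<psi> x),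
       vscale = (\<lambda>r \<phi> x. complex_of_real r * \<phi> x),
       vnorm = dual_norm n V,
       pos_cone = {\<phi> \<in> hermitian_functionals n V. \<forall>x\<in>mats_pos n V. \<phi> x \<in> \<real>\<^sub>\<ge>\<^sub>0} \<rparr>"

definition annihilator_h :: "nat \<Rightarrow> 'a::cstar_algebra set \<Rightarrow> ('a mat \<Rightarrow> complex) set" where
  "annihilator_h n E = {\<eta> \<in> hermitian_functionals n UNIV. \<forall>x\<in>mats n E. \<eta> x = 0}"

definition restrict_functional ::
  "nat \<Rightarrow> 'a set \<Rightarrow> ('a mat \<Rightarrow> complex) \<Rightarrow> 'a mat \<Rightarrow> complex" where
  "restrict_functional n E \<phi> = (\<lambda>x. if x \<in> mats n E then \<phi> x else 0)"

end

theory Submission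
  imports Defs
begin

text \<open>
  Two hermitian functionals on \<open>M\<^sub>n(A)\<close> have the same restriction to \<open>M\<^sub>n(E)\<close> exactly when they
  differ by an element of the annihilator, so restriction induces a linear injection and the theorem
  is a statement about extensions: every hermitian \<open>\<psi>\<close> on \<open>M\<^sub>n(E)\<close> needs a hermitian extension \<open>\<Phi>\<close>
  to \<open>M\<^sub>n(A)\<close> with \<open>\<parallel>\<Phi>\<parallel> \<le> \<parallel>\<psi>\<parallel>\<close> that is positive if \<open>\<psi>\<close> is (see
  \<open>restriction_isometric_order_isomorphism\<close>). The Hahn--Banach theorem, followed by averaging with
  the adjoint functional, gives an extension of the same norm (\<open>hermitian_functional_extension\<close>).

  Positivity is then automatic, because the order unit works like an approximate unit. Write
  \<open>e\<^sub>l\<close> also for the diagonal matrix with entries \<open>e\<^sub>l\<close>. The norm-defining property gives two facts: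
  \<open>\<parallel>e\<^sub>l\<parallel> \<le> 1\<close>, and every self-adjoint matrix \<open>h\<close> over \<open>\<A>\<close> with \<open>\<parallel>h\<parallel> < 1\<close> lies below some \<open>e\<^sub>l\<close>.
  Hence a positive \<open>\<psi>\<close> on \<open>M\<^sub>n(E)\<close> satisfies \<open>\<parallel>\<psi>\<parallel> = sup\<^sub>l \<psi>(e\<^sub>l)\<close>
  (\<open>positive_functional_norm_order_unit\<close>). Now let \<open>a \<ge> 0\<close> in \<open>M\<^sub>n(A)\<close> with \<open>\<parallel>a\<parallel> < 1\<close>. Approximate it by
  a self-adjoint \<open>b\<close> over \<open>\<A>\<close> with \<open>\<parallel>b\<parallel> < 1\<close> and choose \<open>l\<close> with \<open>b \<le> e\<^sub>l\<close> and \<open>\<psi>(e\<^sub>l)\<close> close to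
  \<open>\<parallel>\<psi>\<parallel>\<close>. From \<open>0 \<le> e\<^sub>l - b \<le> e\<^sub>l + (a - b)\<close> follows \<open>\<parallel>e\<^sub>l - b\<parallel> \<le> 1 + \<parallel>a - b\<parallel>\<close>, so
  \<open>\<Phi>(b) = \<psi>(e\<^sub>l) - \<Phi>(e\<^sub>l - b) \<ge> \<psi>(e\<^sub>l) - \<parallel>\<psi>\<parallel> (1 + \<parallel>a - b\<parallel>)\<close>, which is almost nonnegative; in the
  limit \<open>\<Phi>(a) \<ge> 0\<close> (\<open>norm_preserving_extension_positive\<close>).

  This argument uses three facts about C*-algebras: sums of elements \<open>y\<^sup>*y\<close> are again of this form,
  the norm is monotone on positive elements, and *-homomorphisms are contractive. They are derived
  here from the axioms by elementary means. Their analytic core is an iteration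
  converging to \<open>1 - \<surd>(1 - c)\<close> (\<open>quadratic_root\<close>); it replaces spectra and functional calculus. Contractivity also
  shows that \<open>M\<^sub>n(A)\<close> has at most one complete C*-norm and that this norm is bounded by the sum of the
  norms of the entries.

  The matrix size \<open>n\<close> is a number and not a type, whereas C*-algebras form a type class. For this
  reason all C*-normed matrix algebras over \<open>A\<close>, of every size, are put into one C*-algebra, their
  bounded product; each of them is a direct summand, and results about C*-algebras pass from the
  product to its summands.
\<close>

section \<open>Linearity and isometry of the involution\<close>

lemma star_zero [simp]: "star (0::'a::cstar_algebra) = 0"
  by (metis add_cancel_right_right star_add)

lemma star_minus: "star (- x) = - star (x::'a::cstar_algebra)"
  by (metis add.right_inverse minus_unique star_add star_zero)

lemma star_diff: "star (x - y) = star x - star (y::'a::cstar_algebra)"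
  by (metis add_uminus_conv_diff star_add star_minus)

lemma star_scaleR: "star (r *\<^sub>R x) = r *\<^sub>R star (x::'a::cstar_algebra)"
  by (metis complex_cnj_complex_of_real scaleC_of_real star_scaleC)

lemma scaleC_zero_right [simp]: "c *\<^sub>C (0::'a::cstar_algebra) = 0"
  using scaleC_add_right[of c "0::'a" 0] by simp

lemma scaleC_zero_left [simp]: "0 *\<^sub>C (x::'a::cstar_algebra) = 0"
  using scaleC_of_real[of 0 x] by simp

lemma scaleC_one [simp]: "1 *\<^sub>C (x::'a::cstar_algebra) = x"
  using scaleC_of_real[of 1 x] by simp

lemma scaleC_minus_right: "c *\<^sub>C (- x) = - (c *\<^sub>C (x::'a::cstar_algebra))"
  using scaleC_add_right[of c x "- x"] by (simp add: eq_neg_iff_add_eq_0 add.commute)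

lemma scaleC_minus_left: "(- c) *\<^sub>C x = - (c *\<^sub>C (x::'a::cstar_algebra))"
  using scaleC_add_left[of c "- c" x] by (simp add: eq_neg_iff_add_eq_0 add.commute)

lemma scaleC_diff_right: "c *\<^sub>C (x - y) = c *\<^sub>C x - c *\<^sub>C (y::'a::cstar_algebra)"
  using scaleC_add_right[of c x "- y"] by (simp add: scaleC_minus_right)

lemma scaleC_diff_left: "(c - d) *\<^sub>C x = c *\<^sub>C x - d *\<^sub>C (x::'a::cstar_algebra)"
  using scaleC_add_left[of c "- d" x] by (simp add: scaleC_minus_left)

lemma scaleC_scaleR: "c *\<^sub>C (r *\<^sub>R x) = r *\<^sub>R (c *\<^sub>C (x::'a::cstar_algebra))"
  by (metis mult.commute scaleC_of_real scaleC_scaleC)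

lemma norm_star [simp]: "norm (star x) = norm (x::'a::cstar_algebra)"
proof -
  have le: "norm y \<le> norm (star y)" for y :: 'a
  proof (cases "y = 0")
    case False
    have "norm y * norm y \<le> norm (star y) * norm y"
      using cstar_identity[of y] norm_mult_ineq[of "star y" y] by (simp add: power2_eq_square)
    then show ?thesis using False by simp
  qed simp
  show ?thesis using le[of x] le[of "star x"] by (simp add: star_star)
qed

lemma bounded_linear_star: "bounded_linear (star :: 'a::cstar_algebra \<Rightarrow> 'a)"
  by (rule bounded_linear_intro[of _ 1]) (simp_all add: star_add star_scaleR)

lemma norm_square_self_adjoint:
  "star x = x \<Longrightarrow> norm (x * x) = (norm x)\<^sup>2" for x :: "'a::cstar_algebra"
  by (metis cstar_identity)

section \<open>Square roots by iteration\<close>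

text \<open>
  Fixed point iteration for \<open>2k = c + k\<^sup>2\<close>. The solution is \<open>k = 1 - \<surd>(1 - c)\<close>, in a form that makes
  sense without a unit.
\<close>
primrec root_iterate :: "'a::cstar_algebra \<Rightarrow> nat \<Rightarrow> 'a" where
  "root_iterate c 0 = 0"
| "root_iterate c (Suc m) = (1/2) *\<^sub>R (c + root_iterate c m * root_iterate c m)"

text \<open>
  The same iteration for the number \<open>1\<close> in place of \<open>c\<close> gives an increasing sequence \<open>s\<close> of reals
  with limit \<open>1\<close>. It dominates the iteration for \<open>c\<close>: both the norms and the norms of the increments
  are bounded by those of \<open>s\<close>. This covers the boundary case \<open>\<parallel>c\<parallel> = 1\<close>, in which the iteration is
  not a contraction; square roots of positive elements that are not invertible depend on it.
\<close>
lemma root_iterate_limit: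
  fixes c :: "'a::cstar_algebra"
  assumes "norm c \<le> 1"
  obtains k where "root_iterate c \<longlonglongrightarrow> k" and "norm k \<le> 1" and "2 *\<^sub>R k = c + k * k"
proof -
  define s where "s = rec_nat (0::real) (\<lambda>_ t. (1 + t * t) / 2)"
  have s0: "s 0 = 0" and sS: "s (Suc m) = (1 + s m * s m) / 2" for m
    by (simp_all add: s_def)
  have s_bounds: "0 \<le> s m \<and> s m \<le> 1" for m
  proof (induction m)
    case (Suc m)
    then have "s m * s m \<le> 1" by (simp add: mult_le_one)
    with Suc show ?case by (simp add: sS)
  qed (simp add: s0)
  have s_mono: "s m \<le> s (Suc m)" for m
    using sum_power2_ge_zero[of "1 - s m" 0] by (simp add: sS power2_eq_square algebra_simps)
  have "incseq s" using s_mono by (rule incseq_SucI)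
  then obtain L where "s \<longlonglongrightarrow> L"
    using incseq_convergent[of s 1] s_bounds by blast
  then have "Cauchy s" by (rule LIMSEQ_imp_Cauchy)
  have bound: "norm (root_iterate c m) \<le> s m" for m
  proof (induction m)
    case (Suc m)
    have "norm (root_iterate c m * root_iterate c m) \<le> s m * s m"
      using Suc s_bounds[of m] by (intro order_trans[OF norm_mult_ineq] mult_mono) auto
    then show ?case
      using norm_triangle_ineq[of c "root_iterate c m * root_iterate c m"] assms by (simp add: sS)
  qed (simp add: s0)
  have step: "norm (root_iterate c (Suc m) - root_iterate c m) \<le> s (Suc m) - s m" for m
  proof (induction m)
    case 0
    show ?case using assms by (simp add: s0 sS)
  next
    case (Suc m)
    let ?a = "root_iterate c (Suc m)" and ?b = "root_iterate c m"
    have nb: "norm ?a \<le> s (Suc m)" "norm ?b \<le> s m" by (rule bound)+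
    have "norm (?a * (?a - ?b) + (?a - ?b) * ?b)
        \<le> s (Suc m) * (s (Suc m) - s m) + (s (Suc m) - s m) * s m"
      using nb Suc s_bounds[of m] s_bounds[of "Suc m"] s_mono[of m]
      by (intro order_trans[OF norm_triangle_ineq] add_mono order_trans[OF norm_mult_ineq] mult_mono)
        auto
    moreover have "root_iterate c (Suc (Suc m)) - ?a = (1/2) *\<^sub>R (?a * (?a - ?b) + (?a - ?b) * ?b)"
    proof -
      have "root_iterate c (Suc (Suc m)) - ?a = (1/2) *\<^sub>R (c + ?a * ?a) - (1/2) *\<^sub>R (c + ?b * ?b)"
        by (simp only: root_iterate.simps)
      also have "\<dots> = (1/2) *\<^sub>R (?a * (?a - ?b) + (?a - ?b) * ?b)"
        by (simp only: scaleR_diff_right[symmetric]) (simp add: algebra_simps del: root_iterate.simps)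
      finally show ?thesis .
    qed
    ultimately have "norm (root_iterate c (Suc (Suc m)) - ?a)
        \<le> (1/2) * (s (Suc m) * (s (Suc m) - s m) + (s (Suc m) - s m) * s m)"
      by (simp del: root_iterate.simps)
    also have "\<dots> = s (Suc (Suc m)) - s (Suc m)"
    proof -
      have "s (Suc (Suc m)) - s (Suc m) = (1 + s (Suc m) * s (Suc m)) / 2 - (1 + s m * s m) / 2"
        using sS[of "Suc m"] sS[of m] by linarith
      then show ?thesis by (simp add: field_simps)
    qed
    finally show ?case .
  qed
  have diff: "norm (root_iterate c (m + j) - root_iterate c m) \<le> s (m + j) - s m" for m j
  proof (induction j)
    case (Suc j)
    then show ?case
      using norm_triangle_ineq[of "root_iterate c (Suc (m + j)) - root_iterate c (m + j)"
          "root_iterate c (m + j) - root_iterate c m"] step[of "m + j"]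
      by (simp del: root_iterate.simps)
  qed simp
  have "Cauchy (root_iterate c)"
  proof (rule metric_CauchyI)
    fix e :: real assume "e > 0"
    then obtain M where M: "\<And>m n. m \<ge> M \<Longrightarrow> n \<ge> M \<Longrightarrow> dist (s m) (s n) < e"
      using metric_CauchyD[OF \<open>Cauchy s\<close>] by blast
    have le: "dist (root_iterate c (m + j)) (root_iterate c m) < e" if "m \<ge> M" for m j
      using diff[of m j] M[of "m + j" m] that by (auto simp: dist_norm)
    have "dist (root_iterate c m) (root_iterate c n) < e" if "m \<ge> M" "n \<ge> M" for m n
      using le[of m "n - m"] le[of n "m - n"] that by (cases "m \<le> n") (simp_all add: dist_commute)
    then show "\<exists>M. \<forall>m\<ge>M. \<forall>n\<ge>M. dist (root_iterate c m) (root_iterate c n) < e" by blast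
  qed
  then obtain k where k: "root_iterate c \<longlonglongrightarrow> k"
    unfolding Cauchy_convergent_iff convergent_def by blast
  have "norm k \<le> 1"
  proof (rule LIMSEQ_le_const2[OF tendsto_norm[OF k]])
    show "\<exists>M. \<forall>m\<ge>M. norm (root_iterate c m) \<le> 1"
      using order_trans[OF bound] s_bounds by blast
  qed
  moreover have "(\<lambda>m. root_iterate c (Suc m)) \<longlonglongrightarrow> (1/2) *\<^sub>R (c + k * k)"
    unfolding root_iterate.simps by (intro tendsto_intros k)
  then have "k = (1/2) *\<^sub>R (c + k * k)"
    by (rule LIMSEQ_unique[OF LIMSEQ_Suc[OF k]])
  then have "2 *\<^sub>R k = 2 *\<^sub>R ((1/2) *\<^sub>R (c + k * k))" by simp
  then have "2 *\<^sub>R k = c + k * k" by simp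
  ultimately show thesis using that k by blast
qed

lemma root_iterate_commute: "b * c = c * b \<Longrightarrow> b * root_iterate c m = root_iterate c m * b"
proof (induction m)
  case (Suc m)
  then have "b * (root_iterate c m * root_iterate c m) = root_iterate c m * root_iterate c m * b"
    by (metis mult.assoc)
  with Suc show ?case by (simp add: algebra_simps)
qed simp

lemma root_iterate_star: "star c = c \<Longrightarrow> star (root_iterate c m) = root_iterate c m"
  by (induction m) (simp_all add: star_scaleR star_add star_mult)

lemma quadratic_root:
  fixes c :: "'a::cstar_algebra"
  assumes "norm c \<le> 1" and "star c = c"
  obtains k where "2 *\<^sub>R k = c + k * k" and "norm k \<le> 1" and "star k = k"
    and "\<And>b. b * c = c * b \<Longrightarrow> b * k = k * b"
proof -
  obtain k where k: "root_iterate c \<longlonglongrightarrow> k" "norm k \<le> 1" "2 *\<^sub>R k = c + k * k"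
    using root_iterate_limit[OF assms(1)] .
  have "star k = k"
  proof (rule LIMSEQ_unique[OF _ k(1)])
    have "(\<lambda>m. star (root_iterate c m)) \<longlonglongrightarrow> star k"
      by (rule bounded_linear.tendsto[OF bounded_linear_star k(1)])
    then show "root_iterate c \<longlonglongrightarrow> star k" by (simp add: root_iterate_star[OF assms(2)])
  qed
  moreover have "b * k = k * b" if "b * c = c * b" for b
  proof (rule LIMSEQ_unique)
    show "(\<lambda>m. b * root_iterate c m) \<longlonglongrightarrow> b * k" by (intro tendsto_intros k(1))
    have "(\<lambda>m. root_iterate c m * b) \<longlonglongrightarrow> k * b" by (intro tendsto_intros k(1))
    then show "(\<lambda>m. b * root_iterate c m) \<longlonglongrightarrow> k * b"
      by (simp add: root_iterate_commute[OF that])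
  qed
  ultimately show thesis using that k by blast
qed

section \<open>Positive elements of unital C*-algebras\<close>
class unital_cstar_algebra = cstar_algebra + real_normed_algebra_1

lemma star_one [simp]: "star (1::'a::unital_cstar_algebra) = 1"
  by (metis mult.left_neutral mult.right_neutral star_mult star_star)

text \<open>The element \<open>u = x + iy\<close> satisfies \<open>u\<^sup>*u = 1\<close>, so \<open>\<parallel>u\<parallel> = 1\<close>, and \<open>x\<close> is the real part of \<open>u\<close>.\<close>
lemma norm_le_one_if_squares_sum_one:
  fixes x y :: "'a::unital_cstar_algebra"
  assumes "star x = x" "star y = y" "x * y = y * x" "x * x + y * y = 1"
  shows "norm x \<le> 1"
proof -
  define u where "u = x + \<i> *\<^sub>C y"
  have su: "star u = x - \<i> *\<^sub>C y"
    by (simp add: u_def star_add star_scaleC assms scaleC_minus_left)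
  have "star u * u = 1"
    unfolding su unfolding u_def
    by (simp add: algebra_simps mult_scaleC_left mult_scaleC_right scaleC_scaleC assms
        scaleC_minus_left scaleC_diff_right scaleC_add_right)
  then have "norm u = 1"
    using cstar_identity[of u] norm_ge_zero[of u] by (auto simp: power2_eq_1_iff)
  have "2 *\<^sub>R x = u + star u" unfolding su by (simp add: u_def scaleR_2)
  then have "norm (2 *\<^sub>R x) \<le> norm u + norm (star u)" by (metis norm_triangle_ineq)
  then show ?thesis using \<open>norm u = 1\<close> by simp
qed

text \<open>
  With spectra, \<open>\<parallel>t - p\<parallel> \<le> t\<close> says that the spectrum of \<open>p\<close> lies in \<open>[0, 2t]\<close>. In this form it is
  clear that positive elements form a cone; that they are the elements \<open>b\<^sup>*b\<close> is the main result of
  this section.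
\<close>
definition cone_positive :: "'a::unital_cstar_algebra \<Rightarrow> bool" where
  "cone_positive p \<longleftrightarrow> star p = p \<and> (\<exists>t\<ge>0. norm (of_real t - p) \<le> t)"

lemma cone_positive_add: "cone_positive p \<Longrightarrow> cone_positive q \<Longrightarrow> cone_positive (p + q)"
proof -
  assume "cone_positive p" "cone_positive q"
  then obtain s t where "star p = p" "star q = q" "s \<ge> 0" "t \<ge> 0"
    "norm (of_real s - p) \<le> s" "norm (of_real t - q) \<le> t"
    unfolding cone_positive_def by blast
  moreover from this have "norm (of_real (s + t) - (p + q)) \<le> s + t"
    using norm_triangle_ineq[of "of_real s - p" "of_real t - q"] by (simp add: algebra_simps)
  ultimately show ?thesis unfolding cone_positive_def by (metis add_nonneg_nonneg star_add)
qed

lemma cone_positive_scaleR: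
  assumes "cone_positive p" "0 \<le> r" shows "cone_positive (r *\<^sub>R p)"
proof -
  obtain t where "t \<ge> 0" "norm (of_real t - p) \<le> t" "star p = p"
    using assms unfolding cone_positive_def by blast
  moreover have "of_real (r * t) - r *\<^sub>R p = r *\<^sub>R (of_real t - p)"
    by (simp add: algebra_simps of_real_def)
  ultimately show ?thesis
    unfolding cone_positive_def using assms(2)
    by (auto simp: star_scaleR intro!: exI[of _ "r * t"] mult_left_mono)
qed

text \<open>
  After scaling to \<open>t = 1\<close>, let \<open>1 - k\<close> be the square root of \<open>1 - h\<^sup>2\<close>. Then
  \<open>h\<^sup>2 + (1 - k)\<^sup>2 = 1\<close>, whence \<open>\<parallel>1 - k\<parallel> \<le> 1\<close> and \<open>\<parallel>1 - h\<^sup>2\<parallel> \<le> \<parallel>1 - k\<parallel>\<^sup>2 \<le> 1\<close>.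
\<close>
lemma norm_real_minus_square_le:
  fixes h :: "'a::unital_cstar_algebra"
  assumes "star h = h" and "(norm h)\<^sup>2 \<le> t"
  shows "norm (of_real t - h * h) \<le> t"
proof (cases "t > 0")
  case False
  then have "(norm h)\<^sup>2 = 0" "t = 0"
    using assms(2) zero_le_power2[of "norm h"] by linarith+
  then show ?thesis by simp
next
  case True
  define x where "x = (1 / sqrt t) *\<^sub>R h"
  have hx: "h * h = t *\<^sub>R (x * x)" using True by (simp add: x_def)
  have sx: "star x = x" by (simp add: x_def star_scaleR assms)
  have "norm x ^ 2 \<le> 1" using assms(2) True by (simp add: x_def power_divide)
  then have "norm (x * x) \<le> 1" by (simp add: norm_square_self_adjoint sx)
  moreover have "star (x * x) = x * x" by (simp add: star_mult sx)
  ultimately obtain k where k: "2 *\<^sub>R k = x * x + k * k" "norm k \<le> 1" "star k = k"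
    "\<And>b. b * (x * x) = (x * x) * b \<Longrightarrow> b * k = k * b"
    using quadratic_root by blast
  have "x * k = k * x" by (rule k(4)) (simp add: mult.assoc)
  have sq: "(1 - k) * (1 - k) = 1 - x * x"
    using k(1) by (simp add: algebra_simps scaleR_2)
  have "norm (1 - k) \<le> 1"
    by (rule norm_le_one_if_squares_sum_one[of "1 - k" x])
      (use sq \<open>x * k = k * x\<close> in \<open>simp_all add: star_diff k(3) sx algebra_simps\<close>)
  then have "norm (1 - x * x) \<le> 1"
    using norm_mult_ineq[of "1 - k" "1 - k"] mult_le_one[of "norm (1 - k)" "norm (1 - k)"]
    by (simp add: sq)
  moreover have "of_real t - h * h = t *\<^sub>R (1 - x * x)"
    by (simp add: hx scaleR_diff_right of_real_def)
  ultimately show ?thesis using True by simp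
qed

lemma cone_positive_square: "star h = h \<Longrightarrow> cone_positive (h * h)"
  unfolding cone_positive_def
  by (metis norm_real_minus_square_le order_refl star_mult zero_le_power2)

text \<open>
  If \<open>\<parallel>t - p\<parallel> \<le> t\<close>, then \<open>p = t (1 - c)\<close> with \<open>\<parallel>c\<parallel> \<le> 1\<close>, and \<open>\<surd>t (1 - k)\<close> with \<open>2k = c + k\<^sup>2\<close> is a
  square root. It is positive because \<open>\<parallel>k\<parallel> \<le> 1\<close>.
\<close>
lemma cone_positive_sqrt:
  assumes "cone_positive p"
  obtains s where "cone_positive s" and "s * s = p" and "\<And>b. b * p = p * b \<Longrightarrow> b * s = s * b"
proof -
  obtain t where t: "t \<ge> 0" "norm (of_real t - p) \<le> t" and sp: "star p = p"
    using assms unfolding cone_positive_def by blast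
  show thesis
  proof (cases "t = 0")
    case True
    with t have "p = 0" by simp
    with that[of 0] show thesis using assms by simp
  next
    case False
    with t have t0: "t > 0" by simp
    define c where "c = 1 - (1 / t) *\<^sub>R p"
    have "of_real t - p = t *\<^sub>R c" using t0 by (simp add: c_def scaleR_diff_right of_real_def)
    with t t0 have "norm c \<le> 1" by simp
    moreover have "star c = c" by (simp add: c_def star_diff star_scaleR sp)
    ultimately obtain k where k: "2 *\<^sub>R k = c + k * k" "norm k \<le> 1" "star k = k"
      "\<And>b. b * c = c * b \<Longrightarrow> b * k = k * b"
      using quadratic_root by blast
    define s where "s = sqrt t *\<^sub>R (1 - k)"
    have "(1 - k) * (1 - k) = 1 - c"
      using k(1) by (simp add: algebra_simps scaleR_2)
    then have "s * s = p" using t0 by (simp add: s_def c_def)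
    moreover have "norm (of_real (sqrt t) - s) \<le> sqrt t"
      using k(2) t0 by (simp add: s_def scaleR_diff_right of_real_def)
    then have "cone_positive s"
      unfolding cone_positive_def
      using t0 by (auto simp: s_def star_scaleR star_diff k(3) intro!: exI[of _ "sqrt t"])
    moreover have "b * s = s * b" if "b * p = p * b" for b
    proof -
      have "b * c = c * b" using that by (simp add: c_def algebra_simps)
      then show ?thesis using k(4)[of b] by (simp add: s_def algebra_simps)
    qed
    ultimately show thesis using that by blast
  qed
qed

lemma cone_positive_self_adjoint: "cone_positive p \<Longrightarrow> star p = p"
  by (simp add: cone_positive_def)

text \<open>
  For \<open>t > 0\<close>, commuting square roots \<open>x\<close> of \<open>p\<close> and \<open>y\<close> of \<open>t - p\<close> satisfy \<open>x\<^sup>2 + y\<^sup>2 = t\<close>, so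
  \<open>\<parallel>p\<parallel> = \<parallel>x\<parallel>\<^sup>2 \<le> t\<close>. The case \<open>t = 0\<close> follows by approximation.
\<close>
lemma norm_le_if_cone_positive:
  assumes p: "cone_positive p" and tp: "cone_positive (of_real t - p)" and "0 \<le> t"
  shows "norm p \<le> t"
proof -
  have main: "norm p \<le> t" if t: "0 < t" and tp: "cone_positive (of_real t - p)" for t
  proof -
    obtain x where x: "cone_positive x" "x * x = p" "\<And>b. b * p = p * b \<Longrightarrow> b * x = x * b"
      using cone_positive_sqrt[OF p] by blast
    obtain y where y: "cone_positive y" "y * y = of_real t - p"
      "\<And>b. b * (of_real t - p) = (of_real t - p) * b \<Longrightarrow> b * y = y * b"
      using cone_positive_sqrt[OF tp] by blast
    have "x * p = p * x" by (metis x(2) mult.assoc)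
    then have xy: "x * y = y * x"
      by (intro y(3)) (simp add: algebra_simps of_real_def)
    let ?r = "1 / sqrt t"
    have "norm (?r *\<^sub>R x) \<le> 1"
    proof (rule norm_le_one_if_squares_sum_one[of _ "?r *\<^sub>R y"])
      show "(?r *\<^sub>R x) * (?r *\<^sub>R x) + (?r *\<^sub>R y) * (?r *\<^sub>R y) = 1"
      proof -
        have "(?r *\<^sub>R x) * (?r *\<^sub>R x) + (?r *\<^sub>R y) * (?r *\<^sub>R y) = (1 / t) *\<^sub>R (x * x + y * y)"
          using t by (simp add: scaleR_add_right)
        also have "\<dots> = 1" using t by (simp add: x(2) y(2) of_real_def)
        finally show ?thesis .
      qed
    qed (simp_all add: star_scaleR cone_positive_self_adjoint x(1) y(1) xy)
    then have "norm x \<le> sqrt t" using t by simp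
    then have "norm x ^ 2 \<le> sqrt t ^ 2" by (simp add: power_mono)
    then have "norm x ^ 2 \<le> t" using t by simp
    moreover have "norm p = norm x ^ 2"
      using norm_square_self_adjoint[of x] x(1,2) by (simp add: cone_positive_self_adjoint)
    ultimately show ?thesis by simp
  qed
  have "norm p \<le> t + e" if "e > 0" for e
  proof (rule main)
    have "cone_positive (of_real e :: 'a)"
      unfolding cone_positive_def using that
      by (auto intro!: exI[of _ e]) (simp add: of_real_def star_scaleR)
    then have "cone_positive ((of_real t - p) + of_real e)" using tp by (rule cone_positive_add[rotated])
    then show "cone_positive (of_real (t + e) - p)" by (simp add: algebra_simps)
  qed (use that assms in simp)
  then show ?thesis by (rule field_le_epsilon)
qed

lemma cone_positive_norm_minus: "star q = q \<Longrightarrow> cone_positive (of_real (norm q) - q)"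
  unfolding cone_positive_def
  by (auto simp: star_diff of_real_def star_scaleR intro!: exI[of _ "norm q"])

lemma cone_positive_norm_mono:
  assumes p: "cone_positive p" and qp: "cone_positive (q - p)"
  shows "norm p \<le> norm q"
proof (rule norm_le_if_cone_positive[OF p])
  have "star q = q"
    using cone_positive_self_adjoint[OF cone_positive_add[OF p qp]] by simp
  from cone_positive_add[OF cone_positive_norm_minus[OF this] qp]
  show "cone_positive (of_real (norm q) - p)" by (simp add: algebra_simps)
qed simp

text \<open>
  In terms of spectra: \<open>d\<^sup>*d\<close> and \<open>dd\<^sup>*\<close> have the same nonzero spectrum, so one cannot be negative and
  the other positive. The proof compares norms instead. Put \<open>u = q\<^sup>2 = - d\<^sup>*d\<close> and
  \<open>a = \<parallel>d\<parallel>\<^sup>2 = \<parallel>u\<parallel> = \<parallel>dd\<^sup>*\<parallel>\<close>. Since \<open>dd\<^sup>* \<ge> 0\<close>, multiplication by \<open>a - dd\<^sup>*\<close> has norm at most \<open>a\<close>, while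
  \<open>(a - dd\<^sup>*) d = d (a + u)\<close>. Taking squares of norms, \<open>\<parallel>(a + u) u (a + u)\<parallel> \<le> a\<^sup>3\<close>. The left-hand element
  dominates \<open>2a u\<^sup>2\<close>, whose norm is \<open>2a\<^sup>3\<close>; so \<open>a = 0\<close>.
\<close>
lemma zero_if_star_mult_neg_square:
  fixes d :: "'a::unital_cstar_algebra"
  assumes q: "star q = q" and dd: "star d * d = - (q * q)" and pos: "cone_positive (d * star d)"
  shows "d = 0"
proof (rule ccontr)
  assume "d \<noteq> 0"
  define a where "a = (norm d)\<^sup>2"
  have a0: "a > 0" using \<open>d \<noteq> 0\<close> by (simp add: a_def)
  define u where "u = q * q"
  have nu: "norm u = a" using dd cstar_identity[of d] by (simp add: u_def a_def)
  have nu2: "norm (u * u) = a\<^sup>2"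
    using norm_square_self_adjoint[of u] nu by (simp add: u_def star_mult q)
  obtain r where r: "cone_positive r" "r * r = d * star d"
    using cone_positive_sqrt[OF pos] .
  then have sr: "star r = r" by (simp add: cone_positive_self_adjoint)
  have "norm r ^ 2 = norm (d * star d)"
    using norm_square_self_adjoint[OF sr] r by simp
  also have "\<dots> = a" using cstar_identity[of "star d"] by (simp add: star_star a_def)
  finally have nr: "norm r ^ 2 = a" .
  have "norm (of_real a - r * r) \<le> a"
    by (rule norm_real_minus_square_le[OF sr]) (simp add: nr)
  then have "norm ((of_real a - r * r) * d) \<le> a * norm d"
    by (meson norm_ge_zero norm_mult_ineq mult_right_mono order_trans)
  moreover have "(of_real a - r * r) * d = d * (of_real a + u)"
  proof -
    have "d * star d * d = - (d * u)" by (metis dd mult.assoc mult_minus_right u_def)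
    then show ?thesis unfolding r(2) by (simp add: algebra_simps of_real_def)
  qed
  ultimately have le: "norm (d * (of_real a + u)) \<le> a * norm d" by simp
  have su: "star u = u" by (simp add: u_def star_mult q)
  define w where "w = (of_real a + u) * u * (of_real a + u)"
  have "star (d * (of_real a + u)) * (d * (of_real a + u)) = - w"
    by (simp add: star_mult star_add su of_real_def star_scaleR w_def mult.assoc)
      (metis dd minus_mult_commute mult.assoc mult_minus_right u_def)
  then have "norm w = (norm (d * (of_real a + u)))\<^sup>2"
    by (metis cstar_identity norm_minus_cancel)
  also have "\<dots> \<le> (a * norm d)\<^sup>2" using le by (simp add: power_mono)
  also have "\<dots> = a ^ 3" by (simp add: a_def power_mult_distrib power2_eq_square power3_eq_cube)
  finally have wle: "norm w \<le> a ^ 3" .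
  have "norm ((2 * a) *\<^sub>R (u * u)) \<le> norm w"
  proof (rule cone_positive_norm_mono)
    show "cone_positive ((2 * a) *\<^sub>R (u * u))"
      using a0 by (intro cone_positive_scaleR cone_positive_square su) simp
    have "w - (2 * a) *\<^sub>R (u * u) = (a * a) *\<^sub>R (q * q) + (q * u) * (q * u)"
      by (simp add: w_def u_def algebra_simps of_real_def scaleR_2[symmetric])
    moreover have "star (q * u) = q * u" by (simp add: star_mult q u_def mult.assoc)
    ultimately show "cone_positive (w - (2 * a) *\<^sub>R (u * u))"
      by (simp add: cone_positive_add cone_positive_scaleR cone_positive_square q)
  qed
  then have "2 * a * a\<^sup>2 \<le> a ^ 3" using wle a0 nu2 by simp
  then show False using a0 by (simp add: power2_eq_square power3_eq_cube)
qed

text \<open>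
  The Kelley--Vaught theorem. Let \<open>c = a\<^sup>*a\<close>, \<open>s = \<surd>(c\<^sup>2) = |c|\<close> and let \<open>m = s - c\<close> be twice the negative
  part of \<open>c\<close>. For \<open>d = am\<close> one gets \<open>d\<^sup>*d = mcm = - m s m = - q\<^sup>2\<close> with \<open>q = \<surd>s m\<close>. On the other hand,
  \<open>dd\<^sup>* + d\<^sup>*d\<close> is half the sum of the squares of the self-adjoint elements \<open>x\<close> and \<open>y\<close>, so
  \<open>dd\<^sup>* \<ge> 0\<close>. Therefore \<open>d = 0\<close>, hence \<open>m\<^sup>3 = 2q\<^sup>2 = 0\<close>, \<open>m = 0\<close> and \<open>c = s\<close> is positive.
\<close>
lemma cone_positive_star_mult_self:
  fixes a :: "'a::unital_cstar_algebra"
  shows "cone_positive (star a * a)"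
proof -
  define c where "c = star a * a"
  have sc: "star c = c" by (simp add: c_def star_mult star_star)
  obtain s where s: "cone_positive s" "s * s = c * c"
    "\<And>b. b * (c * c) = (c * c) * b \<Longrightarrow> b * s = s * b"
    using cone_positive_sqrt[OF cone_positive_square[OF sc]] by blast
  have cs: "c * s = s * c" by (rule s(3)) (simp add: mult.assoc)
  have ss: "star s = s" by (simp add: cone_positive_self_adjoint s)
  obtain r where r: "cone_positive r" "r * r = s" "\<And>b. b * s = s * b \<Longrightarrow> b * r = r * b"
    using cone_positive_sqrt[OF s(1)] by blast
  have sr: "star r = r" by (simp add: cone_positive_self_adjoint r)
  have cr: "c * r = r * c" by (rule r(3)) (rule cs)
  define m where "m = s - c"
  have sm: "star m = m" by (simp add: m_def star_diff ss sc)
  have rs: "r * s = s * r" using r(2) by (metis mult.assoc)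
  have mr: "m * r = r * m" by (simp add: m_def algebra_simps cr rs)
  define q where "q = r * m"
  have sq: "star q = q" by (simp add: q_def star_mult sr sm mr)
  define d where "d = a * m"
  have cm: "c * m = - (s * m)" by (simp add: m_def algebra_simps s(2) cs)
  have mq: "q * q = m * (s * m)"
    unfolding q_def r(2)[symmetric] by (metis mr mult.assoc)
  have dd: "star d * d = - (q * q)"
  proof -
    have "star d * d = m * (c * m)" by (simp add: d_def star_mult sm c_def mult.assoc)
    then show ?thesis by (simp add: cm mq)
  qed
  define x where "x = d + star d"
  define y where "y = \<i> *\<^sub>C (d - star d)"
  have sx: "star x = x" by (simp add: x_def star_add star_star add.commute)
  have sy: "star y = y"
    by (simp add: y_def star_scaleC star_diff star_star scaleC_minus_left scaleC_minus_right[symmetric])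
  have "x * x + y * y = 2 *\<^sub>R (d * star d + star d * d)"
    by (simp add: x_def y_def mult_scaleC_left mult_scaleC_right scaleC_scaleC scaleC_minus_left)
      (simp add: algebra_simps scaleR_2)
  then have "d * star d = (1/2) *\<^sub>R (x * x + y * y) + q * q"
    by (simp add: dd scaleR_diff_right)
  moreover have "cone_positive ((1/2) *\<^sub>R (x * x + y * y) + q * q)"
    by (intro cone_positive_add cone_positive_scaleR cone_positive_square sx sy sq) simp
  ultimately have "cone_positive (d * star d)" by simp
  then have "d = 0" by (rule zero_if_star_mult_neg_square[OF sq dd])
  then have "q * q = 0" using dd by simp
  then have q0: "q = 0" using norm_square_self_adjoint[OF sq] by simp
  have "m * m * m = 2 *\<^sub>R (q * q)"
  proof -
    have "s * c = c * s" using cs by simp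
    then have "m * m = 2 *\<^sub>R (s * m)"
      by (simp add: m_def algebra_simps s(2) cs scaleR_2)
    then have "m * m * m = 2 *\<^sub>R (r * r * m * m)" by (simp add: r(2))
    also have "r * r * m * m = q * q" by (metis mr mult.assoc q_def)
    finally show ?thesis by (simp add: q0)
  qed
  then have "m * m * m = 0" by (simp add: q0)
  then have "norm ((m * m) * (m * m)) = 0" by (simp add: mult.assoc)
  then have "m = 0"
    using norm_square_self_adjoint[of "m * m"] norm_square_self_adjoint[OF sm]
    by (simp add: star_mult sm)
  then show ?thesis using s(1) by (simp add: m_def c_def)
qed

section \<open>Adjoining a unit\<close>
datatype 'a unitization = Unitization (algebra_part: 'a) (scalar_part: complex)

lemma unitization_eqI:
  "algebra_part u = algebra_part v \<Longrightarrow> scalar_part u = scalar_part v \<Longrightarrow> u = v"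
  by (rule unitization.expand) simp

definition left_action :: "'a::cstar_algebra unitization \<Rightarrow> 'a \<Rightarrow> 'a" where
  "left_action u b = algebra_part u * b + scalar_part u *\<^sub>C b"

lemma bounded_linear_scaleC: "bounded_linear ((*\<^sub>C) c :: 'a::cstar_algebra \<Rightarrow> 'a)"
  by (rule bounded_linear_intro[of _ "cmod c"])
    (simp_all add: scaleC_add_right scaleC_scaleR norm_scaleC)

lemma bounded_linear_left_action: "bounded_linear (left_action u)"
  unfolding left_action_def[abs_def]
  by (intro bounded_linear_add bounded_linear_mult_right bounded_linear_scaleC)

instantiation unitization :: (cstar_algebra) real_vector
begin
definition "0 = Unitization 0 0"
definition "u + v = Unitization (algebra_part u + algebra_part v) (scalar_part u + scalar_part v)"
definition "- u = Unitization (- algebra_part u) (- scalar_part u)"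
definition "u - v = Unitization (algebra_part u - algebra_part v) (scalar_part u - scalar_part v)"
definition "r *\<^sub>R u = Unitization (r *\<^sub>R algebra_part u) (r *\<^sub>R scalar_part u)"
instance
  by standard
    (simp_all add: zero_unitization_def plus_unitization_def uminus_unitization_def
      minus_unitization_def scaleR_unitization_def algebra_simps)
end

lemma unitization_parts [simp]:
  "algebra_part 0 = 0" "scalar_part 0 = 0"
  "algebra_part (u + v) = algebra_part u + algebra_part v"
  "scalar_part (u + v) = scalar_part u + scalar_part v"
  "algebra_part (- u) = - algebra_part u" "scalar_part (- u) = - scalar_part u"
  "algebra_part (u - v) = algebra_part u - algebra_part v"
  "scalar_part (u - v) = scalar_part u - scalar_part v"
  "algebra_part (r *\<^sub>R u) = r *\<^sub>R algebra_part u"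
  "scalar_part (r *\<^sub>R u) = r *\<^sub>R scalar_part u"
  by (simp_all add: zero_unitization_def plus_unitization_def uminus_unitization_def
      minus_unitization_def scaleR_unitization_def)

lemma left_action_simps:
  "left_action 0 b = 0"
  "left_action (u + v) b = left_action u b + left_action v b"
  "left_action (u - v) b = left_action u b - left_action v b"
  "left_action (r *\<^sub>R u) b = r *\<^sub>R left_action u b"
  by (simp_all add: left_action_def algebra_simps scaleC_add_left scaleC_diff_left
      scaleR_conv_of_real scaleC_scaleC[symmetric] scaleC_of_real scaleC_scaleR)

lemma eq_zero_if_left_mult_zero: "(\<And>b. a * b = 0) \<Longrightarrow> a = (0::'a::cstar_algebra)"
  using cstar_identity[of "star a"] by (simp add: star_star)

instantiation unitization :: (cstar_algebra) real_normed_vector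
begin
text \<open>
  The operator norm of left multiplication on the algebra is a C*-norm if the algebra has no unit.
  If it has a unit, the operator norm vanishes on the difference of the two units; the maximum with
  the modulus of the scalar part is a C*-norm in both cases.
\<close>
definition "norm u = max (cmod (scalar_part u)) (onorm (left_action u))"
definition "sgn u = u /\<^sub>R norm (u :: 'a unitization)"
definition "dist u v = norm (u - v :: 'a unitization)"
definition [code del]:
  "uniformity = (INF e\<in>{0<..}. principal {(x, y :: 'a unitization). dist x y < e})"
definition [code del]: "open U = (\<forall>x\<in>U. eventually (\<lambda>(x', y). x' = x \<longrightarrow> y \<in> U)
  (uniformity :: ('a unitization \<times> 'a unitization) filter))"
instance
proof
  fix u v :: "'a unitization" and r :: real
  show "norm u = 0 \<longleftrightarrow> u = 0"
  proof
    assume "norm u = 0"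
    then have s: "scalar_part u = 0" and o: "onorm (left_action u) = 0"
      using onorm_pos_le[OF bounded_linear_left_action[of u]]
      by (auto simp: norm_unitization_def max_def split: if_splits)
    from o s have "algebra_part u * b = 0" for b
      using onorm_eq_0[OF bounded_linear_left_action[of u]] by (simp add: left_action_def)
    then show "u = 0"
      by (intro unitization_eqI) (simp_all add: s eq_zero_if_left_mult_zero)
  next
    assume "u = 0"
    moreover have "left_action (0 :: 'a unitization) = (\<lambda>b. 0)"
      by (simp add: fun_eq_iff left_action_simps)
    ultimately show "norm u = 0" by (simp add: norm_unitization_def onorm_zero)
  qed
  have "onorm (left_action (u + v)) \<le> onorm (left_action u) + onorm (left_action v)"
    unfolding left_action_simps[abs_def]
    by (rule onorm_triangle) (rule bounded_linear_left_action)+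
  then show "norm (u + v) \<le> norm u + norm v"
    unfolding norm_unitization_def using norm_triangle_ineq[of "scalar_part u" "scalar_part v"]
    by simp linarith
  have "onorm (left_action (r *\<^sub>R u)) = \<bar>r\<bar> * onorm (left_action u)"
    unfolding left_action_simps[abs_def]
    by (rule onorm_scaleR) (rule bounded_linear_left_action)
  then show "norm (r *\<^sub>R u) = \<bar>r\<bar> * norm u"
    by (simp add: norm_unitization_def max_mult_distrib_left)
qed (simp_all only: sgn_unitization_def dist_unitization_def uniformity_unitization_def
    open_unitization_def)
end

definition of_algebra :: "'a::cstar_algebra \<Rightarrow> 'a unitization" where
  "of_algebra a = Unitization a 0"

text \<open>The supremum in the operator norm of \<open>a\<close> is attained at \<open>a\<^sup>*\<close>.\<close>
lemma norm_of_algebra [simp]: "norm (of_algebra a) = norm a"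
proof -
  have act: "left_action (of_algebra a) = (\<lambda>b. a * b)"
    by (simp add: left_action_def[abs_def] of_algebra_def)
  have "onorm (\<lambda>b. a * b) = norm a"
  proof (rule antisym)
    show "onorm (\<lambda>b. a * b) \<le> norm a"
      by (rule onorm_bound) (simp_all add: norm_mult_ineq)
    show "norm a \<le> onorm (\<lambda>b. a * b)"
    proof (cases "a = 0")
      case False
      have "norm a * norm a = norm (a * star a)"
        using cstar_identity[of "star a"] by (simp add: star_star power2_eq_square)
      also have "\<dots> \<le> onorm (\<lambda>b. a * b) * norm (star a)"
        by (rule onorm) (rule bounded_linear_mult_right)
      finally show ?thesis using False by simp
    qed (simp add: onorm_zero)
  qed
  then show ?thesis
    by (simp add: norm_unitization_def act) (simp add: of_algebra_def)
qed

lemma norm_scalar_le: "norm (Unitization 0 c) \<le> cmod c" 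
  by (auto simp: norm_unitization_def left_action_def[abs_def] norm_scaleC intro!: onorm_bound)

lemma unitization_split: "u = of_algebra (algebra_part u) + Unitization 0 (scalar_part u)"
  by (rule unitization_eqI) (simp_all add: of_algebra_def)

lemma norm_scalar_part_le: "cmod (scalar_part u) \<le> norm u"
  by (simp add: norm_unitization_def)

lemma norm_algebra_part_le: "norm (algebra_part u) \<le> 2 * norm u"
proof -
  have "of_algebra (algebra_part u) = u - Unitization 0 (scalar_part u)"
    by (rule unitization_eqI) (simp_all add: of_algebra_def)
  then have "norm (of_algebra (algebra_part u)) \<le> norm u + norm (Unitization (0::'a) (scalar_part u))"
    by (metis norm_triangle_ineq4)
  then show ?thesis
    using norm_scalar_le[of "scalar_part u", where 'a = 'a] norm_scalar_part_le[of u] by simp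
qed

instance unitization :: (cstar_algebra) banach
proof
  fix X :: "nat \<Rightarrow> 'a unitization"
  assume X: "Cauchy X"
  have "bounded_linear (scalar_part :: 'a unitization \<Rightarrow> complex)"
    by (rule bounded_linear_intro[of _ 1]) (simp_all add: norm_scalar_part_le)
  then obtain c where c: "(\<lambda>n. scalar_part (X n)) \<longlonglongrightarrow> c"
    using bounded_linear.Cauchy[OF _ X] Cauchy_convergent convergent_def by blast
  have "bounded_linear (algebra_part :: 'a unitization \<Rightarrow> 'a)"
    by (rule bounded_linear_intro[of _ 2])
      (simp_all add: norm_algebra_part_le mult.commute[of _ 2])
  then obtain a where a: "(\<lambda>n. algebra_part (X n)) \<longlonglongrightarrow> a"
    using bounded_linear.Cauchy[OF _ X] Cauchy_convergent convergent_def by blast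
  have "X \<longlonglongrightarrow> Unitization a c"
  proof (rule LIM_zero_cancel)
    have "(\<lambda>n. norm (algebra_part (X n) - a) + cmod (scalar_part (X n) - c)) \<longlonglongrightarrow> 0 + 0"
      by (intro tendsto_add tendsto_norm_zero LIM_zero a c)
    then have lim: "(\<lambda>n. norm (algebra_part (X n) - a) + cmod (scalar_part (X n) - c)) \<longlonglongrightarrow> 0"
      by simp
    have "norm (X n - Unitization a c) \<le> norm (algebra_part (X n) - a) + cmod (scalar_part (X n) - c)"
      for n
    proof -
      have "norm (X n - Unitization a c) \<le> norm (of_algebra (algebra_part (X n) - a))
          + norm (Unitization (0::'a) (scalar_part (X n) - c))"
        using unitization_split[of "X n - Unitization a c"] norm_triangle_ineq
        by (metis unitization.sel unitization_parts(7,8))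
      then show ?thesis using norm_scalar_le[of "scalar_part (X n) - c", where 'a = 'a] by simp
    qed
    then show "(\<lambda>n. X n - Unitization a c) \<longlonglongrightarrow> 0"
      by (intro Lim_null_comparison[OF _ lim]) simp
  qed
  then show "convergent X" unfolding convergent_def by blast
qed

instantiation unitization :: (cstar_algebra) real_normed_algebra_1
begin
definition "1 = Unitization 0 1"
definition "u * v = Unitization
  (algebra_part u * algebra_part v + scalar_part u *\<^sub>C algebra_part v + scalar_part v *\<^sub>C algebra_part u)
  (scalar_part u * scalar_part v)"

lemma unitization_mult_parts [simp]:
  "algebra_part 1 = 0" "scalar_part 1 = 1"
  "algebra_part (u * v) = algebra_part u * algebra_part v + scalar_part u *\<^sub>C algebra_part v
     + scalar_part v *\<^sub>C algebra_part u"
  "scalar_part (u * v) = scalar_part u * scalar_part v"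
  by (simp_all add: one_unitization_def times_unitization_def)

lemma left_action_mult: "left_action (u * v) b = left_action u (left_action v b)"
  by (simp add: left_action_def algebra_simps mult_scaleC_left mult_scaleC_right scaleC_add_right
      scaleC_scaleC)

instance
proof
  fix u v w :: "'a unitization" and r :: real
  show "u * v * w = u * (v * w)"
    by (rule unitization_eqI)
      (simp_all add: algebra_simps mult_scaleC_left mult_scaleC_right scaleC_add_right scaleC_scaleC)
  show "(u + v) * w = u * w + v * w" "u * (v + w) = u * v + u * w"
    by (rule unitization_eqI; simp add: algebra_simps scaleC_add_right scaleC_add_left)+
  show "1 * u = u" "u * 1 = u" by (rule unitization_eqI; simp)+
  show "0 \<noteq> (1 :: 'a unitization)"
    by (simp add: one_unitization_def zero_unitization_def)
  show "(r *\<^sub>R u) * v = r *\<^sub>R (u * v)" "u * (r *\<^sub>R v) = r *\<^sub>R (u * v)"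
    by (rule unitization_eqI;
        simp add: algebra_simps scaleC_scaleR scaleR_conv_of_real scaleC_scaleC[symmetric] scaleC_of_real)+
  have "onorm (left_action (u * v)) \<le> onorm (left_action u) * onorm (left_action v)"
    using onorm_compose[OF bounded_linear_left_action[of u] bounded_linear_left_action[of v]]
    by (simp add: left_action_mult[abs_def] comp_def)
  also have "\<dots> \<le> norm u * norm v"
    by (intro mult_mono onorm_pos_le bounded_linear_left_action norm_ge_zero)
      (simp_all add: norm_unitization_def)
  finally show "norm (u * v) \<le> norm u * norm v"
    using mult_mono[OF norm_scalar_part_le[of u] norm_scalar_part_le[of v]]
    by (simp add: norm_unitization_def[of "u * v"] norm_mult)
  have "onorm (left_action (1 :: 'a unitization)) \<le> 1"
    by (auto simp: left_action_def[abs_def] intro!: onorm_bound)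
  then show "norm (1 :: 'a unitization) = 1" by (simp add: norm_unitization_def)
qed
end

instantiation unitization :: (cstar_algebra) unital_cstar_algebra
begin
definition "c *\<^sub>C u = Unitization (c *\<^sub>C algebra_part u) (c * scalar_part u)"
definition "star u = Unitization (star (algebra_part u)) (cnj (scalar_part u))"

lemma unitization_star_parts [simp]:
  "algebra_part (c *\<^sub>C u) = c *\<^sub>C algebra_part u" "scalar_part (c *\<^sub>C u) = c * scalar_part u"
  "algebra_part (star u) = star (algebra_part u)" "scalar_part (star u) = cnj (scalar_part u)"
  by (simp_all add: scaleC_unitization_def star_unitization_def)

instance
proof
  fix u v :: "'a unitization" and c d :: complex and r :: real
  show "c *\<^sub>C (u + v) = c *\<^sub>C u + c *\<^sub>C v" "(c + d) *\<^sub>C u = c *\<^sub>C u + d *\<^sub>C u"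
    "c *\<^sub>C d *\<^sub>C u = (c * d) *\<^sub>C u"
    by (rule unitization_eqI; simp add: scaleC_add_right scaleC_add_left scaleC_scaleC algebra_simps)+
  show "complex_of_real r *\<^sub>C u = r *\<^sub>R u"
    by (rule unitization_eqI) (simp_all add: scaleC_of_real, simp add: scaleR_conv_of_real)
  show "(c *\<^sub>C u) * v = c *\<^sub>C (u * v)" "u * (c *\<^sub>C v) = c *\<^sub>C (u * v)"
    by (rule unitization_eqI; simp add: scaleC_add_right scaleC_scaleC mult_scaleC_left
        mult_scaleC_right mult.commute mult.left_commute)+
  show "star (star u) = u" "star (u + v) = star u + star v" "star (c *\<^sub>C u) = cnj c *\<^sub>C star u"
    "star (u * v) = star v * star u"
    by (rule unitization_eqI; simp add: star_star star_add star_scaleC star_mult algebra_simps)+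
  have scale_le: "norm (d *\<^sub>C w) \<le> cmod d * norm w" for d and w :: "'a unitization"
  proof -
    have "left_action (d *\<^sub>C w) b = d *\<^sub>C left_action w b" for b
      by (simp add: left_action_def scaleC_add_right mult_scaleC_left scaleC_scaleC)
    then have "onorm (left_action (d *\<^sub>C w)) \<le> cmod d * onorm (left_action w)"
      using onorm[OF bounded_linear_left_action[of w]]
      by (intro onorm_bound)
        (auto simp: norm_scaleC mult.assoc intro!: mult_left_mono mult_nonneg_nonneg onorm_pos_le
          bounded_linear_left_action)
    then show ?thesis by (simp add: norm_unitization_def norm_mult max_mult_distrib_left)
  qed
  show "norm (c *\<^sub>C u) = cmod c * norm u"
  proof (cases "c = 0")
    case True
    then show ?thesis using scale_le[of c u] by simp
  next
    case False
    have "inverse c *\<^sub>C c *\<^sub>C u = u"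
      using False by (intro unitization_eqI) (simp_all add: scaleC_scaleC)
    then have "norm u \<le> inverse (cmod c) * norm (c *\<^sub>C u)"
      using scale_le[of "inverse c" "c *\<^sub>C u"] by (simp add: norm_inverse)
    then have "cmod c * norm u \<le> norm (c *\<^sub>C u)" using False by (simp add: field_simps)
    then show ?thesis using scale_le[of c u] by simp
  qed
  have bl: "bounded_linear (left_action w)" for w :: "'a unitization"
    by (rule bounded_linear_left_action)
  (* The inequality behind the C*-identity: |w b|^2 = |b* (w* w b)|. *)
  have sq: "(onorm (left_action w))\<^sup>2 \<le> onorm (left_action (star w * w))" for w :: "'a unitization"
  proof -
    have nn: "0 \<le> onorm (left_action (star w * w))" by (rule onorm_pos_le[OF bl])
    have "norm (left_action w b) \<le> sqrt (onorm (left_action (star w * w))) * norm b" for b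
    proof -
      have "star (left_action w b) * left_action w b = star b * left_action (star w * w) b"
        by (simp add: left_action_def star_add star_mult star_scaleC algebra_simps mult_scaleC_left
            mult_scaleC_right scaleC_add_right scaleC_scaleC)
      then have "(norm (left_action w b))\<^sup>2 \<le> norm b * norm (left_action (star w * w) b)"
        by (metis cstar_identity norm_mult_ineq norm_star)
      also have "\<dots> \<le> norm b * (onorm (left_action (star w * w)) * norm b)"
        by (intro mult_left_mono onorm bl norm_ge_zero)
      also have "\<dots> = (sqrt (onorm (left_action (star w * w))) * norm b)\<^sup>2"
        using nn by (simp add: power_mult_distrib power2_eq_square)
      finally show ?thesis by (rule power2_le_imp_le) (simp add: nn)
    qed
    then have "onorm (left_action w) \<le> sqrt (onorm (left_action (star w * w)))"
      by (intro onorm_bound) (simp_all add: nn)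
    then show ?thesis
      by (metis bl nn onorm_pos_le power_mono real_sqrt_pow2)
  qed
  have le: "onorm (left_action (star w * w)) \<le> onorm (left_action (star w)) * onorm (left_action w)"
    for w :: "'a unitization"
    using onorm_compose[OF bl[of "star w"] bl[of w]]
    by (simp add: left_action_mult[abs_def] comp_def)
  have mono: "onorm (left_action w) \<le> onorm (left_action (star w))" for w :: "'a unitization"
  proof (cases "onorm (left_action w) = 0")
    case True
    then show ?thesis using onorm_pos_le[OF bl] by simp
  next
    case False
    then have "0 < onorm (left_action w)" using onorm_pos_le[OF bl, of w] by simp
    moreover have "onorm (left_action w) * onorm (left_action w)
        \<le> onorm (left_action (star w)) * onorm (left_action w)"
      using sq[of w] le[of w] by (simp add: power2_eq_square)
    ultimately show ?thesis by simp
  qed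
  have "star (star u) = u" by fact
  then have "onorm (left_action (star u)) = onorm (left_action u)"
    using mono[of u] mono[of "star u"] by simp
  then have "onorm (left_action (star u * u)) = (onorm (left_action u))\<^sup>2"
    using sq[of u] le[of u] by (simp add: power2_eq_square)
  then show "norm (star u * u) = (norm u)\<^sup>2"
    by (simp add: norm_unitization_def norm_mult max_def power2_eq_square)
      (metis abs_le_square_iff abs_of_nonneg bl norm_ge_zero onorm_pos_le power2_eq_square)
qed
end

lemma of_algebra_simps:
  "of_algebra (a + b) = of_algebra a + of_algebra b"
  "of_algebra (a - b) = of_algebra a - of_algebra b"
  "of_algebra (a * b) = of_algebra a * of_algebra b"
  "of_algebra (star a) = star (of_algebra a)"
  "of_algebra (r *\<^sub>R a) = r *\<^sub>R of_algebra a"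
  by (rule unitization_eqI; simp add: of_algebra_def)+

text \<open>A square root of an element of the algebra has scalar part \<open>0\<close>, so it lies in the algebra.\<close>
lemma cone_positive_of_algebra_iff: "cone_positive (of_algebra a) \<longleftrightarrow> a \<in> pos"
proof
  assume "cone_positive (of_algebra a)"
  then obtain s where s: "cone_positive s" "s * s = of_algebra a" using cone_positive_sqrt by blast
  then have "scalar_part s * scalar_part s = 0"
    by (metis of_algebra_def unitization.sel(2) unitization_mult_parts(4))
  then have s0: "scalar_part s = 0" by simp
  let ?b = "algebra_part s"
  have "star s * s = of_algebra a" using s by (simp add: cone_positive_self_adjoint)
  then have "algebra_part (star s * s) = a" by (simp add: of_algebra_def)
  then have "a = star ?b * ?b" by (simp add: s0)
  then show "a \<in> pos" unfolding pos_def by blast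
next
  assume "a \<in> pos"
  then show "cone_positive (of_algebra a)"
    unfolding pos_def by (auto simp: of_algebra_simps cone_positive_star_mult_self)
qed

lemma pos_add: "x \<in> pos \<Longrightarrow> y \<in> pos \<Longrightarrow> x + y \<in> pos"
  unfolding cone_positive_of_algebra_iff[symmetric] of_algebra_simps by (rule cone_positive_add)

lemma norm_mono_pos: "p \<in> pos \<Longrightarrow> q - p \<in> pos \<Longrightarrow> norm p \<le> norm q"
  unfolding cone_positive_of_algebra_iff[symmetric] of_algebra_simps
  using cone_positive_norm_mono[of "of_algebra p" "of_algebra q"] by simp

text \<open>
  For a self-adjoint \<open>h\<close> of norm at most \<open>1\<close> there is \<open>k\<close> with \<open>h\<^sup>2 + (1 - k)\<^sup>2 = 1\<close>. This identity is
  preserved by \<open>f\<close>, and it forces \<open>\<parallel>f(h)\<parallel> \<le> 1\<close>. The C*-identity reduces the general case to the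
  self-adjoint one.
\<close>
lemma star_homomorphism_contractive:
  fixes f :: "'a::cstar_algebra \<Rightarrow> 'b::cstar_algebra"
  assumes add: "\<And>x y. f (x + y) = f x + f y" and scale: "\<And>r x. f (r *\<^sub>R x) = r *\<^sub>R f x"
    and mult: "\<And>x y. f (x * y) = f x * f y" and st: "\<And>x. f (star x) = star (f x)"
  shows "norm (f x) \<le> norm x"
proof -
  have sa: "norm (f h) \<le> 1" if h: "star h = h" "norm h \<le> 1" for h
  proof -
    have "norm (h * h) \<le> 1"
      using h by (simp add: norm_square_self_adjoint power_le_one)
    moreover have "star (h * h) = h * h" by (simp add: star_mult h)
    ultimately obtain k where k: "2 *\<^sub>R k = h * h + k * k" "star k = k"
      "\<And>b. b * (h * h) = (h * h) * b \<Longrightarrow> b * k = k * b"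
      using quadratic_root by blast
    have hk: "h * k = k * h" by (rule k(3)) (simp add: mult.assoc)
    let ?x = "of_algebra (f h)" and ?y = "1 - of_algebra (f k)"
    have "2 *\<^sub>R f k = f h * f h + f k * f k"
      using arg_cong[OF k(1), of f] by (simp add: add scale mult)
    then have "2 *\<^sub>R of_algebra (f k) = ?x * ?x + of_algebra (f k) * of_algebra (f k)"
      by (simp flip: of_algebra_simps)
    then have 1: "?x * ?x + ?y * ?y = 1"
      by (simp add: algebra_simps scaleR_2)
    have "f h * f k = f k * f h" using arg_cong[OF hk, of f] by (simp add: mult)
    then have "?x * of_algebra (f k) = of_algebra (f k) * ?x"
      by (simp flip: of_algebra_simps)
    then have 2: "?x * ?y = ?y * ?x" by (simp add: algebra_simps)
    have "star ?x = ?x" "star ?y = ?y"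
      using st[of h] st[of k] h(1) k(2) by (simp_all add: star_diff flip: of_algebra_simps(4))
    then have "norm ?x \<le> 1" using 2 1 by (rule norm_le_one_if_squares_sum_one)
    then show ?thesis by simp
  qed
  have sa: "norm (f h) \<le> norm h" if h: "star h = h" for h
  proof (cases "h = 0")
    case True
    then show ?thesis using scale[of 0 h] by simp
  next
    case False
    have "norm (f ((1 / norm h) *\<^sub>R h)) \<le> 1"
      by (rule sa) (simp_all add: star_scaleR h)
    then show ?thesis using False by (simp add: scale field_simps)
  qed
  have "(norm (f x))\<^sup>2 = norm (f (star x * x))" by (simp add: mult st cstar_identity)
  also have "\<dots> \<le> norm (star x * x)" by (rule sa) (simp add: star_mult star_star)
  also have "\<dots> = (norm x)\<^sup>2" by (rule cstar_identity)
  finally show ?thesis by (rule power2_le_imp_le) simp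
qed

section \<open>The product of all C*-normed matrix algebras\<close>
lemma scaleC_sum: "c *\<^sub>C (\<Sum>i\<in>I. f i) = (\<Sum>i\<in>I. c *\<^sub>C (f i :: 'a::cstar_algebra))"
  by (rule linear_sum[OF bounded_linear.linear[OF bounded_linear_scaleC]])

lemma star_sum: "star (\<Sum>i\<in>I. f i) = (\<Sum>i\<in>I. star (f i :: 'a::cstar_algebra))"
  by (rule linear_sum[OF bounded_linear.linear[OF bounded_linear_star]])

lemma mat_scaleC_dim [simp]:
  "dim_row (mat_scaleC c x) = dim_row x" "dim_col (mat_scaleC c x) = dim_col x"
  by (simp_all add: mat_scaleC_def)

lemma mat_star_dim [simp]: "dim_row (mat_star x) = dim_col x" "dim_col (mat_star x) = dim_row x"
  by (simp_all add: mat_star_def)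

lemma mat_scaleC_carrier [simp]: "mat_scaleC c x \<in> carrier_mat m n \<longleftrightarrow> x \<in> carrier_mat m n"
  by (simp add: mat_scaleC_def)

lemma mat_star_carrier [simp]: "mat_star x \<in> carrier_mat m n \<longleftrightarrow> x \<in> carrier_mat n m"
  by (auto simp: mat_star_def)

lemma index_mat_scaleC [simp]:
  "i < dim_row x \<Longrightarrow> j < dim_col x \<Longrightarrow> mat_scaleC c x $$ (i, j) = c *\<^sub>C x $$ (i, j)"
  by (simp add: mat_scaleC_def)

lemma index_mat_star [simp]:
  "i < dim_col x \<Longrightarrow> j < dim_row x \<Longrightarrow> mat_star x $$ (i, j) = star (x $$ (j, i))"
  by (simp add: mat_star_def)

lemma mat_scaleC_mult_left: "dim_col x = dim_row y \<Longrightarrow> mat_scaleC c x * y = mat_scaleC c (x * y)"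
  by (rule eq_matI) (simp_all add: scalar_prod_def scaleC_sum mult_scaleC_left)

lemma mat_scaleC_mult_right: "dim_col x = dim_row y \<Longrightarrow> x * mat_scaleC c y = mat_scaleC c (x * y)"
  by (rule eq_matI) (simp_all add: scalar_prod_def scaleC_sum mult_scaleC_right)

lemma mat_star_mult: "dim_col x = dim_row y \<Longrightarrow> mat_star (x * y) = mat_star y * mat_star x"
  by (rule eq_matI) (simp_all add: scalar_prod_def star_sum star_mult)

lemma mat_star_star [simp]: "mat_star (mat_star x) = x"
  by (rule eq_matI) (simp_all add: star_star)

lemma mat_scaleC_one [simp]: "mat_scaleC 1 x = x"
  by (rule eq_matI) simp_all

lemma mat_scaleC_zero_mat: "mat_scaleC c (0\<^sub>m m n) = 0\<^sub>m m n"
  by (rule eq_matI) simp_all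

lemma mat_star_zero_mat: "mat_star (0\<^sub>m m n) = 0\<^sub>m n m"
  by (rule eq_matI) simp_all

lemma uminus_zero_mat: "- 0\<^sub>m m n = (0\<^sub>m m n :: 'a::group_add mat)"
  by (rule eq_matI) simp_all

lemma mat_scaleC_minus_one: "mat_scaleC (- 1) x = - x"
  by (rule eq_matI) (simp_all add: scaleC_minus_left)

lemma mat_scaleC_scaleC: "mat_scaleC c (mat_scaleC d x) = mat_scaleC (c * d) x"
  by (rule eq_matI) (simp_all add: scaleC_scaleC)

context
  fixes n :: nat and N :: "'a::cstar_algebra mat \<Rightarrow> real"
  assumes N: "is_cstar_norm n N"
begin

lemma cstar_norm_nonneg: "x \<in> carrier_mat n n \<Longrightarrow> 0 \<le> N x"
  and cstar_norm_eq_0_iff: "x \<in> carrier_mat n n \<Longrightarrow> N x = 0 \<longleftrightarrow> x = 0\<^sub>m n n"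
  and cstar_norm_triangle:
    "x \<in> carrier_mat n n \<Longrightarrow> y \<in> carrier_mat n n \<Longrightarrow> N (x + y) \<le> N x + N y"
  and cstar_norm_scaleC: "x \<in> carrier_mat n n \<Longrightarrow> N (mat_scaleC c x) = cmod c * N x"
  and cstar_norm_mult:
    "x \<in> carrier_mat n n \<Longrightarrow> y \<in> carrier_mat n n \<Longrightarrow> N (x * y) \<le> N x * N y"
  and cstar_norm_star_mult: "x \<in> carrier_mat n n \<Longrightarrow> N (mat_star x * x) = (N x)\<^sup>2"
proof -
  note N[unfolded is_cstar_norm_def]
  note 1 = this[THEN conjunct1] and 2 = this[THEN conjunct2, THEN conjunct1]
    and 3 = this[THEN conjunct2, THEN conjunct2, THEN conjunct1]
    and 4 = this[THEN conjunct2, THEN conjunct2, THEN conjunct2, THEN conjunct1]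
    and 5 = this[THEN conjunct2, THEN conjunct2, THEN conjunct2, THEN conjunct2, THEN conjunct1]
  show "x \<in> carrier_mat n n \<Longrightarrow> 0 \<le> N x" "x \<in> carrier_mat n n \<Longrightarrow> N x = 0 \<longleftrightarrow> x = 0\<^sub>m n n"
    using 1 by simp_all
  show "x \<in> carrier_mat n n \<Longrightarrow> y \<in> carrier_mat n n \<Longrightarrow> N (x + y) \<le> N x + N y" using 2 by simp
  show "x \<in> carrier_mat n n \<Longrightarrow> N (mat_scaleC c x) = cmod c * N x" using 3 by simp
  show "x \<in> carrier_mat n n \<Longrightarrow> y \<in> carrier_mat n n \<Longrightarrow> N (x * y) \<le> N x * N y" using 4 by simp
  show "x \<in> carrier_mat n n \<Longrightarrow> N (mat_star x * x) = (N x)\<^sup>2" using 5 by simp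
qed

lemma cstar_norm_zero: "N (0\<^sub>m n n) = 0"
  by (simp add: cstar_norm_eq_0_iff)

lemma cstar_norm_minus: "x \<in> carrier_mat n n \<Longrightarrow> N (- x) = N x"
  using cstar_norm_scaleC[of x "- 1"] by (simp add: mat_scaleC_minus_one)

lemma cstar_norm_minus_commute:
  assumes "x \<in> carrier_mat n n" "y \<in> carrier_mat n n" shows "N (x - y) = N (y - x)"
proof -
  have "- (x - y) = y - x" using assms by (intro eq_matI) auto
  then show ?thesis using cstar_norm_minus[of "x - y"] assms by (simp add: minus_carrier_mat)
qed

lemma cstar_norm_diff_triangle:
  assumes "x \<in> carrier_mat n n" "y \<in> carrier_mat n n" "z \<in> carrier_mat n n"
  shows "N (x - z) \<le> N (x - y) + N (y - z)"
proof -
  have "x - z = (x - y) + (y - z)" using assms by (intro eq_matI) auto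
  then show ?thesis using cstar_norm_triangle[of "x - y" "y - z"] assms by (simp add: minus_carrier_mat)
qed

lemma cstar_norm_star:
  assumes "x \<in> carrier_mat n n" shows "N (mat_star x) = N x"
proof -
  have le: "N y \<le> N (mat_star y)" if y: "y \<in> carrier_mat n n" for y
  proof (cases "N y = 0")
    case True
    then show ?thesis using cstar_norm_nonneg[of "mat_star y"] y by simp
  next
    case False
    then have "0 < N y" using cstar_norm_nonneg[OF y] by simp
    moreover have "N y * N y \<le> N (mat_star y) * N y"
      using cstar_norm_star_mult[OF y] cstar_norm_mult[of "mat_star y" y] y
      by (simp add: power2_eq_square)
    ultimately show ?thesis by simp
  qed
  show ?thesis using le[OF assms] le[of "mat_star x"] assms by simp
qed

lemma cstar_norm_complete:
  assumes X: "\<And>k. X k \<in> carrier_mat n n"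
    and Cauchy: "\<And>\<epsilon>. \<epsilon> > 0 \<Longrightarrow> \<exists>K::nat. \<forall>i\<ge>K. \<forall>j\<ge>K. N (X i - X j) < \<epsilon>"
  shows "\<exists>L\<in>carrier_mat n n. (\<lambda>k. N (X k - L)) \<longlonglongrightarrow> 0"
proof -
  note N[unfolded is_cstar_norm_def, THEN conjunct2, THEN conjunct2, THEN conjunct2,
      THEN conjunct2, THEN conjunct2]
  then show ?thesis by (rule allE[of _ X]) (use X Cauchy in simp)
qed

end

text \<open>Extended by \<open>0\<close> to pairs \<open>(n, N)\<close> that are not C*-normed matrix algebras.\<close>
definition slot_norm :: "nat \<Rightarrow> ('a::cstar_algebra mat \<Rightarrow> real) \<Rightarrow> 'a mat \<Rightarrow> real" where
  "slot_norm n N x = (if is_cstar_norm n N then N x else 0)"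

lemma slot_norm_zero [simp]: "slot_norm n N (0\<^sub>m n n) = 0"
  using cstar_norm_zero[of n N] by (simp add: slot_norm_def)

lemma slot_norm_nonneg: "x \<in> carrier_mat n n \<Longrightarrow> 0 \<le> slot_norm n N x"
  using cstar_norm_nonneg[of n N x] by (simp add: slot_norm_def)

lemma slot_norm_triangle:
  "x \<in> carrier_mat n n \<Longrightarrow> y \<in> carrier_mat n n \<Longrightarrow>
    slot_norm n N (x + y) \<le> slot_norm n N x + slot_norm n N y"
  using cstar_norm_triangle[of n N x y] by (simp add: slot_norm_def)

lemma slot_norm_diff_triangle:
  "x \<in> carrier_mat n n \<Longrightarrow> y \<in> carrier_mat n n \<Longrightarrow> z \<in> carrier_mat n n \<Longrightarrow>
    slot_norm n N (x - z) \<le> slot_norm n N (x - y) + slot_norm n N (y - z)"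
  using cstar_norm_diff_triangle[of n N x y z] by (simp add: slot_norm_def)

lemma slot_norm_scaleC:
  "x \<in> carrier_mat n n \<Longrightarrow> slot_norm n N (mat_scaleC c x) = cmod c * slot_norm n N x"
  using cstar_norm_scaleC[of n N x c] by (simp add: slot_norm_def)

lemma slot_norm_minus: "x \<in> carrier_mat n n \<Longrightarrow> slot_norm n N (- x) = slot_norm n N x"
  using slot_norm_scaleC[of x n N "- 1"] by (simp add: mat_scaleC_minus_one)

lemma slot_norm_mult:
  "x \<in> carrier_mat n n \<Longrightarrow> y \<in> carrier_mat n n \<Longrightarrow>
    slot_norm n N (x * y) \<le> slot_norm n N x * slot_norm n N y"
  using cstar_norm_mult[of n N x y] by (simp add: slot_norm_def)

lemma slot_norm_star_mult:
  "x \<in> carrier_mat n n \<Longrightarrow> slot_norm n N (mat_star x * x) = (slot_norm n N x)\<^sup>2"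
  using cstar_norm_star_mult[of n N x] by (simp add: slot_norm_def)

lemma slot_norm_star: "x \<in> carrier_mat n n \<Longrightarrow> slot_norm n N (mat_star x) = slot_norm n N x"
  using cstar_norm_star[of n N x] by (simp add: slot_norm_def)

text \<open>
  Bounded families with one \<open>n \<times> n\<close> matrix for each \<open>n\<close> and each complete C*-norm \<open>N\<close> on the
  \<open>n \<times> n\<close> matrices. Since the norms are indices, two norms on the same matrices give two summands,
  which can be compared by a *-homomorphism of the product into itself.
\<close>
typedef (overloaded) 'a matrix_family =
  "{f :: nat \<Rightarrow> ('a::cstar_algebra mat \<Rightarrow> real) \<Rightarrow> 'a mat.
     (\<forall>n N. f n N \<in> carrier_mat n n) \<and> (\<forall>n N. \<not> is_cstar_norm n N \<longrightarrow> f n N = 0\<^sub>m n n) \<and>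
     (\<exists>K. \<forall>n N. slot_norm n N (f n N) \<le> K)}"
  morphisms component Matrix_family
  by (rule exI[of _ "\<lambda>n N. 0\<^sub>m n n"]) auto

lemma component_carrier [simp]: "component F n N \<in> carrier_mat n n"
  using component[of F] by blast

lemma component_dim [simp]: "dim_row (component F n N) = n" "dim_col (component F n N) = n"
  by (rule carrier_matD[OF component_carrier])+

lemma component_outside: "\<not> is_cstar_norm n N \<Longrightarrow> component F n N = 0\<^sub>m n n"
  using component[of F] by blast

lemma component_bounded: "\<exists>K. \<forall>n N. slot_norm n N (component F n N) \<le> K"
  using component[of F] by blast

lemma component_Matrix_family:
  assumes "\<And>n N. f n N \<in> carrier_mat n n" and "\<And>n N. \<not> is_cstar_norm n N \<Longrightarrow> f n N = 0\<^sub>m n n"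
    and "\<And>n N. slot_norm n N (f n N) \<le> K"
  shows "component (Matrix_family f) = f"
  using assms by (subst Matrix_family_inverse) blast+

lemma matrix_family_eqI: "(\<And>n N. component F n N = component G n N) \<Longrightarrow> F = G"
  by (simp add: component_inject[symmetric] fun_eq_iff)

lemma matrix_family_eqI':
  assumes "\<And>n N i j. i < n \<Longrightarrow> j < n \<Longrightarrow> component F n N $$ (i, j) = component G n N $$ (i, j)"
  shows "F = G"
  by (rule matrix_family_eqI, rule eq_matI) (simp_all add: assms)

instantiation matrix_family :: (cstar_algebra) "{ring, real_vector}"
begin
definition "0 = Matrix_family (\<lambda>n N. 0\<^sub>m n n)"
definition "F + G = Matrix_family (\<lambda>n N. component F n N + component G n N)"
definition "- F = Matrix_family (\<lambda>n N. - component F n N)"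
definition "F - G = Matrix_family (\<lambda>n N. component F n N - component G n N)"
definition "F * G = Matrix_family (\<lambda>n N. component F n N * component G n N)"
definition "r *\<^sub>R F = Matrix_family (\<lambda>n N. mat_scaleC (complex_of_real r) (component F n N))"

lemma component_zero [simp]: "component 0 n N = 0\<^sub>m n n"
proof -
  have "component (0 :: 'a matrix_family) = (\<lambda>n N. 0\<^sub>m n n)"
    unfolding zero_matrix_family_def by (rule component_Matrix_family[where K = 0]) simp_all
  then show ?thesis by simp
qed

lemma component_add [simp]: "component (F + G) n N = component F n N + component G n N"
proof -
  obtain K L where K: "\<forall>n N. slot_norm n N (component F n N) \<le> K"
    and L: "\<forall>n N. slot_norm n N (component G n N) \<le> L"
    using component_bounded[of F] component_bounded[of G] by blast
  have "component (F + G) = (\<lambda>n N. component F n N + component G n N)"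
    unfolding plus_matrix_family_def
  proof (rule component_Matrix_family[where K = "K + L"])
    show "slot_norm n N (component F n N + component G n N) \<le> K + L" for n N
      using slot_norm_triangle[OF component_carrier[of F n N] component_carrier[of G n N], of N]
        K[rule_format, of n N] L[rule_format, of n N] by linarith
  qed (simp_all add: component_outside)
  then show ?thesis by simp
qed

lemma component_scaleR [simp]:
  "component (r *\<^sub>R F) n N = mat_scaleC (complex_of_real r) (component F n N)"
proof -
  obtain K where K: "\<forall>n N. slot_norm n N (component F n N) \<le> K"
    using component_bounded[of F] by blast
  have "component (r *\<^sub>R F) = (\<lambda>n N. mat_scaleC (complex_of_real r) (component F n N))"
    unfolding scaleR_matrix_family_def
  proof (rule component_Matrix_family[where K = "\<bar>r\<bar> * K"])
    show "slot_norm n N (mat_scaleC (complex_of_real r) (component F n N)) \<le> \<bar>r\<bar> * K" for n N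
      using K by (simp add: slot_norm_scaleC mult_left_mono)
  qed (simp_all add: component_outside mat_scaleC_zero_mat)
  then show ?thesis by simp
qed

lemma component_minus [simp]: "component (- F) n N = - component F n N"
proof -
  obtain K where K: "\<forall>n N. slot_norm n N (component F n N) \<le> K"
    using component_bounded[of F] by blast
  have "component (- F) = (\<lambda>n N. - component F n N)"
    unfolding uminus_matrix_family_def
    by (rule component_Matrix_family[where K = K]) (simp_all add: K slot_norm_minus component_outside uminus_zero_mat)
  then show ?thesis by simp
qed

lemma component_diff [simp]: "component (F - G) n N = component F n N - component G n N"
proof -
  have "component (F + - G) n N = component F n N - component G n N" for n N
    by (rule eq_matI) simp_all
  then have "F - G = Matrix_family (component (F + - G))"
    unfolding minus_matrix_family_def by presburger
  then have "F - G = F + - G" by (simp only: component_inverse)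
  then show ?thesis
    using \<open>component (F + - G) n N = component F n N - component G n N\<close> by simp
qed

lemma component_mult [simp]: "component (F * G) n N = component F n N * component G n N"
proof -
  obtain K L where K: "\<forall>n N. slot_norm n N (component F n N) \<le> K"
    and L: "\<forall>n N. slot_norm n N (component G n N) \<le> L"
    using component_bounded[of F] component_bounded[of G] by blast
  have "component (F * G) = (\<lambda>n N. component F n N * component G n N)"
    unfolding times_matrix_family_def
  proof (rule component_Matrix_family[where K = "K * L"])
    fix n and N :: "'a mat \<Rightarrow> real"
    have "0 \<le> slot_norm n N (component F n N)" "0 \<le> slot_norm n N (component G n N)"
      by (simp_all add: slot_norm_nonneg)
    then show "slot_norm n N (component F n N * component G n N) \<le> K * L"
      using K[rule_format, of n N] L[rule_format, of n N]
      by (intro order_trans[OF slot_norm_mult[OF component_carrier component_carrier]] mult_mono) linarith+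
    show "component F n N * component G n N \<in> carrier_mat n n"
      by (rule mult_carrier_mat[OF component_carrier component_carrier])
  qed (simp add: component_outside)
  then show ?thesis by simp
qed

instance
proof
  fix F G H :: "'a matrix_family" and r s :: real
  show "F * G * H = F * (G * H)"
    by (rule matrix_family_eqI)
      (simp only: component_mult assoc_mult_mat[OF component_carrier component_carrier component_carrier])
  show "(F + G) * H = F * H + G * H"
    by (rule matrix_family_eqI)
      (simp only: component_mult component_add add_mult_distrib_mat[OF component_carrier component_carrier component_carrier])
  show "F * (G + H) = F * G + F * H"
    by (rule matrix_family_eqI)
      (simp only: component_mult component_add mult_add_distrib_mat[OF component_carrier component_carrier component_carrier])
qed (rule matrix_family_eqI'; simp add: scaleC_add_left scaleC_add_right scaleC_scaleC algebra_simps)+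
end

lemma sup_norm_bdd: "bdd_above (range (\<lambda>(n, N). slot_norm n N (component F n N)))"
proof -
  obtain K where "\<forall>n N. slot_norm n N (component F n N) \<le> K" using component_bounded[of F] by blast
  then show ?thesis by (intro bdd_aboveI[of _ K]) auto
qed

instantiation matrix_family :: (cstar_algebra) real_normed_vector
begin
definition "norm F = (SUP (n, N). slot_norm n N (component F n N))"
definition "sgn F = F /\<^sub>R norm (F :: 'a matrix_family)"
definition "dist F G = norm (F - G :: 'a matrix_family)"
definition [code del]:
  "uniformity = (INF e\<in>{0<..}. principal {(x, y :: 'a matrix_family). dist x y < e})"
definition [code del]: "open U = (\<forall>x\<in>U. eventually (\<lambda>(x', y). x' = x \<longrightarrow> y \<in> U)
  (uniformity :: ('a matrix_family \<times> 'a matrix_family) filter))"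

lemma slot_norm_le_norm: "slot_norm n N (component F n N) \<le> norm F"
  unfolding norm_matrix_family_def
  using cSUP_upper[OF _ sup_norm_bdd, of "(n, N)" F] by simp

lemma matrix_family_norm_leI:
  assumes "\<And>n N. slot_norm n N (component F n N) \<le> K"
  shows "norm F \<le> K"
  unfolding norm_matrix_family_def using assms by (intro cSUP_least) auto

lemma matrix_family_norm_nonneg: "0 \<le> norm (F :: 'a matrix_family)"
  using slot_norm_nonneg[OF component_carrier] slot_norm_le_norm order_trans by blast

instance
proof
  fix F G :: "'a matrix_family" and r :: real
  show "norm F = 0 \<longleftrightarrow> F = 0"
  proof
    assume *: "norm F = 0"
    show "F = 0"
    proof (rule matrix_family_eqI)
      fix n and N :: "'a mat \<Rightarrow> real"
      have "slot_norm n N (component F n N) = 0"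
        using slot_norm_le_norm[of n N F] slot_norm_nonneg[OF component_carrier[of F n N], of N] * by simp
      then show "component F n N = component 0 n N"
        using cstar_norm_eq_0_iff[of n N "component F n N"]
        by (cases "is_cstar_norm n N") (simp_all add: component_outside slot_norm_def)
    qed
  next
    assume "F = 0"
    then show "norm F = 0"
      using matrix_family_norm_leI[of F 0] matrix_family_norm_nonneg[of F] by simp
  qed
  show "norm (F + G) \<le> norm F + norm G"
  proof (rule matrix_family_norm_leI)
    fix n and N :: "'a mat \<Rightarrow> real"
    show "slot_norm n N (component (F + G) n N) \<le> norm F + norm G"
      using slot_norm_triangle[OF component_carrier[of F n N] component_carrier[of G n N], of N]
        slot_norm_le_norm[of n N F] slot_norm_le_norm[of n N G] by simp
  qed
  have le: "norm (s *\<^sub>R H) \<le> \<bar>s\<bar> * norm H" for s and H :: "'a matrix_family"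
    by (rule matrix_family_norm_leI) (simp add: slot_norm_scaleC mult_left_mono slot_norm_le_norm)
  show "norm (r *\<^sub>R F) = \<bar>r\<bar> * norm F"
  proof (cases "r = 0")
    case True
    then show ?thesis using le[of r F] matrix_family_norm_nonneg[of "r *\<^sub>R F"] by simp
  next
    case False
    then have "norm F \<le> inverse \<bar>r\<bar> * norm (r *\<^sub>R F)" using le[of "inverse r" "r *\<^sub>R F"] by simp
    then have "\<bar>r\<bar> * norm F \<le> norm (r *\<^sub>R F)" using False by (simp add: field_simps)
    then show ?thesis using le[of r F] by simp
  qed
qed (simp_all only: sgn_matrix_family_def dist_matrix_family_def uniformity_matrix_family_def
    open_matrix_family_def)
end

instance matrix_family :: (cstar_algebra) real_normed_algebra
proof
  fix F G :: "'a matrix_family" and r :: real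
  show "(r *\<^sub>R F) * G = r *\<^sub>R (F * G)" "F * (r *\<^sub>R G) = r *\<^sub>R (F * G)"
    by (rule matrix_family_eqI; simp add: mat_scaleC_mult_left mat_scaleC_mult_right)+
  show "norm (F * G) \<le> norm F * norm G"
  proof (rule matrix_family_norm_leI)
    fix n and N :: "'a mat \<Rightarrow> real"
    have "slot_norm n N (component F n N) * slot_norm n N (component G n N) \<le> norm F * norm G"
      by (intro mult_mono slot_norm_le_norm norm_ge_zero slot_norm_nonneg component_carrier)
    then show "slot_norm n N (component (F * G) n N) \<le> norm F * norm G"
      using slot_norm_mult[OF component_carrier[of F n N] component_carrier[of G n N], of N] by simp
  qed
qed

instance matrix_family :: (cstar_algebra) banach
proof
  fix X :: "nat \<Rightarrow> 'a matrix_family"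
  assume X: "Cauchy X"
  have slot_diff: "slot_norm n N (component (X i) n N - component (X j) n N) \<le> norm (X i - X j)"
    for i j n N
    using slot_norm_le_norm[of n N "X i - X j"] by simp
  have "\<exists>L. L \<in> carrier_mat n n \<and> (\<not> is_cstar_norm n N \<longrightarrow> L = 0\<^sub>m n n) \<and>
      (\<lambda>k. slot_norm n N (component (X k) n N - L)) \<longlonglongrightarrow> 0" for n N
  proof (cases "is_cstar_norm n N")
    case True
    have "\<exists>K. \<forall>i\<ge>K. \<forall>j\<ge>K. N (component (X i) n N - component (X j) n N) < \<epsilon>" if \<epsilon>: "\<epsilon> > 0" for \<epsilon>
    proof -
      obtain K where K: "\<forall>i\<ge>K. \<forall>j\<ge>K. norm (X i - X j) < \<epsilon>" using CauchyD[OF X \<epsilon>] by blast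
      have "N (component (X i) n N - component (X j) n N) < \<epsilon>" if "i \<ge> K" "j \<ge> K" for i j
      proof -
        have "norm (X i - X j) < \<epsilon>" using K that by blast
        then show ?thesis using slot_diff[of n N i j] True by (simp add: slot_norm_def)
      qed
      then show ?thesis by blast
    qed
    then show ?thesis
      using cstar_norm_complete[OF True, of "\<lambda>k. component (X k) n N"] True
      by (simp add: slot_norm_def Bex_def)
  next
    case False
    then show ?thesis by (intro exI[of _ "0\<^sub>m n n"]) (simp add: slot_norm_def)
  qed
  then obtain L where L_carrier [simp]: "\<And>n N. L n N \<in> carrier_mat n n"
    and L_outside: "\<And>n N. \<not> is_cstar_norm n N \<Longrightarrow> L n N = 0\<^sub>m n n"
    and L_lim: "\<And>n N. (\<lambda>k. slot_norm n N (component (X k) n N - L n N)) \<longlonglongrightarrow> 0"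
    by metis
  have unif: "slot_norm n N (component (X i) n N - L n N) \<le> \<epsilon>"
    if K: "\<forall>i\<ge>K. \<forall>j\<ge>K. norm (X i - X j) < \<epsilon>" and "i \<ge> K" for n N \<epsilon> and K i :: nat
  proof (rule LIMSEQ_le_const)
    have "(\<lambda>j. \<epsilon> + slot_norm n N (component (X j) n N - L n N)) \<longlonglongrightarrow> \<epsilon> + 0"
      by (intro tendsto_intros L_lim)
    then show "(\<lambda>j. \<epsilon> + slot_norm n N (component (X j) n N - L n N)) \<longlonglongrightarrow> \<epsilon>" by simp
    have "slot_norm n N (component (X i) n N - L n N)
        \<le> \<epsilon> + slot_norm n N (component (X j) n N - L n N)" if "j \<ge> K" for j
    proof -
      have "norm (X i - X j) < \<epsilon>" using K \<open>i \<ge> K\<close> \<open>j \<ge> K\<close> by blast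
      then show ?thesis
        using slot_diff[of n N i j] slot_norm_diff_triangle[OF component_carrier[of "X i" n N]
            component_carrier[of "X j" n N] L_carrier[of n N], of N]
        by linarith
    qed
    then show "\<exists>K. \<forall>j\<ge>K. slot_norm n N (component (X i) n N - L n N)
        \<le> \<epsilon> + slot_norm n N (component (X j) n N - L n N)" by blast
  qed
  obtain K where K: "\<forall>i\<ge>K. \<forall>j\<ge>K. norm (X i - X j) < 1" using CauchyD[OF X, of 1] by auto
  have cL: "component (Matrix_family L) = L"
  proof (rule component_Matrix_family[where K = "1 + norm (X K)"])
    fix n and N :: "'a mat \<Rightarrow> real"
    let ?D = "component (X K) n N - L n N"
    have D: "?D \<in> carrier_mat n n" by (rule minus_carrier_mat) simp
    have "L n N = component (X K) n N + - ?D"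
      using carrier_matD[OF L_carrier[of n N]] by (intro eq_matI) simp_all
    then have "slot_norm n N (L n N) \<le> slot_norm n N (component (X K) n N) + slot_norm n N (- ?D)"
      using slot_norm_triangle[OF component_carrier[of "X K" n N], of "- ?D" N] D by simp
    moreover have "slot_norm n N (- ?D) \<le> 1"
      using unif[OF K order_refl, of n N] by (simp add: slot_norm_minus[OF D])
    ultimately show "slot_norm n N (L n N) \<le> 1 + norm (X K)"
      using slot_norm_le_norm[of n N "X K"] by linarith
  qed (simp_all add: L_outside)
  have "X \<longlonglongrightarrow> Matrix_family L"
  proof (rule LIMSEQ_I)
    fix r :: real assume "r > 0"
    then obtain K where K: "\<forall>i\<ge>K. \<forall>j\<ge>K. norm (X i - X j) < r / 2"
      using CauchyD[OF X, of "r / 2"] by auto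
    have "norm (X i - Matrix_family L) \<le> r / 2" if "i \<ge> K" for i
      by (rule matrix_family_norm_leI) (simp only: cL component_diff unif[OF K that])
    then show "\<exists>K. \<forall>i\<ge>K. norm (X i - Matrix_family L) < r" using \<open>r > 0\<close> by force
  qed
  then show "convergent X" unfolding convergent_def by blast
qed

instantiation matrix_family :: (cstar_algebra) cstar_algebra
begin
definition "c *\<^sub>C F = Matrix_family (\<lambda>n N. mat_scaleC c (component F n N))"
definition "star F = Matrix_family (\<lambda>n N. mat_star (component F n N))"

lemma component_scaleC [simp]: "component (c *\<^sub>C F) n N = mat_scaleC c (component F n N)"
proof -
  have "component (c *\<^sub>C F) = (\<lambda>n N. mat_scaleC c (component F n N))"
    unfolding scaleC_matrix_family_def
    by (rule component_Matrix_family[where K = "cmod c * norm F"])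
      (simp_all add: component_outside slot_norm_scaleC mat_scaleC_zero_mat mult_left_mono slot_norm_le_norm)
  then show ?thesis by simp
qed

lemma component_star [simp]: "component (star F) n N = mat_star (component F n N)"
proof -
  have "component (star F) = (\<lambda>n N. mat_star (component F n N))"
    unfolding star_matrix_family_def
    by (rule component_Matrix_family[where K = "norm F"])
      (simp_all add: component_outside slot_norm_star mat_star_zero_mat slot_norm_le_norm)
  then show ?thesis by simp
qed

instance
proof
  fix F G :: "'a matrix_family" and c d :: complex and r :: real
  show "c *\<^sub>C (F + G) = c *\<^sub>C F + c *\<^sub>C G" "(c + d) *\<^sub>C F = c *\<^sub>C F + d *\<^sub>C F"
    "c *\<^sub>C d *\<^sub>C F = (c * d) *\<^sub>C F" "star (star F) = F" "star (F + G) = star F + star G"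
    "star (c *\<^sub>C F) = cnj c *\<^sub>C star F"
    by (rule matrix_family_eqI'; simp add: scaleC_add_right scaleC_add_left scaleC_scaleC star_star
        star_add star_scaleC)+
  show "complex_of_real r *\<^sub>C F = r *\<^sub>R F" by (rule matrix_family_eqI) simp
  show "(c *\<^sub>C F) * G = c *\<^sub>C (F * G)" "F * (c *\<^sub>C G) = c *\<^sub>C (F * G)"
    "star (F * G) = star G * star F"
    by (rule matrix_family_eqI; simp add: mat_scaleC_mult_left mat_scaleC_mult_right mat_star_mult)+
  have le: "norm (d *\<^sub>C H) \<le> cmod d * norm H" for d and H :: "'a matrix_family"
    by (rule matrix_family_norm_leI) (simp add: slot_norm_scaleC mult_left_mono slot_norm_le_norm)
  show "norm (c *\<^sub>C F) = cmod c * norm F"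
  proof (cases "c = 0")
    case True
    then show ?thesis using le[of c F] by simp
  next
    case False
    have "inverse c *\<^sub>C c *\<^sub>C F = F"
      using False by (intro matrix_family_eqI) (simp add: mat_scaleC_scaleC)
    then have "norm F \<le> inverse (cmod c) * norm (c *\<^sub>C F)"
      using le[of "inverse c" "c *\<^sub>C F"] by (simp add: norm_inverse)
    then have "cmod c * norm F \<le> norm (c *\<^sub>C F)" using False by (simp add: field_simps)
    then show ?thesis using le[of c F] by simp
  qed
  show "norm (star F * F) = (norm F)\<^sup>2"
  proof (rule antisym)
    have "norm (star F) \<le> norm F"
      by (rule matrix_family_norm_leI) (simp add: slot_norm_star slot_norm_le_norm)
    then show "norm (star F * F) \<le> (norm F)\<^sup>2"
      using norm_mult_ineq[of "star F" F] mult_right_mono[of "norm (star F)" "norm F" "norm F"]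
      by (simp add: power2_eq_square)
    have "norm F \<le> sqrt (norm (star F * F))"
    proof (rule matrix_family_norm_leI)
      fix n and N :: "'a mat \<Rightarrow> real"
      have "(slot_norm n N (component F n N))\<^sup>2 \<le> norm (star F * F)"
        using slot_norm_le_norm[of n N "star F * F"] by (simp add: slot_norm_star_mult)
      then show "slot_norm n N (component F n N) \<le> sqrt (norm (star F * F))" by (rule real_le_rsqrt)
    qed
    then show "(norm F)\<^sup>2 \<le> norm (star F * F)"
      using power_mono[of "norm F" "sqrt (norm (star F * F))" 2] by simp
  qed
qed
end

section \<open>Norm and order of a matrix algebra\<close>
definition embed_matrix :: "nat \<Rightarrow> ('a::cstar_algebra mat \<Rightarrow> real) \<Rightarrow> 'a mat \<Rightarrow> 'a matrix_family" where
  "embed_matrix n N x = Matrix_family (\<lambda>m M. if m = n \<and> M = N then x else 0\<^sub>m m m)"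

context
  fixes n :: nat and N :: "'a::cstar_algebra mat \<Rightarrow> real"
  assumes N: "is_cstar_norm n N"
begin

lemma component_embed_matrix:
  assumes x: "x \<in> carrier_mat n n"
  shows "component (embed_matrix n N x) m M = (if m = n \<and> M = N then x else 0\<^sub>m m m)"
proof -
  have "component (embed_matrix n N x) = (\<lambda>m M. if m = n \<and> M = N then x else 0\<^sub>m m m)"
    unfolding embed_matrix_def
  proof (rule component_Matrix_family[where K = "slot_norm n N x"])
    show "slot_norm m M (if m = n \<and> M = N then x else 0\<^sub>m m m) \<le> slot_norm n N x" for m M
      using slot_norm_nonneg[OF x, of N] by auto
  qed (use x N in auto)
  then show ?thesis by simp
qed

lemma embed_matrix_add:
  assumes x: "x \<in> carrier_mat n n" and y: "y \<in> carrier_mat n n"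
  shows "embed_matrix n N (x + y) = embed_matrix n N x + embed_matrix n N y"
proof (rule matrix_family_eqI)
  have "x + y \<in> carrier_mat n n" using x y by simp
  then show "component (embed_matrix n N (x + y)) m M
      = component (embed_matrix n N x + embed_matrix n N y) m M" for m M
    by (simp add: component_embed_matrix x y)
qed

lemma embed_matrix_diff:
  assumes x: "x \<in> carrier_mat n n" and y: "y \<in> carrier_mat n n"
  shows "embed_matrix n N (x - y) = embed_matrix n N x - embed_matrix n N y"
proof (rule matrix_family_eqI)
  have "x - y \<in> carrier_mat n n" using y by (rule minus_carrier_mat)
  then show "component (embed_matrix n N (x - y)) m M
      = component (embed_matrix n N x - embed_matrix n N y) m M" for m M
    by (simp add: component_embed_matrix x y minus_r_inv_mat[OF zero_carrier_mat])
qed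

lemma embed_matrix_mult:
  assumes x: "x \<in> carrier_mat n n" and y: "y \<in> carrier_mat n n"
  shows "embed_matrix n N (x * y) = embed_matrix n N x * embed_matrix n N y"
proof (rule matrix_family_eqI)
  have "x * y \<in> carrier_mat n n" using x y by (rule mult_carrier_mat)
  then show "component (embed_matrix n N (x * y)) m M
      = component (embed_matrix n N x * embed_matrix n N y) m M" for m M
    by (simp add: component_embed_matrix x y)
qed

lemma embed_matrix_star:
  assumes x: "x \<in> carrier_mat n n"
  shows "embed_matrix n N (mat_star x) = star (embed_matrix n N x)"
  by (rule matrix_family_eqI) (simp add: component_embed_matrix x mat_star_zero_mat)

lemma embed_matrix_scaleC:
  assumes x: "x \<in> carrier_mat n n"
  shows "embed_matrix n N (mat_scaleC c x) = c *\<^sub>C embed_matrix n N x"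
  by (rule matrix_family_eqI) (simp add: component_embed_matrix x mat_scaleC_zero_mat)

lemma norm_embed_matrix:
  assumes x: "x \<in> carrier_mat n n" shows "norm (embed_matrix n N x) = N x"
proof -
  have slot: "slot_norm n N x = N x" using N by (simp add: slot_norm_def)
  have "norm (embed_matrix n N x) \<le> slot_norm n N x"
  proof (rule matrix_family_norm_leI)
    show "slot_norm m M (component (embed_matrix n N x) m M) \<le> slot_norm n N x" for m M
      using slot_norm_nonneg[OF x, of N] by (simp add: component_embed_matrix[OF x])
  qed
  moreover have "slot_norm n N x \<le> norm (embed_matrix n N x)"
    using slot_norm_le_norm[of n N "embed_matrix n N x"] by (simp add: component_embed_matrix[OF x])
  ultimately show ?thesis by (simp add: slot)
qed

lemma embed_matrix_pos_iff:
  assumes x: "x \<in> carrier_mat n n"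
  shows "embed_matrix n N x \<in> pos \<longleftrightarrow> x \<in> mats_pos n UNIV"
proof
  assume "embed_matrix n N x \<in> pos"
  then obtain F where "embed_matrix n N x = star F * F" unfolding pos_def by blast
  then have "component (embed_matrix n N x) n N = component (star F * F) n N" by simp
  then have "x = mat_star (component F n N) * component F n N" by (simp add: component_embed_matrix[OF x])
  then show "x \<in> mats_pos n UNIV"
    unfolding mats_pos_def mats_def using x component_carrier[of F n N] by blast
next
  assume "x \<in> mats_pos n UNIV"
  then obtain y where y: "y \<in> carrier_mat n n" "x = mat_star y * y" unfolding mats_pos_def by blast
  then have "embed_matrix n N x = star (embed_matrix n N y) * embed_matrix n N y"
    using embed_matrix_mult[of "mat_star y" y] embed_matrix_star[OF y(1)] by simp
  then show "embed_matrix n N x \<in> pos" unfolding pos_def by blast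
qed

end

text \<open>
  Taking the \<open>(n, M)\<close> component and placing it at \<open>(n, N)\<close> is a *-homomorphism of the product into
  itself, hence contractive. With the roles of \<open>N\<close> and \<open>M\<close> exchanged this gives uniqueness of the
  complete C*-norm on matrices.
\<close>
lemma cstar_norm_le:
  assumes N: "is_cstar_norm n N" and M: "is_cstar_norm n M" and x: "x \<in> carrier_mat n n"
  shows "N x \<le> M x"
proof -
  have "norm (embed_matrix n N (component F n M)) \<le> norm F" for F
  proof (rule star_homomorphism_contractive)
    show "embed_matrix n N (component (r *\<^sub>R G) n M) = r *\<^sub>R embed_matrix n N (component G n M)" for r G
      using embed_matrix_scaleC[OF N component_carrier[of G n M], of "complex_of_real r"]
      by (simp add: scaleC_of_real)
  qed (simp_all add: embed_matrix_add[OF N] embed_matrix_mult[OF N] embed_matrix_star[OF N])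
  from this[of "embed_matrix n M x"] show ?thesis
    by (simp add: component_embed_matrix[OF M x] norm_embed_matrix[OF N x] norm_embed_matrix[OF M x])
qed

lemma mat_norm_eq:
  assumes N: "is_cstar_norm n N" and x: "x \<in> carrier_mat n n"
  shows "mat_norm x = N x"
  unfolding mat_norm_def
proof (rule the_equality)
  show "\<exists>M. is_cstar_norm (dim_row x) M \<and> N x = M x" using N x by auto
  fix r assume "\<exists>M. is_cstar_norm (dim_row x) M \<and> r = M x"
  then obtain M where M: "is_cstar_norm n M" "r = M x" using x by auto
  show "r = N x"
    using cstar_norm_le[OF N M(1) x] cstar_norm_le[OF M(1) N x] M(2) by simp
qed

lemma is_cstar_norm_cong:
  assumes eq: "\<And>x. x \<in> carrier_mat n n \<Longrightarrow> M x = N x" and N: "is_cstar_norm n N"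
  shows "is_cstar_norm n M"
proof -
  have carriers: "x + y \<in> carrier_mat n n" "x - y \<in> carrier_mat n n" "x * y \<in> carrier_mat n n"
    "mat_star x \<in> carrier_mat n n" "mat_star x * x \<in> carrier_mat n n" "mat_scaleC c x \<in> carrier_mat n n"
    if "x \<in> carrier_mat n n" "y \<in> carrier_mat n n" for x y :: "'a mat" and c
    using that by (auto intro: minus_carrier_mat mult_carrier_mat)
  show ?thesis
    using N unfolding is_cstar_norm_def
    by (simp add: eq carriers cong: conj_cong)
qed

lemma is_cstar_norm_mat_norm:
  assumes "is_cstar_norm n (N :: 'a::cstar_algebra mat \<Rightarrow> real)"
  shows "is_cstar_norm n (mat_norm :: 'a mat \<Rightarrow> real)"
  by (rule is_cstar_norm_cong[OF mat_norm_eq[OF assms] assms])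

definition entry_mat :: "nat \<Rightarrow> nat \<Rightarrow> nat \<Rightarrow> 'a::zero \<Rightarrow> 'a mat" where
  "entry_mat n p q a = mat n n (\<lambda>(i, j). if i = p \<and> j = q then a else 0)"

lemma entry_mat_carrier [simp]: "entry_mat n p q a \<in> carrier_mat n n"
  by (simp add: entry_mat_def)

lemma entry_mat_dim [simp]: "dim_row (entry_mat n p q a) = n" "dim_col (entry_mat n p q a) = n"
  by (simp_all add: entry_mat_def)

lemma index_entry_mat [simp]:
  "i < n \<Longrightarrow> j < n \<Longrightarrow> entry_mat n p q a $$ (i, j) = (if i = p \<and> j = q then a else 0)"
  by (simp add: entry_mat_def)

lemma entry_mat_mult:
  assumes "q < n"
  shows "entry_mat n p q a * entry_mat n q r b = entry_mat n p r (a * b :: 'a::cstar_algebra)"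
proof (rule eq_matI)
  fix i j assume ij: "i < dim_row (entry_mat n p r (a * b))" "j < dim_col (entry_mat n p r (a * b))"
  have "(\<Sum>k = 0..<n. (if i = p \<and> k = q then a else 0) * (if k = q \<and> j = r then b else 0))
      = (\<Sum>k = 0..<n. if k = q then (if i = p \<and> j = r then a * b else 0) else 0)"
    by (rule sum.cong) auto
  with ij assms show "(entry_mat n p q a * entry_mat n q r b) $$ (i, j) = entry_mat n p r (a * b) $$ (i, j)"
    by (simp add: scalar_prod_def)
qed simp_all

lemma mat_star_entry_mat: "mat_star (entry_mat n p q a) = entry_mat n q p (star a)"
  by (rule eq_matI) auto

lemma entry_mat_add: "entry_mat n p q (a + b) = entry_mat n p q a + entry_mat n p q (b :: 'a::cstar_algebra)"
  by (rule eq_matI) auto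

lemma entry_mat_scaleC: "entry_mat n p q (c *\<^sub>C a) = mat_scaleC c (entry_mat n p q a)"
  by (rule eq_matI) auto

text \<open>
  By the C*-identity the norm of a matrix with the single entry \<open>a\<close> is determined by that of the
  matrix with \<open>a\<^sup>*a\<close> at a diagonal place, and for a diagonal place the inclusion is a *-homomorphism.
\<close>
lemma cstar_norm_entry_mat_le:
  fixes N :: "'a::cstar_algebra mat \<Rightarrow> real"
  assumes N: "is_cstar_norm n N" and p: "p < n" and q: "q < n"
  shows "N (entry_mat n p q a) \<le> norm a"
proof -
  have "norm (embed_matrix n N (entry_mat n q q b)) \<le> norm b" for b :: 'a
  proof (rule star_homomorphism_contractive)
    show "embed_matrix n N (entry_mat n q q (r *\<^sub>R x)) = r *\<^sub>R embed_matrix n N (entry_mat n q q x)" for r x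
      unfolding scaleC_of_real[symmetric] entry_mat_scaleC embed_matrix_scaleC[OF N entry_mat_carrier] ..
    show "embed_matrix n N (entry_mat n q q (x * y))
        = embed_matrix n N (entry_mat n q q x) * embed_matrix n N (entry_mat n q q y)" for x y
      unfolding entry_mat_mult[OF q, symmetric] embed_matrix_mult[OF N entry_mat_carrier entry_mat_carrier] ..
  qed (simp_all add: entry_mat_add embed_matrix_add[OF N]  mat_star_entry_mat[symmetric] embed_matrix_star[OF N])
  from this[of "star a * a"] have "N (entry_mat n q q (star a * a)) \<le> (norm a)\<^sup>2"
    by (simp add: norm_embed_matrix[OF N] cstar_identity)
  moreover have "entry_mat n q q (star a * a) = mat_star (entry_mat n p q a) * entry_mat n p q a"
    by (simp add: mat_star_entry_mat entry_mat_mult[OF p])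
  ultimately have "(N (entry_mat n p q a))\<^sup>2 \<le> (norm a)\<^sup>2"
    by (simp add: cstar_norm_star_mult[OF N])
  then show ?thesis by (rule power2_le_imp_le) simp
qed

lemma component_sum_index:
  "i < n \<Longrightarrow> j < n \<Longrightarrow>
    component (\<Sum>k\<in>K. F k) n N $$ (i, j) = (\<Sum>k\<in>K. component (F k) n N $$ (i, j))"
  by (induction K rule: infinite_finite_induct) simp_all

lemma cstar_norm_le_sum_entries:
  fixes N :: "'a::cstar_algebra mat \<Rightarrow> real"
  assumes N: "is_cstar_norm n N" and x: "x \<in> carrier_mat n n"
  shows "N x \<le> (\<Sum>p<n. \<Sum>q<n. norm (x $$ (p, q)))"
proof -
  let ?F = "\<lambda>p q. embed_matrix n N (entry_mat n p q (x $$ (p, q)))"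
  have "embed_matrix n N x = (\<Sum>p<n. \<Sum>q<n. ?F p q)"
  proof (rule matrix_family_eqI')
    fix m i j :: nat and M :: "'a mat \<Rightarrow> real" assume ij: "i < m" "j < m"
    show "component (embed_matrix n N x) m M $$ (i, j) = component (\<Sum>p<n. \<Sum>q<n. ?F p q) m M $$ (i, j)"
    proof (cases "m = n \<and> M = N")
      case True
      have "(\<Sum>p<n. \<Sum>q<n. if i = p \<and> j = q then x $$ (p, q) else 0)
          = (\<Sum>p<n. if p = i then x $$ (p, j) else 0)"
        using True ij by (intro sum.cong refl) (auto simp: sum.delta)
      then show ?thesis
        using True ij by (simp add: component_sum_index component_embed_matrix[OF N] x)
    qed (use ij in \<open>auto simp: component_sum_index component_embed_matrix[OF N] x\<close>)
  qed
  then have "N x = norm (\<Sum>p<n. \<Sum>q<n. ?F p q)" using norm_embed_matrix[OF N x] by simp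
  also have "\<dots> \<le> (\<Sum>p<n. \<Sum>q<n. norm (x $$ (p, q)))"
    by (intro order_trans[OF norm_sum] sum_mono)
      (simp add: norm_embed_matrix[OF N] cstar_norm_entry_mat_le[OF N])
  finally show ?thesis .
qed

section \<open>Extension of functionals\<close>

text \<open>
  The Hahn--Banach theorem for sublinear \<open>p\<close>. Zorn's lemma is applied to subspaces of
  \<open>V \<times> \<real>\<close> all of whose elements \<open>(x, a)\<close> satisfy \<open>a \<le> p(x)\<close>: such a subspace is the graph of a
  function, because \<open>(0, a)\<close> and \<open>(0, - a)\<close> can only both belong to it if \<open>a = 0\<close>.
\<close>
theorem sublinear_extension:
  fixes p :: "'v::real_vector \<Rightarrow> real" and f :: "'v \<Rightarrow> real"
  assumes p_add: "\<And>x y. p (x + y) \<le> p x + p y"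
    and p_scale: "\<And>r x. 0 \<le> r \<Longrightarrow> p (r *\<^sub>R x) = r * p x"
    and S: "subspace S"
    and f_add: "\<And>x y. x \<in> S \<Longrightarrow> y \<in> S \<Longrightarrow> f (x + y) = f x + f y"
    and f_scale: "\<And>r x. x \<in> S \<Longrightarrow> f (r *\<^sub>R x) = r * f x"
    and f_le: "\<And>x. x \<in> S \<Longrightarrow> f x \<le> p x"
  obtains g where "linear g" and "\<And>x. x \<in> S \<Longrightarrow> g x = f x" and "\<And>x. g x \<le> p x"
proof -
  define G0 where "G0 = (\<lambda>x. (x, f x)) ` S"
  define \<G> where "\<G> = {G. subspace G \<and> G0 \<subseteq> G \<and> (\<forall>(x, a)\<in>G. a \<le> p x)}"
  have f0: "f 0 = 0" using f_scale[of 0 0] subspace_0[OF S] by simp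
  have "subspace G0"
    unfolding G0_def subspace_def
    using S f0 by (auto simp: image_iff subspace_def f_add f_scale zero_prod_def)
  then have "G0 \<in> \<G>" unfolding \<G>_def G0_def using f_le by auto
  have "\<exists>M\<in>\<G>. \<forall>G\<in>\<G>. M \<subseteq> G \<longrightarrow> G = M"
  proof (rule subset_Zorn_nonempty)
    show "\<G> \<noteq> {}" using \<open>G0 \<in> \<G>\<close> by blast
  next
    fix \<C> assume ne: "\<C> \<noteq> {}" and chain: "subset.chain \<G> \<C>"
    have \<C>: "\<And>G. G \<in> \<C> \<Longrightarrow> subspace G \<and> G0 \<subseteq> G \<and> (\<forall>(x, a)\<in>G. a \<le> p x)"
      and total: "\<And>G H. G \<in> \<C> \<Longrightarrow> H \<in> \<C> \<Longrightarrow> G \<subseteq> H \<or> H \<subseteq> G"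
      using chain unfolding subset_chain_def \<G>_def by blast+
    have "subspace (\<Union>\<C>)"
    proof (rule subspaceI)
      show "0 \<in> \<Union>\<C>" using ne \<C> subspace_0 by blast
      show "u + v \<in> \<Union>\<C>" if uv: "u \<in> \<Union>\<C>" "v \<in> \<Union>\<C>" for u v
      proof -
        obtain G H where "G \<in> \<C>" "H \<in> \<C>" "u \<in> G" "v \<in> H" using uv by blast
        with total[of G H] obtain K where "K \<in> \<C>" "u \<in> K" "v \<in> K" by blast
        with \<C> subspace_add[of K u v] show ?thesis by blast
      qed
      show "r *\<^sub>R u \<in> \<Union>\<C>" if "u \<in> \<Union>\<C>" for r u
        using that \<C> subspace_scale by blast
    qed
    then show "\<Union>\<C> \<in> \<G>" unfolding \<G>_def using ne \<C> by blast
  qed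
  then obtain M where M: "M \<in> \<G>" and max: "\<And>G. G \<in> \<G> \<Longrightarrow> M \<subseteq> G \<Longrightarrow> G = M" by blast
  have subM: "subspace M" and G0M: "G0 \<subseteq> M" and le: "\<And>x a. (x, a) \<in> M \<Longrightarrow> a \<le> p x"
    using M unfolding \<G>_def by auto
  have unique: "a = b" if "(x, a) \<in> M" "(x, b) \<in> M" for x a b
  proof -
    have diff: "c \<le> 0" if "(0, c) \<in> M" for c
      using le[OF that] p_scale[of 0 0] by simp
    have "(x, a) - (x, b) \<in> M" "(x, b) - (x, a) \<in> M"
      using that subM subspace_diff by blast+
    then have "(0, a - b) \<in> M" "(0, b - a) \<in> M" by simp_all
    then have "a - b \<le> 0" "b - a \<le> 0" by (blast intro: diff)+
    then show ?thesis by simp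
  qed
  have ex: "\<exists>a. (x0, a) \<in> M" for x0
  proof -
    let ?A = "{a - p (x - x0) |x a. (x, a) \<in> M}"
    (* The value at x0 has to lie between these two families of numbers. *)
    have bound: "a - p (x - x0) \<le> p (y + x0) - b" if "(x, a) \<in> M" "(y, b) \<in> M" for x a y b
    proof -
      have "(x, a) + (y, b) \<in> M" using that subM subspace_add by blast
      then have "a + b \<le> p (x + y)" using le by simp
      also have "\<dots> \<le> p (x - x0) + p (y + x0)" using p_add[of "x - x0" "y + x0"] by simp
      finally show ?thesis by simp
    qed
    have zeroM: "(0, 0) \<in> M" using subspace_0[OF subM] by (simp add: zero_prod_def)
    define \<alpha> where "\<alpha> = Sup ?A"
    have "bdd_above ?A" using bound[OF _ zeroM] by (auto intro!: bdd_aboveI)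
    then have lower: "a - p (x - x0) \<le> \<alpha>" if "(x, a) \<in> M" for x a
      unfolding \<alpha>_def using that by (intro cSup_upper) auto
    have upper: "\<alpha> \<le> p (y + x0) - b" if "(y, b) \<in> M" for y b
      unfolding \<alpha>_def using bound[OF _ that] zeroM by (intro cSup_least) auto
    let ?G = "span (insert (x0, \<alpha>) M)"
    have "c \<le> p z" if zc: "(z, c) \<in> ?G" for z c
    proof -
      obtain t where "(z, c) - t *\<^sub>R (x0, \<alpha>) \<in> span M" using zc span_breakdown_eq by blast
      moreover have "span M = M" using subM by (simp add: span_eq_iff)
      ultimately have m: "(z - t *\<^sub>R x0, c - t * \<alpha>) \<in> M" by simp
      have scaled: "((1/s) *\<^sub>R (z - t *\<^sub>R x0), (1/s) * (c - t * \<alpha>)) \<in> M" for s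
        using subspace_scale[OF subM m, of "1/s"] by simp
      consider "t = 0" | "t > 0" | "t < 0" by linarith
      then show ?thesis
      proof cases
        case 1
        then show ?thesis using le[OF m] by simp
      next
        case 2
        then have "(1/t) *\<^sub>R (z - t *\<^sub>R x0) + x0 = (1/t) *\<^sub>R z" by (simp add: scaleR_diff_right)
        then have "\<alpha> \<le> (1/t) * p z - (1/t) * (c - t * \<alpha>)"
          using upper[OF scaled[of t]] p_scale[of "1/t" z] 2 by simp
        then show ?thesis using 2 by (simp add: field_simps)
      next
        case 3
        then have "(1/(-t)) *\<^sub>R (z - t *\<^sub>R x0) - x0 = (1/(-t)) *\<^sub>R z" by (simp add: scaleR_diff_right)
        then have "(1/(-t)) * (c - t * \<alpha>) - (1/(-t)) * p z \<le> \<alpha>"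
          using lower[OF scaled[of "-t"]] p_scale[of "1/(-t)" z] 3 by simp
        then show ?thesis using 3 by (simp add: field_simps)
      qed
    qed
    moreover have "M \<subseteq> ?G" using span_superset[of "insert (x0, \<alpha>) M"] by blast
    ultimately have "?G \<in> \<G>" unfolding \<G>_def using G0M by auto
    then have "?G = M" using max \<open>M \<subseteq> ?G\<close> by blast
    then have "(x0, \<alpha>) \<in> M" using span_base[of "(x0, \<alpha>)" "insert (x0, \<alpha>) M"] by simp
    then show ?thesis by blast
  qed
  define g where "g x = (THE a. (x, a) \<in> M)" for x
  have gM: "(x, g x) \<in> M" for x
    unfolding g_def using ex[of x] unique by (metis theI)
  have g_eq: "(x, a) \<in> M \<Longrightarrow> g x = a" for x a using gM unique by blast
  show thesis
  proof (rule that[of g])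
    show "linear g"
    proof (rule linearI)
      show "g (x + y) = g x + g y" for x y
        using subspace_add[OF subM gM[of x] gM[of y]] by (intro g_eq) simp
      show "g (r *\<^sub>R x) = r *\<^sub>R g x" for r x
        using subspace_scale[OF subM gM[of x], of r] by (intro g_eq) simp
    qed
    show "g x = f x" if "x \<in> S" for x
      using G0M that unfolding G0_def by (intro g_eq) blast
    show "g x \<le> p x" for x using le[OF gM] .
  qed
qed

text \<open>
  The real part of \<open>\<psi>\<close> extends to a real functional \<open>g\<close>. Then \<open>h(x) = g(x) - i g(ix)\<close> is complex
  linear, it extends \<open>\<psi>\<close>, and multiplying \<open>x\<close> by a suitable complex number of modulus \<open>1\<close> shows that it
  satisfies the same bound. The average of \<open>h\<close> and its adjoint is hermitian and still extends \<open>\<psi>\<close>.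
\<close>
theorem hermitian_functional_extension:
  fixes S :: "'a::cstar_algebra set" and \<psi> :: "'a \<Rightarrow> complex"
  assumes S: "star_subspace S"
    and add: "\<And>x y. x \<in> S \<Longrightarrow> y \<in> S \<Longrightarrow> \<psi> (x + y) = \<psi> x + \<psi> y"
    and scale: "\<And>c x. x \<in> S \<Longrightarrow> \<psi> (c *\<^sub>C x) = c * \<psi> x"
    and hermitian: "\<And>x. x \<in> S \<Longrightarrow> \<psi> (star x) = cnj (\<psi> x)"
    and bound: "\<And>x. x \<in> S \<Longrightarrow> cmod (\<psi> x) \<le> K * norm x"
    and "0 \<le> K"
  obtains \<Phi> where "\<And>x y. \<Phi> (x + y) = \<Phi> x + \<Phi> y" and "\<And>c x. \<Phi> (c *\<^sub>C x) = c * \<Phi> x"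
    and "\<And>x. \<Phi> (star x) = cnj (\<Phi> x)" and "\<And>x. cmod (\<Phi> x) \<le> K * norm x"
    and "\<And>x. x \<in> S \<Longrightarrow> \<Phi> x = \<psi> x"
proof -
  have S_scaleC: "c *\<^sub>C x \<in> S" and S_star: "star x \<in> S" if "x \<in> S" for c x
    using S that unfolding star_subspace_def by blast+
  have "subspace S"
    using S unfolding star_subspace_def subspace_def by (simp add: scaleC_of_real[symmetric])
  obtain g where g: "linear g" and g_ext: "\<And>x. x \<in> S \<Longrightarrow> g x = Re (\<psi> x)"
    and g_le: "\<And>x. g x \<le> K * norm x"
  proof (rule sublinear_extension[of "\<lambda>x. K * norm x" S "\<lambda>x. Re (\<psi> x)"])
    show "K * norm (x + y) \<le> K * norm x + K * norm y" for x y :: 'a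
      using mult_left_mono[OF norm_triangle_ineq \<open>0 \<le> K\<close>] by (simp add: distrib_left)
    show "Re (\<psi> (r *\<^sub>R x)) = r * Re (\<psi> x)" if "x \<in> S" for r x
      using scale[OF that, of "complex_of_real r"] by (simp add: scaleC_of_real)
    show "Re (\<psi> x) \<le> K * norm x" if "x \<in> S" for x
      using bound[OF that] complex_Re_le_cmod order_trans by blast
  qed (use \<open>subspace S\<close> add in auto)
  have g_add: "g (x + y) = g x + g y" and g_scale: "g (r *\<^sub>R x) = r * g x" for x y r
    using linear_add[OF g] linear_scale[OF g] by simp_all
  define h where "h x = Complex (g x) (- g (\<i> *\<^sub>C x))" for x
  have h_add: "h (x + y) = h x + h y" for x y
    by (simp add: h_def scaleC_add_right g_add complex_eq_iff)
  have h_scale: "h (c *\<^sub>C x) = c * h x" for c x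
  proof -
    have c: "c *\<^sub>C y = Re c *\<^sub>R y + Im c *\<^sub>R (\<i> *\<^sub>C y)" for y :: 'a
    proof -
      have "c *\<^sub>C y = (complex_of_real (Re c) + complex_of_real (Im c) * \<i>) *\<^sub>C y"
        by (simp add: complex_eq[of c, symmetric] mult.commute)
      then show ?thesis by (simp add: scaleC_add_left scaleC_scaleC[symmetric] scaleC_of_real)
    qed
    have "\<i> *\<^sub>C \<i> *\<^sub>C x = - x" by (simp add: scaleC_scaleC scaleC_minus_left)
    then have "\<i> *\<^sub>C c *\<^sub>C x = Re c *\<^sub>R (\<i> *\<^sub>C x) - Im c *\<^sub>R x"
      by (simp add: c[of x] scaleC_add_right scaleC_scaleR)
    moreover have "g (- x) = - g x" for x using g_scale[of "-1" x] by simp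
    ultimately show ?thesis
      using g_add[of "Re c *\<^sub>R (\<i> *\<^sub>C x)" "- (Im c *\<^sub>R x)"]
      by (simp add: h_def c[of x] g_add g_scale complex_eq_iff)
  qed
  have h_le: "cmod (h x) \<le> K * norm x" for x
  proof (cases "h x = 0")
    case False
    define u where "u = cnj (h x) / cmod (h x)"
    have "u * h x = cmod (h x)"
      using False by (simp add: u_def complex_norm_square[symmetric] power2_eq_square mult.commute)
    then have "cmod (h x) = Re (h (u *\<^sub>C x))" by (simp add: h_scale)
    also have "\<dots> \<le> K * norm (u *\<^sub>C x)" using g_le by (simp add: h_def)
    also have "norm (u *\<^sub>C x) = norm x" using False by (simp add: norm_scaleC u_def norm_divide)
    finally show ?thesis .
  qed (use \<open>0 \<le> K\<close> in simp)
  have h_ext: "h x = \<psi> x" if "x \<in> S" for x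
    using that by (simp add: h_def g_ext S_scaleC scale complex_eq_iff)
  define \<Phi> where "\<Phi> x = (h x + cnj (h (star x))) / 2" for x
  show thesis
  proof (rule that[of \<Phi>])
    show "\<Phi> (x + y) = \<Phi> x + \<Phi> y" for x y
      by (simp add: \<Phi>_def star_add h_add add_divide_distrib)
    show "\<Phi> (c *\<^sub>C x) = c * \<Phi> x" for c x
      by (simp add: \<Phi>_def star_scaleC h_scale distrib_left)
    show "\<Phi> (star x) = cnj (\<Phi> x)" for x
      by (simp add: \<Phi>_def star_star add.commute)
    show "\<Phi> x = \<psi> x" if "x \<in> S" for x
      using that by (simp add: \<Phi>_def h_ext S_star hermitian)
    show "cmod (\<Phi> x) \<le> K * norm x" for x
    proof -
      have "cmod (h x + cnj (h (star x))) \<le> K * norm x + K * norm x"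
        using h_le[of x] h_le[of "star x"] by (intro order_trans[OF norm_triangle_ineq] add_mono) simp_all
      then show ?thesis by (simp add: \<Phi>_def norm_divide)
    qed
  qed
qed

section \<open>Block matrices and diagonal amplifications\<close>
lemma mats_UNIV: "mats n UNIV = carrier_mat n n"
  by (auto simp: mats_def)

lemma mats_carrier: "x \<in> mats n V \<Longrightarrow> x \<in> carrier_mat n n"
  by (simp add: mats_def)

lemma mats_mono: "U \<subseteq> V \<Longrightarrow> mats n U \<subseteq> mats n V"
  by (auto simp: mats_def)

lemma mats_closed:
  assumes V: "star_subspace V" and x: "x \<in> mats n V"
  shows "mat_scaleC c x \<in> mats n V" and "mat_star x \<in> mats n V"
    and "y \<in> mats n V \<Longrightarrow> x + y \<in> mats n V" and "y \<in> mats n V \<Longrightarrow> x - y \<in> mats n V"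
proof -
  have dim: "dim_row z = n" "dim_col z = n" if "z \<in> mats n V" for z
    using that by (auto simp: mats_def)
  have diff: "a - b \<in> V" if "a \<in> V" "b \<in> V" for a b
  proof -
    have "a + (- 1) *\<^sub>C b \<in> V" using V that unfolding star_subspace_def by blast
    then show ?thesis by (simp add: scaleC_minus_left)
  qed
  show "mat_scaleC c x \<in> mats n V" "mat_star x \<in> mats n V"
    using V x dim[OF x] unfolding star_subspace_def mats_def by auto
  show "x + y \<in> mats n V" if "y \<in> mats n V"
    using V x that dim[OF x] dim[OF that] unfolding star_subspace_def mats_def by auto
  show "x - y \<in> mats n V" if "y \<in> mats n V"
    using x that dim[OF x] dim[OF that] diff unfolding mats_def by (auto intro: minus_carrier_mat)
qed

lemma mats_zero: "star_subspace V \<Longrightarrow> 0\<^sub>m n n \<in> mats n V"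
  unfolding star_subspace_def mats_def by auto

lemma star_subspace_UNIV: "star_subspace UNIV"
  by (simp add: star_subspace_def)

lemma mats_pos_iff: "x \<in> mats_pos n V \<longleftrightarrow> x \<in> mats n V \<and> x \<in> mats_pos n UNIV"
  by (auto simp: mats_pos_def mats_def)

lemma mats_pos_carrier: "x \<in> mats_pos n V \<Longrightarrow> x \<in> carrier_mat n n"
  by (simp add: mats_pos_def mats_def)

lemma mats_pos_self_adjoint: "x \<in> mats_pos n V \<Longrightarrow> mat_star x = x"
  unfolding mats_pos_def by (auto simp: mat_star_mult)

lemma mats_pos_scale:
  assumes "x \<in> mats_pos n UNIV" and "0 \<le> r"
  shows "mat_scaleC (complex_of_real r) x \<in> mats_pos n UNIV"
proof -
  obtain y where y: "y \<in> carrier_mat n n" "x = mat_star y * y"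
    using assms(1) unfolding mats_pos_def by blast
  let ?z = "mat_scaleC (complex_of_real (sqrt r)) y"
  have "mat_star ?z = mat_scaleC (complex_of_real (sqrt r)) (mat_star y)"
    by (rule eq_matI) (simp_all add: star_scaleC)
  then have "mat_star ?z * ?z = mat_scaleC (complex_of_real (sqrt r) * complex_of_real (sqrt r)) x"
    using y by (simp add: mat_scaleC_mult_left mat_scaleC_mult_right mat_scaleC_scaleC)
  also have "complex_of_real (sqrt r) * complex_of_real (sqrt r) = complex_of_real r"
    using assms(2) by (simp flip: of_real_mult)
  finally have "mat_scaleC (complex_of_real r) x = mat_star ?z * ?z" ..
  moreover have "mat_scaleC (complex_of_real r) x \<in> carrier_mat n n" "?z \<in> carrier_mat n n"
    using y(1) mats_pos_carrier[OF assms(1)] by simp_all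
  ultimately show ?thesis unfolding mats_pos_def mats_UNIV by blast
qed

text \<open>
  The hypotheses say that the \<open>2 \<times> 2\<close> matrix with diagonal entries \<open>a\<close> and off-diagonal entries \<open>x\<close> is
  \<open>y\<^sup>*y\<close>, where \<open>y\<close> has rows \<open>(p, r)\<close> and \<open>(q, s)\<close>. Compressing it by the vectors \<open>(1, 1)\<close> and
  \<open>(1, - 1)\<close> yields \<open>2 (a + x)\<close> and \<open>2 (a - x)\<close> as sums of two elements \<open>b\<^sup>*b\<close>.
\<close>
lemma half_block_pos:
  fixes a x p q r s :: "'a::cstar_algebra"
  assumes "a = star p * p + star q * q" and "a = star r * r + star s * s"
    and "x = star p * r + star q * s" and "star x = x"
  shows "a + x \<in> pos" and "a - x \<in> pos"
proof -
  have pos: "star b * b \<in> pos" for b :: 'a unfolding pos_def by blast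
  have half: "(1/2) *\<^sub>R c \<in> pos" if c: "c \<in> pos" for c :: 'a
  proof -
    obtain b where "c = star b * b" using c unfolding pos_def by blast
    then have "(1/2) *\<^sub>R c = star (sqrt (1/2) *\<^sub>R b) * (sqrt (1/2) *\<^sub>R b)"
      by (simp add: star_scaleR)
    then show ?thesis unfolding pos_def by blast
  qed
  have x2: "x = star r * p + star s * q"
    using assms(4) by (simp add: assms(3) star_add star_mult star_star)
  have "star (p + r) * (p + r) + star (q + s) * (q + s)
      = (star p * p + star q * q) + (star r * r + star s * s)
        + (star p * r + star q * s) + (star r * p + star s * q)"
    by (simp add: star_add algebra_simps)
  also have "\<dots> = 2 *\<^sub>R (a + x)"
    unfolding assms(1)[symmetric] assms(2)[symmetric] assms(3)[symmetric] x2[symmetric]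
    by (simp add: scaleR_2)
  finally have "2 *\<^sub>R (a + x) \<in> pos" using pos_add[OF pos[of "p + r"] pos[of "q + s"]] by simp
  from half[OF this] show "a + x \<in> pos" by simp
  have "star (p - r) * (p - r) + star (q - s) * (q - s)
      = (star p * p + star q * q) + (star r * r + star s * s)
        - (star p * r + star q * s) - (star r * p + star s * q)"
    by (simp add: star_diff algebra_simps)
  also have "\<dots> = 2 *\<^sub>R (a - x)"
    unfolding assms(1)[symmetric] assms(2)[symmetric] assms(3)[symmetric] x2[symmetric]
    by (simp add: scaleR_2)
  finally have "2 *\<^sub>R (a - x) \<in> pos" using pos_add[OF pos[of "p - r"] pos[of "q - s"]] by simp
  from half[OF this] show "a - x \<in> pos" by simp
qed

lemma four_block_mat_inject:
  assumes c: "A \<in> carrier_mat n n" "B \<in> carrier_mat n n" "C \<in> carrier_mat n n" "D \<in> carrier_mat n n"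
    "A' \<in> carrier_mat n n" "B' \<in> carrier_mat n n" "C' \<in> carrier_mat n n" "D' \<in> carrier_mat n n"
    and eq: "four_block_mat A B C D = four_block_mat A' B' C' D'"
  shows "A = A'" and "B = B'" and "C = C'" and "D = D'"
proof -
  have e: "four_block_mat A B C D $$ (i, j) = four_block_mat A' B' C' D' $$ (i, j)" for i j
    by (simp add: eq)
  show "A = A'"
  proof (rule eq_matI)
    fix i j assume "i < dim_row A'" "j < dim_col A'"
    then show "A $$ (i, j) = A' $$ (i, j)" using c e[of i j] by simp
  qed (use c in auto)
  show "B = B'"
  proof (rule eq_matI)
    fix i j assume "i < dim_row B'" "j < dim_col B'"
    then show "B $$ (i, j) = B' $$ (i, j)" using c e[of i "j + n"] by simp
  qed (use c in auto)
  show "C = C'"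
  proof (rule eq_matI)
    fix i j assume "i < dim_row C'" "j < dim_col C'"
    then show "C $$ (i, j) = C' $$ (i, j)" using c e[of "i + n" j] by simp
  qed (use c in auto)
  show "D = D'"
  proof (rule eq_matI)
    fix i j assume "i < dim_row D'" "j < dim_col D'"
    then show "D $$ (i, j) = D' $$ (i, j)" using c e[of "i + n" "j + n"] by simp
  qed (use c in auto)
qed

lemma mat_star_four_block:
  assumes "A \<in> carrier_mat n n" "B \<in> carrier_mat n n" "C \<in> carrier_mat n n" "D \<in> carrier_mat n n"
  shows "mat_star (four_block_mat A B C D)
    = four_block_mat (mat_star A) (mat_star C) (mat_star B) (mat_star D)"
  by (rule eq_matI) (use assms in auto)

context
  fixes n :: nat
  assumes N: "is_cstar_norm n (mat_norm :: 'a::cstar_algebra mat \<Rightarrow> real)"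
begin

lemma mats_pos_add:
  assumes "x \<in> mats_pos n UNIV" "y \<in> mats_pos n UNIV"
  shows "x + y \<in> mats_pos n (UNIV :: 'a set)"
proof -
  have c: "x \<in> carrier_mat n n" "y \<in> carrier_mat n n" "x + y \<in> carrier_mat n n"
    using assms[THEN mats_pos_carrier] by simp_all
  show ?thesis
    using assms pos_add unfolding embed_matrix_pos_iff[OF N c(1), symmetric]
      embed_matrix_pos_iff[OF N c(2), symmetric] embed_matrix_pos_iff[OF N c(3), symmetric]
      embed_matrix_add[OF N c(1,2)] by blast
qed

lemma mat_norm_mono:
  assumes p: "p \<in> mats_pos n UNIV" and q: "q \<in> carrier_mat n n" and qp: "q - p \<in> mats_pos n UNIV"
  shows "mat_norm p \<le> mat_norm (q :: 'a mat)"
proof -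
  let ?J = "embed_matrix n (mat_norm :: 'a mat \<Rightarrow> real)"
  have c: "p \<in> carrier_mat n n" using mats_pos_carrier[OF p] .
  have "norm (?J p) \<le> norm (?J q)"
  proof (rule norm_mono_pos)
    show "?J p \<in> pos" using p by (simp only: embed_matrix_pos_iff[OF N c])
    show "?J q - ?J p \<in> pos"
      using qp embed_matrix_pos_iff[OF N mats_pos_carrier[OF qp]]
      by (simp only: embed_matrix_diff[OF N q c])
  qed
  then show ?thesis by (simp only: norm_embed_matrix[OF N c] norm_embed_matrix[OF N q])
qed

text \<open>
  The block matrix has size \<open>2n\<close>, but the conclusion is drawn inside the \<open>n \<times> n\<close> matrices, by cutting
  the factor \<open>y\<close> of the block matrix \<open>y\<^sup>*y\<close> into four blocks.
\<close>
lemma block_mats_pos: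
  fixes a x :: "'a mat"
  assumes a: "a \<in> carrier_mat n n" and x: "x \<in> carrier_mat n n" and sx: "mat_star x = x"
    and block: "four_block_mat a x (mat_star x) a \<in> mats_pos (2 * n) V"
  shows "a + x \<in> mats_pos n UNIV" and "a - x \<in> mats_pos n UNIV"
proof -
  let ?J = "embed_matrix n (mat_norm :: 'a mat \<Rightarrow> real)"
  obtain y where y: "y \<in> carrier_mat (2 * n) (2 * n)" "four_block_mat a x (mat_star x) a = mat_star y * y"
    using block unfolding mats_pos_def by blast
  obtain p r q s where split: "split_block y n n = (p, r, q, s)" by (metis prod_cases4)
  have c: "p \<in> carrier_mat n n" "r \<in> carrier_mat n n" "q \<in> carrier_mat n n" "s \<in> carrier_mat n n"
    and y_eq: "y = four_block_mat p r q s"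
    using split_block[OF split, of n n] y(1) by auto
  have sc: "mat_star p \<in> carrier_mat n n" "mat_star r \<in> carrier_mat n n"
    "mat_star q \<in> carrier_mat n n" "mat_star s \<in> carrier_mat n n" using c by simp_all
  have "mat_star y * y = four_block_mat (mat_star p * p + mat_star q * q) (mat_star p * r + mat_star q * s)
      (mat_star r * p + mat_star s * q) (mat_star r * r + mat_star s * s)"
    unfolding y_eq mat_star_four_block[OF c(1,2,3,4)]
    by (rule mult_four_block_mat[OF sc(1) sc(3) sc(2) sc(4) c(1) c(2) c(3) c(4)])
  with y(2) have block_eq: "four_block_mat a x (mat_star x) a
      = four_block_mat (mat_star p * p + mat_star q * q) (mat_star p * r + mat_star q * s)
      (mat_star r * p + mat_star s * q) (mat_star r * r + mat_star s * s)" by simp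
  have prod: "mat_star u * v \<in> carrier_mat n n" if "u \<in> carrier_mat n n" "v \<in> carrier_mat n n" for u v :: "'a mat"
    using that by (intro mult_carrier_mat[of _ _ n]) simp_all
  have sum: "mat_star u * v + mat_star w * z \<in> carrier_mat n n"
    if "u \<in> carrier_mat n n" "v \<in> carrier_mat n n" "w \<in> carrier_mat n n" "z \<in> carrier_mat n n"
    for u v w z :: "'a mat"
    using that by (intro add_carrier_mat prod)
  have "mat_star x \<in> carrier_mat n n" using x by simp
  note eq = four_block_mat_inject[OF a x this a sum[OF c(1) c(1) c(3) c(3)] sum[OF c(1) c(2) c(3) c(4)]
      sum[OF c(2) c(1) c(4) c(3)] sum[OF c(2) c(2) c(4) c(4)] block_eq]
  have J_sum: "?J (mat_star u * v + mat_star w * z) = star (?J u) * ?J v + star (?J w) * ?J z"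
    if "u \<in> carrier_mat n n" "v \<in> carrier_mat n n" "w \<in> carrier_mat n n" "z \<in> carrier_mat n n"
    for u v w z :: "'a mat"
    using that prod
    by (simp add: embed_matrix_add[OF N] embed_matrix_mult[OF N] embed_matrix_star[OF N])
  have 1: "?J a = star (?J p) * ?J p + star (?J q) * ?J q"
    using arg_cong[OF eq(1), of ?J] J_sum[OF c(1) c(1) c(3) c(3)] by (rule trans)
  have 2: "?J a = star (?J r) * ?J r + star (?J s) * ?J s"
    using arg_cong[OF eq(4), of ?J] J_sum[OF c(2) c(2) c(4) c(4)] by (rule trans)
  have 3: "?J x = star (?J p) * ?J r + star (?J q) * ?J s"
    using arg_cong[OF eq(2), of ?J] J_sum[OF c(1) c(2) c(3) c(4)] by (rule trans)
  have 4: "star (?J x) = ?J x" using embed_matrix_star[OF N x] by (simp only: sx)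
  have d: "a - x \<in> carrier_mat n n" using x by (rule minus_carrier_mat)
  show "a + x \<in> mats_pos n UNIV" "a - x \<in> mats_pos n UNIV"
    using half_block_pos[OF 1 2 3 4] embed_matrix_pos_iff[OF N, of "a + x"] embed_matrix_pos_iff[OF N d]
      embed_matrix_add[OF N a x] embed_matrix_diff[OF N a x] a x by simp_all
qed

end

lemma amp_carrier [simp]: "amp n a \<in> carrier_mat n n"
  by (simp add: amp_def)

lemma amp_dim [simp]: "dim_row (amp n a) = n" "dim_col (amp n a) = n"
  by (simp_all add: amp_def)

lemma index_amp [simp]: "i < n \<Longrightarrow> j < n \<Longrightarrow> amp n a $$ (i, j) = (if i = j then a else 0)"
  by (simp add: amp_def)

lemma amp_mult: "amp n a * amp n b = amp n (a * b :: 'a::cstar_algebra)"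
proof (rule eq_matI)
  fix i j assume ij: "i < dim_row (amp n (a * b))" "j < dim_col (amp n (a * b))"
  have "(\<Sum>k = 0..<n. (if i = k then a else 0) * (if k = j then b else 0))
      = (\<Sum>k = 0..<n. if k = i then (if i = j then a * b else 0) else 0)"
    by (rule sum.cong) auto
  with ij show "(amp n a * amp n b) $$ (i, j) = amp n (a * b) $$ (i, j)"
    by (simp add: scalar_prod_def)
qed simp_all

lemma mat_star_amp: "mat_star (amp n a) = amp n (star a)"
  by (rule eq_matI) auto

lemma amp_diff: "amp n (a - b) = amp n a - amp n (b :: 'a::cstar_algebra)"
  by (rule eq_matI) auto

lemma amp_scaleR: "amp n (r *\<^sub>R a) = mat_scaleC (complex_of_real r) (amp n (a :: 'a::cstar_algebra))"
  by (rule eq_matI) (auto simp: scaleC_of_real)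

lemma amp_mats: "star_subspace V \<Longrightarrow> a \<in> V \<Longrightarrow> amp n a \<in> mats n V"
  unfolding mats_def star_subspace_def by auto

lemma amp_pos: "a \<in> pos \<Longrightarrow> amp n a \<in> mats_pos n UNIV"
  unfolding pos_def mats_pos_def mats_UNIV
  by (auto simp: amp_mult[symmetric] mat_star_amp[symmetric] intro!: mult_carrier_mat[of _ _ n])

section \<open>Functionals on spaces of matrices\<close>
lemma mat_star_scaleC: "mat_star (mat_scaleC c x) = mat_scaleC (cnj c) (mat_star x)"
  by (rule eq_matI) (simp_all add: star_scaleC)

lemma mat_diff_eq_add:
  "dim_row x = dim_row y \<Longrightarrow> dim_col x = dim_col y \<Longrightarrow> x - y = x + mat_scaleC (- 1) (y :: 'a::cstar_algebra mat)"
  by (rule eq_matI) (simp_all add: scaleC_minus_left)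

definition self_adjoint_part :: "'a::cstar_algebra mat \<Rightarrow> 'a mat" where
  "self_adjoint_part z = mat_scaleC (1/2) (z + mat_star z)"

lemma self_adjoint_part_mats:
  "star_subspace V \<Longrightarrow> z \<in> mats n V \<Longrightarrow> self_adjoint_part z \<in> mats n V"
  unfolding self_adjoint_part_def by (intro mats_closed)

lemma mat_star_self_adjoint_part:
  "z \<in> carrier_mat n n \<Longrightarrow> mat_star (self_adjoint_part z) = self_adjoint_part z"
  unfolding self_adjoint_part_def
  by (rule eq_matI) (auto simp: star_scaleC star_add star_star add.commute)

lemma self_adjoint_part_diff:
  assumes "x \<in> carrier_mat n n" "mat_star x = x" "y \<in> carrier_mat n n"
  shows "x - self_adjoint_part y = self_adjoint_part (x - y)"
proof (rule eq_matI)
  fix i j assume ij: "i < dim_row (self_adjoint_part (x - y))" "j < dim_col (self_adjoint_part (x - y))"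
  then have ij: "i < n" "j < n" using assms by (simp_all add: self_adjoint_part_def)
  have "star (x $$ (j, i)) = x $$ (i, j)"
    using arg_cong[OF assms(2), of "\<lambda>z. z $$ (i, j)"] ij assms(1) by simp
  moreover have "(1/2 :: complex) *\<^sub>C (a + a) = a" for a :: 'a
    using scaleC_add_left[of "1/2" "1/2" a] by (simp add: scaleC_add_right)
  then have "(1/2 :: complex) *\<^sub>C a + (1/2 :: complex) *\<^sub>C a = a" for a :: 'a
    by (simp only: scaleC_add_right)
  ultimately show "(x - self_adjoint_part y) $$ (i, j) = self_adjoint_part (x - y) $$ (i, j)"
    using ij assms by (simp add: self_adjoint_part_def star_diff scaleC_add_right scaleC_diff_right
        add_diff_eq diff_add_eq diff_diff_eq)
qed (use assms in \<open>simp_all add: self_adjoint_part_def\<close>)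

lemma four_block_mats:
  assumes "A \<in> mats n V" "B \<in> mats n V" "C \<in> mats n V" "D \<in> mats n V"
  shows "four_block_mat A B C D \<in> mats (2 * n) V"
proof -
  have entry: "X $$ (k, l) \<in> V" if "X \<in> mats n V" "k < n" "l < n" for X k l
    using that by (simp add: mats_def)
  have c: "A \<in> carrier_mat n n" "D \<in> carrier_mat n n" using assms by (simp_all add: mats_def)
  have "four_block_mat A B C D $$ (i, j) \<in> V" if "i < 2 * n" "j < 2 * n" for i j
  proof -
    have eq: "four_block_mat A B C D $$ (i, j)
        = (if i < n then if j < n then A $$ (i, j) else B $$ (i, j - n)
           else if j < n then C $$ (i - n, j) else D $$ (i - n, j - n))"
      using that c by (subst index_mat_four_block) simp_all
    have "i - n < n" "j - n < n" using that by linarith+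
    then show ?thesis unfolding eq by (simp add: entry assms)
  qed
  then show ?thesis
    unfolding mats_def mult_2 using four_block_carrier_mat[OF c] by simp
qed

lemma mat_dual_add:
  "\<phi> \<in> mat_dual n V \<Longrightarrow> x \<in> mats n V \<Longrightarrow> y \<in> mats n V \<Longrightarrow> \<phi> (x + y) = \<phi> x + \<phi> y"
  by (simp add: mat_dual_def)

lemma mat_dual_scaleC: "\<phi> \<in> mat_dual n V \<Longrightarrow> x \<in> mats n V \<Longrightarrow> \<phi> (mat_scaleC c x) = c * \<phi> x"
  by (simp add: mat_dual_def)

lemma mat_dual_outside: "\<phi> \<in> mat_dual n V \<Longrightarrow> x \<notin> mats n V \<Longrightarrow> \<phi> x = 0"
  by (simp add: mat_dual_def)

lemma mat_dual_diff:
  assumes "\<phi> \<in> mat_dual n V" "star_subspace V" "x \<in> mats n V" "y \<in> mats n V"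
  shows "\<phi> (x - y) = \<phi> x - \<phi> y"
proof -
  have "x - y = x + mat_scaleC (- 1) y"
    using assms(3,4) by (intro mat_diff_eq_add) (auto simp: mats_def)
  then show ?thesis
    using assms by (simp add: mat_dual_add mat_dual_scaleC mats_closed(1))
qed

lemma hermitian_functionalsD:
  assumes "\<phi> \<in> hermitian_functionals n V"
  shows "\<phi> \<in> mat_dual n V" and "x \<in> mats n V \<Longrightarrow> \<phi> (mat_star x) = cnj (\<phi> x)"
  using assms by (simp_all add: hermitian_functionals_def)

context
  fixes n :: nat
  assumes N: "is_cstar_norm n (mat_norm :: 'a::cstar_algebra mat \<Rightarrow> real)"
begin

lemma mat_norm_self_adjoint_part_le:
  assumes "z \<in> carrier_mat n n"
  shows "mat_norm (self_adjoint_part z) \<le> mat_norm (z :: 'a mat)"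
proof -
  have "mat_norm (z + mat_star z) \<le> mat_norm z + mat_norm z"
    using cstar_norm_triangle[OF N assms, of "mat_star z"] cstar_norm_star[OF N assms] assms by simp
  then show ?thesis
    using cstar_norm_scaleC[OF N, of "z + mat_star z" "1/2"] assms
    by (simp add: self_adjoint_part_def norm_divide)
qed

text \<open>
  Approximate entrywise and pass to the self-adjoint part, which does not increase the distance to
  the self-adjoint matrix \<open>x\<close>.
\<close>
lemma self_adjoint_mats_approx:
  assumes U: "star_subspace U" and V: "V \<subseteq> closure U"
    and x: "x \<in> mats n V" "mat_star x = x" and "\<epsilon> > 0"
  shows "\<exists>y\<in>mats n U. mat_star y = y \<and> mat_norm (x - y :: 'a mat) < \<epsilon>"
proof -
  define \<delta> where "\<delta> = \<epsilon> / (real n * real n + 1)"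
  have pos: "real n * real n + 1 > 0" by (simp add: add_nonneg_pos)
  then have "\<delta> > 0" using \<open>\<epsilon> > 0\<close> by (simp add: \<delta>_def)
  have "\<exists>u. i < n \<longrightarrow> j < n \<longrightarrow> u \<in> U \<and> dist u (x $$ (i, j)) < \<delta>" for i j
  proof (cases "i < n \<and> j < n")
    case True
    then have "x $$ (i, j) \<in> closure U" using x(1) V unfolding mats_def by blast
    then show ?thesis using \<open>\<delta> > 0\<close> unfolding closure_approachable by blast
  qed blast
  then have "\<forall>i j. \<exists>u. i < n \<longrightarrow> j < n \<longrightarrow> u \<in> U \<and> dist u (x $$ (i, j)) < \<delta>" by blast
  then obtain f where f: "\<And>i j. i < n \<Longrightarrow> j < n \<Longrightarrow> f i j \<in> U \<and> dist (f i j) (x $$ (i, j)) < \<delta>"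
    unfolding choice_iff by blast
  define y where "y = mat n n (\<lambda>(i, j). f i j)"
  have yU: "y \<in> mats n U" unfolding y_def mats_def using f by simp
  have xc: "x \<in> carrier_mat n n" and yc: "y \<in> carrier_mat n n" using x yU by (simp_all add: mats_def)
  have d: "x - y \<in> carrier_mat n n" using yc by (rule minus_carrier_mat)
  have "mat_norm (x - y) \<le> (\<Sum>p<n. \<Sum>q<n. norm ((x - y) $$ (p, q)))"
    by (rule cstar_norm_le_sum_entries[OF N d])
  also have "\<dots> \<le> (\<Sum>p<n. \<Sum>q<n. \<delta>)"
  proof (intro sum_mono)
    fix p q assume "p \<in> {..<n}" "q \<in> {..<n}"
    then show "norm ((x - y) $$ (p, q)) \<le> \<delta>"
      using f[of p q] yc by (simp add: y_def dist_norm norm_minus_commute less_imp_le)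
  qed
  also have "\<dots> = real n * real n * \<delta>" by simp
  also have "\<dots> < \<epsilon>"
    using \<open>\<epsilon> > 0\<close> pos by (simp add: \<delta>_def divide_less_eq)
  finally have "mat_norm (x - y) < \<epsilon>" .
  then have "mat_norm (x - self_adjoint_part y) < \<epsilon>"
    using mat_norm_self_adjoint_part_le[OF d] by (simp add: self_adjoint_part_diff[OF xc x(2) yc])
  then show ?thesis
    using self_adjoint_part_mats[OF U yU] mat_star_self_adjoint_part[OF yc] by blast
qed

lemma dual_norm_leI:
  assumes V: "star_subspace V"
    and "\<And>x. x \<in> mats n V \<Longrightarrow> mat_norm (x :: 'a mat) \<le> 1 \<Longrightarrow> cmod (\<phi> x) \<le> K"
  shows "dual_norm n V \<phi> \<le> K"
  unfolding dual_norm_def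
proof (rule cSup_least)
  have "mat_norm (0\<^sub>m n n :: 'a mat) \<le> 1" using cstar_norm_zero[OF N] by simp
  then show "{cmod (\<phi> x) |x. x \<in> mats n V \<and> mat_norm x \<le> 1} \<noteq> {}" using mats_zero[OF V] by blast
qed (use assms(2) in blast)

lemma dual_norm_upper:
  assumes \<phi>: "\<phi> \<in> mat_dual n V" and x: "x \<in> mats n V" "mat_norm (x :: 'a mat) \<le> 1"
  shows "cmod (\<phi> x) \<le> dual_norm n V \<phi>"
proof -
  obtain K where K: "\<And>x. x \<in> mats n V \<Longrightarrow> cmod (\<phi> x) \<le> K * mat_norm x"
    using \<phi> unfolding mat_dual_def by blast
  have "cmod (\<phi> z) \<le> \<bar>K\<bar>" if "z \<in> mats n V" "mat_norm z \<le> 1" for z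
  proof -
    have "K * mat_norm z \<le> \<bar>K\<bar> * mat_norm z"
      using cstar_norm_nonneg[OF N mats_carrier[OF that(1)]] by (intro mult_right_mono) simp_all
    also have "\<dots> \<le> \<bar>K\<bar> * 1" using that by (intro mult_left_mono) simp_all
    finally show ?thesis using K[OF that(1)] by simp
  qed
  then have "bdd_above {cmod (\<phi> x) |x. x \<in> mats n V \<and> mat_norm x \<le> 1}"
    by (intro bdd_aboveI[of _ "\<bar>K\<bar>"]) blast
  then show ?thesis unfolding dual_norm_def using x by (intro cSup_upper) blast+
qed

lemma dual_norm_nonneg:
  assumes V: "star_subspace V" and \<phi>: "\<phi> \<in> mat_dual n V"
  shows "0 \<le> dual_norm n V (\<phi> :: 'a mat \<Rightarrow> complex)"
  using dual_norm_upper[OF \<phi> mats_zero[OF V]] cstar_norm_zero[OF N] norm_ge_zero[of "\<phi> (0\<^sub>m n n)"]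
  by linarith

lemma mat_dual_bound:
  assumes V: "star_subspace V" and \<phi>: "\<phi> \<in> mat_dual n V" and x: "x \<in> mats n V"
  shows "cmod (\<phi> x) \<le> dual_norm n V \<phi> * mat_norm (x :: 'a mat)"
proof (cases "mat_norm x = 0")
  case True
  then have "x = mat_scaleC 0 x"
    using cstar_norm_eq_0_iff[OF N mats_carrier[OF x]] by (simp add: mat_scaleC_zero_mat)
  then have "\<phi> x = 0" using mat_dual_scaleC[OF \<phi> x, of 0] by simp
  then show ?thesis using True by simp
next
  case False
  then have pos: "mat_norm x > 0" using cstar_norm_nonneg[OF N mats_carrier[OF x]] by simp
  let ?y = "mat_scaleC (complex_of_real (1 / mat_norm x)) x"
  have "mat_norm ?y \<le> 1"
    using pos cstar_norm_scaleC[OF N mats_carrier[OF x], of "complex_of_real (1 / mat_norm x)"]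
    by (simp add: norm_divide)
  then have "cmod (\<phi> ?y) \<le> dual_norm n V \<phi>"
    by (intro dual_norm_upper \<phi> mats_closed V x)
  then show ?thesis
    using pos by (simp add: mat_dual_scaleC[OF \<phi> x] norm_mult norm_divide field_simps)
qed

text \<open>
  The functional is transported to the image of \<open>M\<^sub>n(V)\<close> in the product algebra, extended to the whole
  product there, and pulled back.
\<close>
lemma hermitian_functional_extension_mats:
  assumes V: "star_subspace (V :: 'a set)" and \<psi>: "\<psi> \<in> hermitian_functionals n V"
  obtains \<Phi> where "\<Phi> \<in> hermitian_functionals n UNIV" and "\<And>x. x \<in> mats n V \<Longrightarrow> \<Phi> x = \<psi> x"
    and "dual_norm n UNIV \<Phi> \<le> dual_norm n V \<psi>"
proof -
  note dual = hermitian_functionalsD(1)[OF \<psi>] and herm = hermitian_functionalsD(2)[OF \<psi>]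
  let ?J = "embed_matrix n (mat_norm :: 'a mat \<Rightarrow> real)" and ?c = "dual_norm n V \<psi>"
  define \<psi>' where "\<psi>' F = \<psi> (component F n mat_norm)" for F
  have \<psi>'_J: "\<psi>' (?J x) = \<psi> x" if "x \<in> carrier_mat n n" for x
    using component_embed_matrix[OF N that, of n mat_norm] by (simp add: \<psi>'_def)
  note J_simps = embed_matrix_add[OF N, symmetric] embed_matrix_scaleC[OF N, symmetric]
    embed_matrix_star[OF N, symmetric]
  have c: "x \<in> carrier_mat n n" "x + y \<in> carrier_mat n n" "mat_scaleC a x \<in> carrier_mat n n"
    "mat_star x \<in> carrier_mat n n" if "x \<in> mats n V" "y \<in> mats n V" for x y a
    using that by (simp_all add: mats_carrier)
  have "?J (0\<^sub>m n n) = 0"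
    by (rule matrix_family_eqI) (simp add: component_embed_matrix[OF N])
  then have sub: "star_subspace (?J ` mats n V)"
    unfolding star_subspace_def
  proof (intro conjI ballI allI)
    show "0 \<in> ?J ` mats n V" if "?J (0\<^sub>m n n) = 0"
      using mats_zero[OF V] that by (metis image_eqI)
    fix F assume "F \<in> ?J ` mats n V"
    then obtain x where x: "x \<in> mats n V" "F = ?J x" by blast
    show "a *\<^sub>C F \<in> ?J ` mats n V" for a
      unfolding x(2) embed_matrix_scaleC[OF N mats_carrier[OF x(1)], symmetric]
      by (intro imageI mats_closed V x)
    show "star F \<in> ?J ` mats n V"
      unfolding x(2) embed_matrix_star[OF N mats_carrier[OF x(1)], symmetric]
      by (intro imageI mats_closed V x)
    fix G assume "G \<in> ?J ` mats n V"
    then obtain y where y: "y \<in> mats n V" "G = ?J y" by blast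
    show "F + G \<in> ?J ` mats n V"
      unfolding x(2) y(2) embed_matrix_add[OF N mats_carrier[OF x(1)] mats_carrier[OF y(1)], symmetric]
      by (intro imageI mats_closed V x y)
  qed
  obtain \<Phi>' where add: "\<And>x y. \<Phi>' (x + y) = \<Phi>' x + \<Phi>' y" and scale: "\<And>c x. \<Phi>' (c *\<^sub>C x) = c * \<Phi>' x"
    and star: "\<And>x. \<Phi>' (star x) = cnj (\<Phi>' x)" and bound: "\<And>x. cmod (\<Phi>' x) \<le> ?c * norm x"
    and ext: "\<And>x. x \<in> ?J ` mats n V \<Longrightarrow> \<Phi>' x = \<psi>' x"
  proof (rule hermitian_functional_extension[OF sub])
    show "0 \<le> ?c" by (rule dual_norm_nonneg[OF V dual])
    fix F assume "F \<in> ?J ` mats n V"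
    then obtain x where x: "x \<in> mats n V" "F = ?J x" by blast
    show "\<psi>' (a *\<^sub>C F) = a * \<psi>' F" for a
      using x c[OF x(1) x(1)] mat_dual_scaleC[OF dual x(1)] by (simp add: J_simps \<psi>'_J)
    show "\<psi>' (star F) = cnj (\<psi>' F)"
      using x c[OF x(1) x(1)] herm[OF x(1)] by (simp add: J_simps \<psi>'_J)
    show "cmod (\<psi>' F) \<le> ?c * norm F"
      using x c[OF x(1) x(1)] mat_dual_bound[OF V dual x(1)] by (simp add: norm_embed_matrix[OF N] \<psi>'_J)
    fix G assume "G \<in> ?J ` mats n V"
    then obtain y where y: "y \<in> mats n V" "G = ?J y" by blast
    show "\<psi>' (F + G) = \<psi>' F + \<psi>' G"
      using x y c[OF x(1) y(1)] c[OF y(1) y(1)] mat_dual_add[OF dual x(1) y(1)]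
      by (simp add: J_simps \<psi>'_J)
  qed (use that in blast)
  define \<Phi> where "\<Phi> x = (if x \<in> carrier_mat n n then \<Phi>' (?J x) else 0)" for x
  have bnd: "cmod (\<Phi> x) \<le> ?c * mat_norm x" if "x \<in> carrier_mat n n" for x
    using bound[of "?J x"] norm_embed_matrix[OF N that] that by (simp add: \<Phi>_def)
  have \<Phi>: "\<Phi> \<in> hermitian_functionals n UNIV"
    unfolding hermitian_functionals_def mat_dual_def mats_UNIV
  proof (intro CollectI conjI ballI allI impI exI[of _ ?c])
    show "\<Phi> (x + y) = \<Phi> x + \<Phi> y" if "x \<in> carrier_mat n n" "y \<in> carrier_mat n n" for x y
      using that embed_matrix_add[OF N that] add by (simp add: \<Phi>_def)
    show "\<Phi> (mat_scaleC a x) = a * \<Phi> x" if "x \<in> carrier_mat n n" for a x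
      using that embed_matrix_scaleC[OF N that] scale by (simp add: \<Phi>_def)
    show "\<Phi> (mat_star x) = cnj (\<Phi> x)" if "x \<in> carrier_mat n n" for x
      using that embed_matrix_star[OF N that] star by (simp add: \<Phi>_def)
  qed (use bnd in \<open>simp_all add: \<Phi>_def\<close>)
  show thesis
  proof (rule that[OF \<Phi>])
    show "\<Phi> x = \<psi> x" if "x \<in> mats n V" for x
      using ext[of "?J x"] that mats_carrier[OF that] by (simp add: \<Phi>_def \<psi>'_J)
    show "dual_norm n UNIV \<Phi> \<le> ?c"
    proof (rule dual_norm_leI[OF star_subspace_UNIV])
      fix x :: "'a mat" assume "x \<in> mats n UNIV" "mat_norm x \<le> 1"
      then show "cmod (\<Phi> x) \<le> ?c"
        using bnd[of x] mult_left_mono[of "mat_norm x" 1 ?c] dual_norm_nonneg[OF V dual]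
        by (simp add: mats_UNIV)
    qed
  qed
qed

end

section \<open>Approximate order units\<close>
lemma nonneg_if_ge_small:
  fixes x C :: real
  assumes "\<And>\<epsilon>. 0 < \<epsilon> \<Longrightarrow> \<epsilon> < 1 \<Longrightarrow> - C * \<epsilon> \<le> x"
  shows "0 \<le> x"
proof (rule field_le_epsilon)
  fix d :: real assume "d > 0"
  define D where "D = \<bar>C\<bar> + 1"
  have D: "D > 0" "C \<le> D" by (simp_all add: D_def)
  define \<epsilon> where "\<epsilon> = min (1/2) (d / D)"
  have \<epsilon>: "0 < \<epsilon>" "\<epsilon> < 1" using \<open>d > 0\<close> D by (simp_all add: \<epsilon>_def min_less_iff_disj)
  have "C * \<epsilon> \<le> D * \<epsilon>" using D \<epsilon> by (intro mult_right_mono) simp_all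
  also have "\<dots> \<le> D * (d / D)" using D by (intro mult_left_mono) (simp_all add: \<epsilon>_def)
  also have "\<dots> = d" using D by simp
  finally show "0 \<le> x + d" using assms[OF \<epsilon>] by simp
qed

text \<open>
  If \<open>e\<^sub>l = b\<^sup>*b\<close>, the block matrix with all four blocks equal to \<open>e\<^sub>l\<close> is \<open>y\<^sup>*y\<close> for \<open>y\<close> with first block
  row \<open>(b, b)\<close> and second block row \<open>0\<close>. So \<open>t = 1\<close> is admissible in the formula for the norm.
\<close>
lemma mat_norm_amp_order_unit_le:
  assumes A: "star_subspace (A :: 'a::cstar_algebra set)" and nd: "norm_defining A \<Lambda> e"
    and l: "l \<in> \<Lambda>" "e l \<in> A" "e l \<in> pos" and "n \<ge> 1"
  shows "mat_norm (amp n (e l)) \<le> 1"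
proof -
  let ?a = "amp n (e l)"
  obtain b where b: "e l = star b * b" using l(3) unfolding pos_def by blast
  have "star (e l) = e l" by (simp add: b star_mult star_star)
  then have sa: "mat_star ?a = ?a" by (simp add: mat_star_amp)
  let ?y = "four_block_mat (amp n b) (amp n b) (0\<^sub>m n n) (0\<^sub>m n n)"
  have c: "amp n b \<in> carrier_mat n n" "amp n (star b) \<in> carrier_mat n n"
    "(0\<^sub>m n n :: 'a mat) \<in> carrier_mat n n" by simp_all
  have "mat_star ?y = four_block_mat (amp n (star b)) (0\<^sub>m n n) (amp n (star b)) (0\<^sub>m n n)"
    unfolding mat_star_four_block[OF c(1) c(1) c(3) c(3)] by (simp add: mat_star_amp mat_star_zero_mat)
  then have "mat_star ?y * ?y = four_block_mat (amp n (star b) * amp n b + 0\<^sub>m n n * 0\<^sub>m n n)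
      (amp n (star b) * amp n b + 0\<^sub>m n n * 0\<^sub>m n n)
      (amp n (star b) * amp n b + 0\<^sub>m n n * 0\<^sub>m n n) (amp n (star b) * amp n b + 0\<^sub>m n n * 0\<^sub>m n n)"
    by (simp only: mult_four_block_mat[OF c(2) c(3) c(2) c(3) c(1) c(1) c(3) c(3)])
  then have eq: "four_block_mat ?a ?a ?a ?a = mat_star ?y * ?y"
    by (simp add: amp_mult b)
  have "?a \<in> mats n A" by (rule amp_mats[OF A l(2)])
  then have "four_block_mat ?a ?a ?a ?a \<in> mats (2 * n) A" by (intro four_block_mats)
  moreover have "?y \<in> carrier_mat (2 * n) (2 * n)"
    unfolding mult_2 by (rule four_block_carrier_mat[OF c(1) c(3)])
  ultimately have "four_block_mat ?a ?a ?a ?a \<in> mats_pos (2 * n) A"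
    unfolding mats_pos_def eq by blast
  then have "four_block_mat (amp n (1 *\<^sub>R e l)) ?a (mat_star ?a) (amp n (1 *\<^sub>R e l)) \<in> mats_pos (2 * n) A"
    by (simp add: sa)
  then have "1 \<in> {t. 0 \<le> t \<and> (\<exists>l'\<in>\<Lambda>. four_block_mat (amp n (t *\<^sub>R e l')) ?a (mat_star ?a)
      (amp n (t *\<^sub>R e l')) \<in> mats_pos (2 * n) A)}"
    using l(1) by (intro CollectI conjI bexI[of _ l]) simp_all
  then have "Inf (ereal ` {t. 0 \<le> t \<and> (\<exists>l'\<in>\<Lambda>. four_block_mat (amp n (t *\<^sub>R e l')) ?a (mat_star ?a)
      (amp n (t *\<^sub>R e l')) \<in> mats_pos (2 * n) A)}) \<le> ereal 1"
    by (intro Inf_lower imageI)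
  then have "ereal (mat_norm ?a) \<le> ereal 1"
    using nd \<open>?a \<in> mats n A\<close> \<open>n \<ge> 1\<close> unfolding norm_defining_def by simp
  then show ?thesis by simp
qed

context
  fixes n :: nat and A0 :: "'a::cstar_algebra set" and \<Lambda> :: "'i set"
    and rel :: "'i \<Rightarrow> 'i \<Rightarrow> bool" and e :: "'i \<Rightarrow> 'a"
  assumes N: "is_cstar_norm n (mat_norm :: 'a mat \<Rightarrow> real)"
    and A0: "star_subspace A0"
    and aou: "approximate_order_unit A0 \<Lambda> rel e"
    and nd: "norm_defining A0 \<Lambda> e"
    and n1: "n \<ge> 1"
begin

lemma order_unit_mem: "l \<in> \<Lambda> \<Longrightarrow> e l \<in> A0" "l \<in> \<Lambda> \<Longrightarrow> e l \<in> pos"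
  using aou unfolding approximate_order_unit_def by blast+

lemma order_unit_mono:
  "l \<in> \<Lambda> \<Longrightarrow> m \<in> \<Lambda> \<Longrightarrow> rel l m \<Longrightarrow> amp n (e m) - amp n (e l) \<in> mats_pos n UNIV"
  using aou unfolding approximate_order_unit_def cle_def amp_diff[symmetric] by (blast intro: amp_pos)

lemma order_unit_upper_bound:
  assumes "l \<in> \<Lambda>" "m \<in> \<Lambda>" obtains k where "k \<in> \<Lambda>" "rel l k" "rel m k"
  using assms aou unfolding approximate_order_unit_def directed_set_def by blast

text \<open>
  The norm formula gives \<open>h \<le> t e\<^sub>l\<close> for some \<open>t < 1\<close>, and \<open>t e\<^sub>l \<le> e\<^sub>l\<close>.
\<close>
lemma order_unit_dominates:
  assumes h: "h \<in> mats n A0" "mat_star h = h" "mat_norm h < 1"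
  shows "\<exists>l\<in>\<Lambda>. amp n (e l) - h \<in> mats_pos n UNIV"
proof -
  have hc: "h \<in> carrier_mat n n" using h(1) by (rule mats_carrier)
  let ?T = "{t. 0 \<le> t \<and> (\<exists>l\<in>\<Lambda>. four_block_mat (amp n (t *\<^sub>R e l)) h (mat_star h) (amp n (t *\<^sub>R e l))
      \<in> mats_pos (2 * n) A0)}"
  have "ereal (mat_norm h) = Inf (ereal ` ?T)"
    using nd h(1) n1 unfolding norm_defining_def by blast
  then have "Inf (ereal ` ?T) < ereal 1" using h(3) by (metis ereal_less_eq(3) linorder_not_le)
  then obtain t l where t: "t < 1" "0 \<le> t" and l: "l \<in> \<Lambda>"
    and block: "four_block_mat (amp n (t *\<^sub>R e l)) h (mat_star h) (amp n (t *\<^sub>R e l)) \<in> mats_pos (2 * n) A0"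
    unfolding Inf_less_iff by auto
  have 1: "amp n (t *\<^sub>R e l) - h \<in> mats_pos n UNIV"
    by (rule block_mats_pos(2)[OF N amp_carrier hc h(2) block])
  have "amp n ((1 - t) *\<^sub>R e l) \<in> mats_pos n UNIV"
    unfolding amp_scaleR using t by (intro mats_pos_scale amp_pos order_unit_mem l) simp
  from mats_pos_add[OF N 1 this]
  have "(amp n (t *\<^sub>R e l) - h) + amp n ((1 - t) *\<^sub>R e l) \<in> mats_pos n UNIV" .
  moreover have "(amp n (t *\<^sub>R e l) - h) + amp n ((1 - t) *\<^sub>R e l) = amp n (e l) - h"
    using hc by (intro eq_matI) (auto simp: scaleR_diff_left)
  ultimately show ?thesis using l by auto
qed

lemma mats_diff_telescope:
  "x \<in> carrier_mat n n \<Longrightarrow> y \<in> carrier_mat n n \<Longrightarrow> z \<in> carrier_mat n n \<Longrightarrow>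
    (x - y) + (y - z) = x - (z :: 'a mat)"
  by (rule eq_matI) auto

lemma order_unit_dominates_larger:
  assumes l: "l \<in> \<Lambda>" "m \<in> \<Lambda>" "rel l m" and h: "h \<in> carrier_mat n n"
    and dom: "amp n (e l) - h \<in> mats_pos n UNIV"
  shows "amp n (e m) - h \<in> mats_pos n UNIV"
  using mats_pos_add[OF N order_unit_mono[OF l] dom]
  by (simp only: mats_diff_telescope[OF amp_carrier amp_carrier h])

lemma mats_pos_functional_nonneg:
  assumes "\<psi> \<in> pos_cone (dual_h n V)" "x \<in> mats_pos n V"
  shows "0 \<le> Re (\<psi> x)"
  using assms by (simp add: dual_h_def complex_nonneg_Reals_iff)

text \<open>
  Choose \<open>x\<close> in the unit ball with \<open>|\<psi>(x)|\<close> close to \<open>\<parallel>\<psi>\<parallel>\<close>. As \<open>\<psi>\<close> is hermitian, the self-adjoint part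
  \<open>h\<close> of a rotation of \<open>x\<close> has \<open>\<psi>(h) = |\<psi>(x)|\<close>. A matrix over \<open>\<E>\<close> close to \<open>h\<close>, scaled to norm less
  than \<open>1\<close>, lies below some \<open>e\<^sub>l\<close>, and positivity of \<open>\<psi>\<close> gives the estimate.
\<close>
lemma positive_functional_norm_order_unit:
  fixes E E0 :: "'a set"
  assumes E: "star_subspace E" and E0: "star_subspace E0" "E0 \<subseteq> A0" "E0 \<subseteq> E" "E \<subseteq> closure E0"
    and eE: "\<forall>l\<in>\<Lambda>. e l \<in> E0"
    and \<psi>: "\<psi> \<in> pos_cone (dual_h n E)" and "\<epsilon> > 0"
  shows "\<exists>l\<in>\<Lambda>. dual_norm n E \<psi> - \<epsilon> \<le> Re (\<psi> (amp n (e l)))"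
proof -
  have \<psi>h: "\<psi> \<in> hermitian_functionals n E" using \<psi> by (simp add: dual_h_def)
  note dual = hermitian_functionalsD(1)[OF \<psi>h] and herm = hermitian_functionalsD(2)[OF \<psi>h]
  define S where "S = dual_norm n E \<psi>"
  have S0: "0 \<le> S" unfolding S_def by (rule dual_norm_nonneg[OF N E dual])
  (* The estimates below lose \<delta> + 2 S \<delta> in total. *)
  define \<delta> where "\<delta> = \<epsilon> / (1 + 2 * S)"
  have d0: "\<delta> > 0" using \<open>\<epsilon> > 0\<close> S0 by (simp add: \<delta>_def)
  have "\<delta> * (1 + 2 * S) = \<epsilon>" using S0 by (simp add: \<delta>_def)
  then have d\<epsilon>: "\<delta> + 2 * S * \<delta> = \<epsilon>" by (simp add: algebra_simps)
  have "\<not> (\<forall>x\<in>mats n E. mat_norm x \<le> 1 \<longrightarrow> cmod (\<psi> x) \<le> S - \<delta>)"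
  proof
    assume *: "\<forall>x\<in>mats n E. mat_norm x \<le> 1 \<longrightarrow> cmod (\<psi> x) \<le> S - \<delta>"
    have "S \<le> S - \<delta>" unfolding S_def
      by (rule dual_norm_leI[OF N E]) (use * in \<open>simp add: S_def\<close>)
    then show False using d0 by simp
  qed
  then obtain x where x: "x \<in> mats n E" "mat_norm x \<le> 1" "S - \<delta> < cmod (\<psi> x)" by force
  define u where "u = (if \<psi> x = 0 then 1 else cnj (\<psi> x) / cmod (\<psi> x))"
  have u1: "cmod u = 1" by (simp add: u_def norm_divide)
  have u: "u * \<psi> x = cmod (\<psi> x)"
    by (simp add: u_def complex_norm_square[symmetric] power2_eq_square mult.commute)
  define z where "z = mat_scaleC u x"
  have zE: "z \<in> mats n E" unfolding z_def by (rule mats_closed[OF E x(1)])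
  define h where "h = self_adjoint_part z"
  have hE: "h \<in> mats n E" unfolding h_def by (rule self_adjoint_part_mats[OF E zE])
  have hs: "mat_star h = h" unfolding h_def by (rule mat_star_self_adjoint_part[OF mats_carrier[OF zE]])
  have "mat_norm z \<le> 1"
    using cstar_norm_scaleC[OF N mats_carrier[OF x(1)], of u] x(2) u1 by (simp add: z_def)
  then have h1: "mat_norm h \<le> 1"
    using mat_norm_self_adjoint_part_le[OF N mats_carrier[OF zE]] by (simp add: h_def)
  have \<psi>z: "\<psi> z = cmod (\<psi> x)" unfolding z_def mat_dual_scaleC[OF dual x(1)] by (rule u)
  have zs: "mat_star z \<in> mats n E" "z + mat_star z \<in> mats n E"
    using mats_closed[OF E zE] by simp_all
  have \<psi>h_eq: "\<psi> h = cmod (\<psi> x)"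
    using mat_dual_scaleC[OF dual zs(2), of "1/2"] mat_dual_add[OF dual zE zs(1)] herm[OF zE]
    by (simp add: h_def self_adjoint_part_def \<psi>z)
  obtain h0 where h0: "h0 \<in> mats n E0" "mat_star h0 = h0" "mat_norm (h - h0) < \<delta>"
    using self_adjoint_mats_approx[OF N E0(1) E0(4) hE hs d0] by blast
  have h0E: "h0 \<in> mats n E" using h0(1) mats_mono[OF E0(3)] by blast
  note hc = mats_carrier[OF hE] and h0c = mats_carrier[OF h0(1)]
  have dE: "h - h0 \<in> mats n E" by (rule mats_closed(4)[OF E hE h0E])
  have "mat_norm h0 \<le> mat_norm (h0 - h) + mat_norm h"
  proof -
    have "(h0 - h) + h = h0" using hc h0c by (intro eq_matI) auto
    moreover have "h0 - h \<in> carrier_mat n n" using hc by (rule minus_carrier_mat)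
    ultimately show ?thesis using cstar_norm_triangle[OF N _ hc, of "h0 - h"] by simp
  qed
  then have nh0: "mat_norm h0 < 1 + \<delta>"
    using h0(3) h1 cstar_norm_minus_commute[OF N hc h0c] by simp
  define h1 where "h1 = mat_scaleC (complex_of_real (1 / (1 + \<delta>))) h0"
  have "h1 \<in> mats n E0" unfolding h1_def by (rule mats_closed[OF E0(1) h0(1)])
  then have h1A: "h1 \<in> mats n A0" and h1E: "h1 \<in> mats n E" using mats_mono E0 by blast+
  have h1s: "mat_star h1 = h1" by (simp add: h1_def mat_star_scaleC h0(2))
  have "mat_norm h1 = 1 / (1 + \<delta>) * mat_norm h0"
    unfolding h1_def cstar_norm_scaleC[OF N h0c] norm_of_real using d0 by simp
  then have "mat_norm h1 < 1" using nh0 d0 by simp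
  then obtain l where l: "l \<in> \<Lambda>" "amp n (e l) - h1 \<in> mats_pos n UNIV"
    using order_unit_dominates[OF h1A h1s] by blast
  have ampE: "amp n (e l) \<in> mats n E" using l(1) eE E0(3) by (intro amp_mats[OF E]) blast
  have "amp n (e l) - h1 \<in> mats_pos n E"
    using l(2) mats_closed(4)[OF E ampE h1E] mats_pos_iff by blast
  then have "0 \<le> Re (\<psi> (amp n (e l) - h1))" by (rule mats_pos_functional_nonneg[OF \<psi>])
  then have v1: "Re (\<psi> h1) \<le> Re (\<psi> (amp n (e l)))"
    by (simp add: mat_dual_diff[OF dual E ampE h1E])
  have v2: "Re (\<psi> h1) = Re (\<psi> h0) / (1 + \<delta>)"
  proof -
    have "Re (complex_of_real c * w) = w' / c'" if "c = 1 / c'" "Re w = w'" for c c' w w'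
      using that by simp
    then show ?thesis unfolding h1_def mat_dual_scaleC[OF dual h0E] by blast
  qed
  have "cmod (\<psi> (h - h0)) \<le> S * mat_norm (h - h0)"
    unfolding S_def by (rule mat_dual_bound[OF N E dual dE])
  also have "\<dots> \<le> S * \<delta>" using h0(3) S0 by (intro mult_left_mono) simp_all
  finally have "Re (\<psi> h) - Re (\<psi> h0) \<le> S * \<delta>"
    using complex_Re_le_cmod[of "\<psi> (h - h0)"] by (simp add: mat_dual_diff[OF dual E hE h0E])
  then have v3: "S - \<delta> - S * \<delta> \<le> Re (\<psi> h0)" using x(3) by (simp add: \<psi>h_eq)
  let ?v = "Re (\<psi> (amp n (e l)))"
  have "mat_norm (amp n (e l)) \<le> 1"
    by (rule mat_norm_amp_order_unit_le[OF A0 nd l(1) order_unit_mem(1)[OF l(1)] order_unit_mem(2)[OF l(1)] n1])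
  then have "cmod (\<psi> (amp n (e l))) \<le> S" unfolding S_def by (rule dual_norm_upper[OF N dual ampE])
  then have "?v \<le> S" using complex_Re_le_cmod order_trans by blast
  then have "\<delta> * ?v \<le> \<delta> * S" using d0 by (intro mult_left_mono) simp_all
  moreover have "Re (\<psi> h0) \<le> (1 + \<delta>) * ?v" using v1 d0 by (simp add: v2 divide_le_eq mult.commute)
  ultimately have "S - \<delta> - 2 * S * \<delta> \<le> ?v" using v3 by (simp add: algebra_simps)
  then have "S - \<epsilon> \<le> ?v" using d\<epsilon> by linarith
  then show ?thesis using l(1) unfolding S_def by blast
qed

text \<open>
  The heart of the theorem. In the notation of the introduction, \<open>a\<close> is not normalized here: it is
  approximated by \<open>a0\<close> over \<open>\<A>\<close>, and \<open>b = a0 / r\<close> with \<open>r = \<parallel>a\<parallel> + 1\<close> has norm less than \<open>1\<close>. The key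
  estimate is \<open>0 \<le> e\<^sub>k - b \<le> e\<^sub>k + (a - a0) / r\<close>, where the second inequality is \<open>a \<ge> 0\<close>. It bounds
  \<open>\<parallel>e\<^sub>k - b\<parallel>\<close> by almost \<open>1\<close>, although \<open>b\<close> itself need not be positive.
\<close>
lemma norm_preserving_extension_positive:
  fixes E E0 :: "'a set"
  assumes E: "star_subspace E" and E0: "star_subspace E0" "E0 \<subseteq> A0" "E0 \<subseteq> E" "E \<subseteq> closure E0"
    and eE: "\<forall>l\<in>\<Lambda>. e l \<in> E0" and dense: "closure A0 = UNIV"
    and \<psi>: "\<psi> \<in> pos_cone (dual_h n E)"
    and \<Phi>: "\<Phi> \<in> hermitian_functionals n UNIV" and ext: "\<And>x. x \<in> mats n E \<Longrightarrow> \<Phi> x = \<psi> x"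
    and le: "dual_norm n UNIV \<Phi> \<le> dual_norm n E \<psi>"
  shows "\<Phi> \<in> pos_cone (dual_h n UNIV)"
proof -
  note dual = hermitian_functionalsD(1)[OF \<Phi>] and herm = hermitian_functionalsD(2)[OF \<Phi>]
  define S where "S = dual_norm n E \<psi>"
  have S0: "0 \<le> S"
    using dual_norm_nonneg[OF N star_subspace_UNIV dual] le by (simp add: S_def)
  have bound: "Re (\<Phi> x) \<le> S * K" if "x \<in> carrier_mat n n" "mat_norm x \<le> K" for x K
  proof -
    have "Re (\<Phi> x) \<le> cmod (\<Phi> x)" by (rule complex_Re_le_cmod)
    also have "\<dots> \<le> dual_norm n UNIV \<Phi> * mat_norm x"
      using that(1) by (intro mat_dual_bound[OF N star_subspace_UNIV dual]) (simp add: mats_UNIV)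
    also have "\<dots> \<le> S * K"
      using le that S0 cstar_norm_nonneg[OF N that(1)] by (intro mult_mono) (simp_all add: S_def)
    finally show ?thesis .
  qed
  have diff: "\<Phi> (x - y) = \<Phi> x - \<Phi> y" if "x \<in> carrier_mat n n" "y \<in> carrier_mat n n" for x y
    using that by (intro mat_dual_diff[OF dual star_subspace_UNIV]) (simp_all add: mats_UNIV)
  have "\<Phi> a \<in> \<real>\<^sub>\<ge>\<^sub>0" if a: "a \<in> mats_pos n UNIV" for a
  proof -
    have ac: "a \<in> carrier_mat n n" and as: "mat_star a = a"
      using mats_pos_carrier[OF a] mats_pos_self_adjoint[OF a] by simp_all
    define r where "r = mat_norm a + 1"
    have r1: "r \<ge> 1" using cstar_norm_nonneg[OF N ac] by (simp add: r_def)
    have "- (r * (1 + S) + S) * \<epsilon> \<le> Re (\<Phi> a)" if \<epsilon>: "0 < \<epsilon>" "\<epsilon> < 1" for \<epsilon>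
    proof -
      obtain a0 where a0: "a0 \<in> mats n A0" "mat_star a0 = a0" "mat_norm (a - a0) < \<epsilon>"
        using self_adjoint_mats_approx[OF N A0, of UNIV a \<epsilon>] dense ac as \<epsilon> by (auto simp: mats_UNIV)
      note a0c = mats_carrier[OF a0(1)]
      have dc: "a - a0 \<in> carrier_mat n n" "a0 - a \<in> carrier_mat n n"
        using ac a0c minus_carrier_mat by blast+
      have "(a0 - a) + a = a0" using ac a0c by (intro eq_matI) auto
      then have "mat_norm a0 \<le> mat_norm (a0 - a) + mat_norm a"
        using cstar_norm_triangle[OF N dc(2) ac] by simp
      then have "mat_norm a0 < r"
        using a0(3) \<epsilon>(2) cstar_norm_minus_commute[OF N ac a0c] by (simp add: r_def)
      define c where "c = complex_of_real (1 / r)"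
      have cabs: "cmod c = 1 / r" using r1 by (simp add: c_def norm_divide)
      define b where "b = mat_scaleC c a0"
      have bA: "b \<in> mats n A0" unfolding b_def by (rule mats_closed[OF A0 a0(1)])
      note bc = mats_carrier[OF bA]
      have "mat_star b = b" by (simp add: b_def mat_star_scaleC a0(2) c_def)
      moreover have "mat_norm b < 1"
        using cstar_norm_scaleC[OF N a0c, of c] \<open>mat_norm a0 < r\<close> r1 by (simp add: b_def cabs)
      ultimately obtain l where l: "l \<in> \<Lambda>" "amp n (e l) - b \<in> mats_pos n UNIV"
        using order_unit_dominates[OF bA] by blast
      obtain m where m: "m \<in> \<Lambda>" "S - \<epsilon> \<le> Re (\<psi> (amp n (e m)))"
        using positive_functional_norm_order_unit[OF E E0 eE \<psi> \<epsilon>(1)] by (auto simp: S_def)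
      obtain k where k: "k \<in> \<Lambda>" "rel l k" "rel m k" using order_unit_upper_bound[OF l(1) m(1)] .
      let ?e = "amp n (e k)"
      have eb: "?e - b \<in> mats_pos n UNIV"
        by (rule order_unit_dominates_larger[OF l(1) k(1,2) bc l(2)])
      have ampE: "amp n (e j) \<in> mats n E" if "j \<in> \<Lambda>" for j
        using that eE E0(3) by (intro amp_mats[OF E]) blast
      have "?e - amp n (e m) \<in> mats_pos n E"
        using order_unit_mono[OF m(1) k(1,3)] mats_closed(4)[OF E ampE[OF k(1)] ampE[OF m(1)]]
          mats_pos_iff by blast
      then have "0 \<le> Re (\<psi> (?e - amp n (e m)))" by (rule mats_pos_functional_nonneg[OF \<psi>])
      moreover have "\<psi> (?e - amp n (e m)) = \<psi> ?e - \<psi> (amp n (e m))"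
        using \<psi> by (intro mat_dual_diff[OF _ E ampE[OF k(1)] ampE[OF m(1)]] hermitian_functionalsD(1))
          (simp add: dual_h_def)
      ultimately have e_large: "S - \<epsilon> \<le> Re (\<Phi> ?e)" using m(2) ext[OF ampE[OF k(1)]] by simp
      let ?q = "?e + mat_scaleC c (a - a0)"
      have qc: "?q \<in> carrier_mat n n" using dc by simp
      have "mat_norm ?q \<le> 1 + 1 / r * \<epsilon>"
      proof -
        have "mat_norm (mat_scaleC c (a - a0)) \<le> 1 / r * \<epsilon>"
          using cstar_norm_scaleC[OF N dc(1), of c] a0(3) r1 by (simp add: cabs divide_right_mono)
        moreover have "mat_norm ?e \<le> 1"
          by (rule mat_norm_amp_order_unit_le[OF A0 nd k(1) order_unit_mem(1)[OF k(1)] order_unit_mem(2)[OF k(1)] n1])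
        ultimately show ?thesis
          using cstar_norm_triangle[OF N amp_carrier[of n "e k"], of "mat_scaleC c (a - a0)"] dc by simp
      qed
      moreover have "mat_norm (?e - b) \<le> mat_norm ?q"
      proof (rule mat_norm_mono[OF N eb qc])
        have "?q - (?e - b) = mat_scaleC c a"
          using ac a0c by (intro eq_matI) (auto simp: b_def scaleC_diff_right)
        moreover have "mat_scaleC c a \<in> mats_pos n UNIV"
          unfolding c_def using r1 by (intro mats_pos_scale a) simp
        ultimately show "?q - (?e - b) \<in> mats_pos n UNIV" by simp
      qed
      ultimately have "mat_norm (?e - b) \<le> 1 + 1 / r * \<epsilon>" by simp
      then have "Re (\<Phi> (?e - b)) \<le> S * (1 + 1 / r * \<epsilon>)"
        by (rule bound[OF mats_pos_carrier[OF eb]])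
      then have "Re (\<Phi> ?e) - Re (\<Phi> b) \<le> S * (1 + 1 / r * \<epsilon>)" by (simp add: diff[OF amp_carrier bc])
      then have "- \<epsilon> - S * (1 / r * \<epsilon>) \<le> Re (\<Phi> b)" using e_large by (simp add: algebra_simps)
      moreover have "Re (\<Phi> b) = Re (\<Phi> a0) / r"
        using mat_dual_scaleC[OF dual, of a0 c] a0c r1
        by (simp add: b_def c_def mats_UNIV Re_divide_of_real)
      ultimately have "r * (- \<epsilon> - S * (1 / r * \<epsilon>)) \<le> Re (\<Phi> a0)"
        using r1 by (simp add: le_divide_eq mult.commute)
      then have "- (r * \<epsilon> + S * \<epsilon>) \<le> Re (\<Phi> a0)" using r1 by (simp add: algebra_simps)
      moreover have "Re (\<Phi> (a0 - a)) \<le> S * \<epsilon>"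
        using a0(3) cstar_norm_minus_commute[OF N ac a0c] by (intro bound[OF dc(2)]) simp
      then have "Re (\<Phi> a0) - Re (\<Phi> a) \<le> S * \<epsilon>" by (simp add: diff[OF a0c ac])
      ultimately have "- (r * \<epsilon> + S * \<epsilon>) - S * \<epsilon> \<le> Re (\<Phi> a)" by linarith
      moreover have "S * \<epsilon> \<le> r * S * \<epsilon>" using r1 S0 \<epsilon>(1) by (simp add: mult_right_mono mult_le_cancel_right1)
      ultimately show ?thesis by (simp add: algebra_simps)
    qed
    note small = this
    have "0 \<le> Re (\<Phi> a)" by (rule nonneg_if_ge_small[OF small])
    moreover have "Im (\<Phi> a) = 0"
      using herm[of a] ac as by (simp add: mats_UNIV complex_eq_iff)
    ultimately show ?thesis by (simp add: complex_nonneg_Reals_iff)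
  qed
  then show ?thesis using \<Phi> by (simp add: dual_h_def)
qed

end

section \<open>The restriction map\<close>
lemma dual_h_simps [simp]:
  "vectors (dual_h n V) = hermitian_functionals n V"
  "vadd (dual_h n V) \<phi> \<psi> = (\<lambda>x. \<phi> x + \<psi> x)"
  "vscale (dual_h n V) r \<phi> = (\<lambda>x. complex_of_real r * \<phi> x)"
  "vnorm (dual_h n V) = dual_norm n V"
  by (simp_all add: dual_h_def)

lemma pos_cone_dual_h_iff:
  "\<phi> \<in> pos_cone (dual_h n V) \<longleftrightarrow>
    \<phi> \<in> hermitian_functionals n V \<and> (\<forall>x\<in>mats_pos n V. \<phi> x \<in> \<real>\<^sub>\<ge>\<^sub>0)"
  by (simp add: dual_h_def)

lemma zero_hermitian_functional: "(\<lambda>x. 0) \<in> hermitian_functionals n V"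
  by (auto simp: hermitian_functionals_def mat_dual_def intro: exI[of _ 0])

lemma hermitian_functionals_add:
  assumes "\<phi> \<in> hermitian_functionals n V" "\<psi> \<in> hermitian_functionals n V"
  shows "(\<lambda>x. \<phi> x + \<psi> x) \<in> hermitian_functionals n V"
proof -
  obtain K L where K: "\<forall>x\<in>mats n V. cmod (\<phi> x) \<le> K * mat_norm x"
    and L: "\<forall>x\<in>mats n V. cmod (\<psi> x) \<le> L * mat_norm x"
    using assms unfolding hermitian_functionals_def mat_dual_def by blast
  have "cmod (\<phi> x + \<psi> x) \<le> (K + L) * mat_norm x" if "x \<in> mats n V" for x
    using norm_triangle_ineq[of "\<phi> x" "\<psi> x"] K[rule_format, OF that] L[rule_format, OF that]
    by (simp add: distrib_right)
  then have "\<exists>K. \<forall>x\<in>mats n V. cmod (\<phi> x + \<psi> x) \<le> K * mat_norm x" by blast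
  then show ?thesis
    using assms unfolding hermitian_functionals_def mat_dual_def by (simp add: distrib_left)
qed

lemma hermitian_functionals_scale:
  assumes "\<phi> \<in> hermitian_functionals n V"
  shows "(\<lambda>x. complex_of_real r * \<phi> x) \<in> hermitian_functionals n V"
proof -
  obtain K where K: "\<forall>x\<in>mats n V. cmod (\<phi> x) \<le> K * mat_norm x"
    using assms unfolding hermitian_functionals_def mat_dual_def by blast
  have "cmod (complex_of_real r * \<phi> x) \<le> (\<bar>r\<bar> * K) * mat_norm x" if "x \<in> mats n V" for x
    using mult_left_mono[OF K[rule_format, OF that], of "\<bar>r\<bar>"] by (simp add: norm_mult mult.assoc)
  then have "\<exists>K. \<forall>x\<in>mats n V. cmod (complex_of_real r * \<phi> x) \<le> K * mat_norm x" by blast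
  then show ?thesis
    using assms unfolding hermitian_functionals_def mat_dual_def by (simp add: distrib_left)
qed

lemma restrict_functional_hermitian:
  assumes E: "star_subspace E" and \<phi>: "\<phi> \<in> hermitian_functionals n UNIV"
  shows "restrict_functional n E \<phi> \<in> hermitian_functionals n E"
proof -
  have sub: "x \<in> mats n UNIV" if "x \<in> mats n E" for x using that mats_mono[of E UNIV] by blast
  obtain K where "\<forall>x\<in>mats n UNIV. cmod (\<phi> x) \<le> K * mat_norm x"
    using \<phi> unfolding hermitian_functionals_def mat_dual_def by blast
  then have "\<exists>K. \<forall>x\<in>mats n E. cmod (restrict_functional n E \<phi> x) \<le> K * mat_norm x"
    using sub by (intro exI[of _ K]) (simp add: restrict_functional_def)
  then show ?thesis
    using hermitian_functionalsD[OF \<phi>] sub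
    unfolding hermitian_functionals_def mat_dual_def[of n E]
    by (simp add: restrict_functional_def mats_closed[OF E] mat_dual_add mat_dual_scaleC)
qed

lemma dual_norm_restrict_le:
  assumes N: "is_cstar_norm n (mat_norm :: 'a::cstar_algebra mat \<Rightarrow> real)"
    and E: "star_subspace (E :: 'a set)" and \<phi>: "\<phi> \<in> hermitian_functionals n UNIV"
  shows "dual_norm n E (restrict_functional n E \<phi>) \<le> dual_norm n UNIV \<phi>"
proof (rule dual_norm_leI[OF N E])
  fix x assume x: "x \<in> mats n E" "mat_norm x \<le> 1"
  then have "x \<in> mats n UNIV" using mats_mono[of E UNIV] by blast
  then show "cmod (restrict_functional n E \<phi> x) \<le> dual_norm n UNIV \<phi>"
    using x dual_norm_upper[OF N hermitian_functionalsD(1)[OF \<phi>]] by (simp add: restrict_functional_def)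
qed

text \<open>
  If there were no complete C*-norm on the \<open>n \<times> n\<close> matrices, the definite description in the definition
  of the matrix norm would have the same arbitrary value for all of them. The norm-defining property
  at the zero matrix fixes this value: \<open>t = 0\<close> is admissible there.
\<close>
lemma mat_norm_degenerate:
  fixes A :: "'a::cstar_algebra set" and e :: "'i \<Rightarrow> 'a" and x :: "'a mat"
  assumes A: "star_subspace A" and nd: "norm_defining A \<Lambda> e" and "\<Lambda> \<noteq> {}" and "n \<ge> 1"
    and none: "\<nexists>N :: 'a mat \<Rightarrow> real. is_cstar_norm n N"
    and x: "x \<in> carrier_mat n n"
  shows "mat_norm x = 0"
proof -
  have const: "mat_norm y = (THE r :: real. False)" if "y \<in> carrier_mat n n" for y :: "'a mat"
  proof -
    have "(\<exists>N :: 'a mat \<Rightarrow> real. is_cstar_norm (dim_row y) N \<and> r = N y) = False" for r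
      using none that by auto
    then show ?thesis unfolding mat_norm_def by (simp only:)
  qed
  let ?z = "0\<^sub>m n n :: 'a mat"
  let ?T = "{t. 0 \<le> t \<and> (\<exists>l\<in>\<Lambda>. four_block_mat (amp n (t *\<^sub>R e l)) ?z (mat_star ?z) (amp n (t *\<^sub>R e l))
      \<in> mats_pos (2 * n) A)}"
  obtain l where l: "l \<in> \<Lambda>" using \<open>\<Lambda> \<noteq> {}\<close> by blast
  have "amp n 0 = ?z" by (rule eq_matI) auto
  then have "four_block_mat (amp n (0 *\<^sub>R e l)) ?z (mat_star ?z) (amp n (0 *\<^sub>R e l)) = 0\<^sub>m (2 * n) (2 * n)"
    by (simp add: mat_star_zero_mat mult_2)
  moreover have "0\<^sub>m (2 * n) (2 * n) \<in> mats_pos (2 * n) A"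
  proof -
    have "0\<^sub>m (2 * n) (2 * n) = mat_star (0\<^sub>m (2 * n) (2 * n)) * (0\<^sub>m (2 * n) (2 * n) :: 'a mat)"
      by (simp add: mat_star_zero_mat)
    then show ?thesis
      unfolding mats_pos_def using mats_zero[OF A, of "2 * n"] zero_carrier_mat[of "2 * n" "2 * n"] by blast
  qed
  ultimately have "0 \<in> ?T" using l by auto
  then have "Inf (ereal ` ?T) \<le> ereal 0" by (intro Inf_lower imageI)
  moreover have "ereal 0 \<le> Inf (ereal ` ?T)" by (intro Inf_greatest) auto
  moreover have "ereal (mat_norm ?z) = Inf (ereal ` ?T)"
    using nd mats_zero[OF A] \<open>n \<ge> 1\<close> unfolding norm_defining_def by blast
  ultimately have "mat_norm ?z = 0" by simp
  then show ?thesis using const[OF x] const[of ?z] by simp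
qed

text \<open>
  Reduction to extensions. The map is defined by restricting an arbitrary element of a coset; all
  elements have the same restriction. Contractivity of restriction gives one inequality between the
  norms, and a norm-preserving extension, being an element of the coset, gives the other. In the same
  way a positive extension is a positive representative of the coset.
\<close>
theorem restriction_isometric_order_isomorphism:
  fixes E :: "'a::cstar_algebra set"
  assumes E: "star_subspace E"
    and contractive: "\<And>\<phi>. \<phi> \<in> hermitian_functionals n UNIV \<Longrightarrow>
      dual_norm n E (restrict_functional n E \<phi>) \<le> dual_norm n UNIV \<phi>"
    and extend: "\<And>\<psi>. \<psi> \<in> hermitian_functionals n E \<Longrightarrow> \<exists>\<Phi>\<in>hermitian_functionals n UNIV.
      restrict_functional n E \<Phi> = \<psi> \<and> dual_norm n UNIV \<Phi> \<le> dual_norm n E \<psi> \<and>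
      (\<psi> \<in> pos_cone (dual_h n E) \<longrightarrow> \<Phi> \<in> pos_cone (dual_h n UNIV))"
  shows "\<exists>\<rho>. (\<forall>\<phi>\<in>vectors (dual_h n UNIV).
                \<rho> (vcoset (dual_h n UNIV) (annihilator_h n E) \<phi>) = restrict_functional n E \<phi>) \<and>
             isometric_order_isomorphism \<rho>
               (quotient_space (dual_h n UNIV) (annihilator_h n E)) (dual_h n E)"
proof -
  let ?H = "hermitian_functionals n (UNIV :: 'a set)"
  let ?W = "annihilator_h n E"
  let ?r = "restrict_functional n E"
  let ?X = "dual_h n (UNIV :: 'a set)"
  let ?cos = "vcoset ?X ?W"
  define \<rho> where "\<rho> C = ?r (SOME \<phi>. \<phi> \<in> C)" for C
  have \<rho>_eq: "\<rho> C = \<psi>" if "C \<noteq> {}" "\<And>\<phi>. \<phi> \<in> C \<Longrightarrow> ?r \<phi> = \<psi>" for C \<psi>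
    unfolding \<rho>_def using that some_in_eq by blast
  have minus_H: "(\<lambda>x. \<phi> x - \<psi> x) \<in> ?H" if "\<phi> \<in> ?H" "\<psi> \<in> ?H" for \<phi> \<psi>
    using hermitian_functionals_add[OF that(1) hermitian_functionals_scale[OF that(2), of "- 1"]] by simp
  have r_eq_iff: "?r \<phi> = ?r \<psi> \<longleftrightarrow> (\<lambda>x. \<phi> x - \<psi> x) \<in> ?W" if "\<phi> \<in> ?H" "\<psi> \<in> ?H" for \<phi> \<psi>
  proof -
    have "?r \<phi> = ?r \<psi> \<longleftrightarrow> (\<forall>x\<in>mats n E. \<phi> x - \<psi> x = 0)"
      by (auto simp: restrict_functional_def fun_eq_iff)
    then show ?thesis using minus_H[OF that] by (simp add: annihilator_h_def)
  qed
  have coset_iff: "\<phi>' \<in> ?cos \<phi> \<longleftrightarrow> \<phi>' \<in> ?H \<and> ?r \<phi>' = ?r \<phi>" if \<phi>: "\<phi> \<in> ?H" for \<phi> \<phi>'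
  proof
    assume "\<phi>' \<in> ?cos \<phi>"
    then obtain \<eta> where \<eta>: "\<eta> \<in> ?W" "\<phi>' = (\<lambda>x. \<phi> x + \<eta> x)" unfolding vcoset_def by auto
    then have "\<phi>' \<in> ?H" using hermitian_functionals_add[OF \<phi>, of \<eta>] by (simp add: annihilator_h_def)
    moreover have "(\<lambda>x. \<phi>' x - \<phi> x) \<in> ?W" using \<eta> by simp
    ultimately show "\<phi>' \<in> ?H \<and> ?r \<phi>' = ?r \<phi>" using r_eq_iff \<phi> by blast
  next
    assume "\<phi>' \<in> ?H \<and> ?r \<phi>' = ?r \<phi>"
    then have "(\<lambda>x. \<phi>' x - \<phi> x) \<in> ?W" using r_eq_iff \<phi> by blast
    moreover have "\<phi>' = vadd ?X \<phi> (\<lambda>x. \<phi>' x - \<phi> x)" by simp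
    ultimately show "\<phi>' \<in> ?cos \<phi>" unfolding vcoset_def by blast
  qed
  have coset_self: "\<phi> \<in> ?cos \<phi>" if "\<phi> \<in> ?H" for \<phi> using coset_iff[OF that] that by blast
  have coset_eq: "?cos \<phi> = ?cos \<psi>" if "\<phi> \<in> ?H" "\<psi> \<in> ?H" "?r \<phi> = ?r \<psi>" for \<phi> \<psi>
    by (rule Set.set_eqI) (simp only: coset_iff[OF that(1)] coset_iff[OF that(2)] that(3))
  have \<rho>_coset: "\<rho> (?cos \<phi>) = ?r \<phi>" if "\<phi> \<in> ?H" for \<phi>
    by (rule \<rho>_eq) (use coset_self[OF that] coset_iff[OF that] in blast)+
  have r_H: "?r \<phi> \<in> hermitian_functionals n E" if "\<phi> \<in> ?H" for \<phi>
    by (rule restrict_functional_hermitian[OF E that])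
  let ?Q = "quotient_space ?X ?W" and ?Y = "dual_h n E"
  have Q: "vectors ?Q = ?cos ` ?H" by (simp add: quotient_space_def)
  have vadd_Q: "vadd ?Q C D = {\<lambda>x. \<phi> x + \<psi> x |\<phi> \<psi>. \<phi> \<in> C \<and> \<psi> \<in> D}" for C D
    by (simp add: quotient_space_def)
  have vscale_Q: "vscale ?Q s C = {\<lambda>x. complex_of_real s * \<phi> x + \<eta> x |\<phi> \<eta>. \<phi> \<in> C \<and> \<eta> \<in> ?W}" for s C
    by (simp add: quotient_space_def)
  have bij: "bij_betw \<rho> (vectors ?Q) (vectors ?Y)"
  proof (rule bij_betw_imageI)
    show "inj_on \<rho> (vectors ?Q)"
    proof (rule inj_onI)
      fix C D assume CD: "C \<in> vectors ?Q" "D \<in> vectors ?Q" "\<rho> C = \<rho> D"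
      then obtain \<phi> \<psi> where "\<phi> \<in> ?H" "C = ?cos \<phi>" "\<psi> \<in> ?H" "D = ?cos \<psi>" unfolding Q by blast
      then show "C = D" using CD(3) coset_eq[of \<phi> \<psi>] by (simp add: \<rho>_coset)
    qed
    have "?r ` ?H = hermitian_functionals n E"
    proof
      show "hermitian_functionals n E \<subseteq> ?r ` ?H" using extend by blast
    qed (use r_H in blast)
    then show "\<rho> ` vectors ?Q = vectors ?Y"
      unfolding Q image_image by (simp add: \<rho>_coset cong: image_cong)
  qed
  have add: "\<rho> (vadd ?Q C D) = vadd ?Y (\<rho> C) (\<rho> D)" if CD: "C \<in> vectors ?Q" "D \<in> vectors ?Q" for C D
  proof -
    obtain \<phi> \<psi> where \<phi>: "\<phi> \<in> ?H" "C = ?cos \<phi>" and \<psi>: "\<psi> \<in> ?H" "D = ?cos \<psi>" using CD unfolding Q by blast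
    have "\<rho> (vadd ?Q C D) = (\<lambda>x. ?r \<phi> x + ?r \<psi> x)"
    proof (rule \<rho>_eq)
      have "\<phi> \<in> C" "\<psi> \<in> D" using coset_self \<phi> \<psi> by blast+
      then show "vadd ?Q C D \<noteq> {}" unfolding vadd_Q by blast
      fix \<theta> assume "\<theta> \<in> vadd ?Q C D"
      then obtain \<phi>' \<psi>' where "\<phi>' \<in> C" "\<psi>' \<in> D" and \<theta>: "\<theta> = (\<lambda>x. \<phi>' x + \<psi>' x)"
        unfolding vadd_Q by blast
      then have "?r \<phi>' = ?r \<phi>" "?r \<psi>' = ?r \<psi>"
        unfolding \<phi>(2) \<psi>(2) coset_iff[OF \<phi>(1)] coset_iff[OF \<psi>(1)] by blast+
      moreover have "?r \<theta> = (\<lambda>x. ?r \<phi>' x + ?r \<psi>' x)"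
        by (simp add: \<theta> restrict_functional_def fun_eq_iff)
      ultimately show "?r \<theta> = (\<lambda>x. ?r \<phi> x + ?r \<psi> x)" by simp
    qed
    then show ?thesis using \<phi> \<psi> by (simp add: \<rho>_coset)
  qed
  have scale: "\<rho> (vscale ?Q s C) = vscale ?Y s (\<rho> C)" if C: "C \<in> vectors ?Q" for s C
  proof -
    obtain \<phi> where \<phi>: "\<phi> \<in> ?H" "C = ?cos \<phi>" using C unfolding Q by blast
    have zW: "(\<lambda>x. 0) \<in> ?W" using zero_hermitian_functional by (simp add: annihilator_h_def)
    have "\<rho> (vscale ?Q s C) = (\<lambda>x. complex_of_real s * ?r \<phi> x)"
    proof (rule \<rho>_eq)
      have "\<phi> \<in> C" using coset_self \<phi> by blast
      then show "vscale ?Q s C \<noteq> {}" unfolding vscale_Q using zW by blast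
      fix \<theta> assume "\<theta> \<in> vscale ?Q s C"
      then obtain \<phi>' \<eta> where "\<phi>' \<in> C" and \<eta>: "\<eta> \<in> ?W" and \<theta>: "\<theta> = (\<lambda>x. complex_of_real s * \<phi>' x + \<eta> x)"
        unfolding vscale_Q by blast
      then have "?r \<phi>' = ?r \<phi>" unfolding \<phi>(2) coset_iff[OF \<phi>(1)] by blast
      moreover have "?r \<theta> = (\<lambda>x. complex_of_real s * ?r \<phi>' x)"
        using \<eta> by (simp add: \<theta> restrict_functional_def fun_eq_iff annihilator_h_def)
      ultimately show "?r \<theta> = (\<lambda>x. complex_of_real s * ?r \<phi> x)" by simp
    qed
    then show ?thesis using \<phi> by (simp add: \<rho>_coset)
  qed
  have norm: "vnorm ?Y (\<rho> C) = vnorm ?Q C" if C: "C \<in> vectors ?Q" for C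
  proof -
    obtain \<phi> where \<phi>: "\<phi> \<in> ?H" "C = ?cos \<phi>" using C unfolding Q by blast
    obtain \<Phi> where \<Phi>: "\<Phi> \<in> ?H" "?r \<Phi> = ?r \<phi>" "dual_norm n UNIV \<Phi> \<le> dual_norm n E (?r \<phi>)"
      using extend[OF r_H[OF \<phi>(1)]] by blast
    have lower: "dual_norm n E (?r \<phi>) \<le> dual_norm n UNIV \<phi>'" if "\<phi>' \<in> C" for \<phi>'
      using contractive[of \<phi>'] coset_iff[OF \<phi>(1), of \<phi>'] that \<phi>(2) by simp
    have "\<Phi> \<in> C" using coset_iff[OF \<phi>(1)] \<Phi> \<phi>(2) by blast
    have "Inf (dual_norm n UNIV ` C) = dual_norm n E (?r \<phi>)"
    proof (rule antisym)
      have "bdd_below (dual_norm n UNIV ` C)" using lower by (intro bdd_belowI2)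
      then have "Inf (dual_norm n UNIV ` C) \<le> dual_norm n UNIV \<Phi>"
        using \<open>\<Phi> \<in> C\<close> by (intro cInf_lower imageI)
      then show "Inf (dual_norm n UNIV ` C) \<le> dual_norm n E (?r \<phi>)" using \<Phi>(3) by simp
      show "dual_norm n E (?r \<phi>) \<le> Inf (dual_norm n UNIV ` C)"
        using lower \<open>\<Phi> \<in> C\<close> by (intro cInf_greatest) blast+
    qed
    then show ?thesis using \<phi> by (simp add: quotient_space_def \<rho>_coset)
  qed
  have positive: "\<rho> C \<in> pos_cone ?Y \<longleftrightarrow> C \<in> pos_cone ?Q" if C: "C \<in> vectors ?Q" for C
  proof -
    obtain \<phi> where \<phi>: "\<phi> \<in> ?H" "C = ?cos \<phi>" using C unfolding Q by blast
    have cone: "C \<in> pos_cone ?Q \<longleftrightarrow> C \<in> ?cos ` pos_cone ?X" by (simp add: quotient_space_def)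
    show ?thesis
    proof
      assume "\<rho> C \<in> pos_cone ?Y"
      then have r_pos: "?r \<phi> \<in> pos_cone ?Y" by (simp only: \<phi>(2) \<rho>_coset[OF \<phi>(1)])
      obtain \<Phi> where \<Phi>: "\<Phi> \<in> ?H" "?r \<Phi> = ?r \<phi>"
        and "?r \<phi> \<in> pos_cone ?Y \<longrightarrow> \<Phi> \<in> pos_cone ?X"
        using extend[OF r_H[OF \<phi>(1)]] by (elim bexE conjE)
      then have "\<Phi> \<in> pos_cone ?X" using r_pos by (elim mp)
      moreover have "C = ?cos \<Phi>" unfolding \<phi>(2) by (rule coset_eq[OF \<phi>(1) \<Phi>(1) \<Phi>(2)[symmetric]])
      ultimately show "C \<in> pos_cone ?Q" unfolding cone by (intro image_eqI)
    next
      assume "C \<in> pos_cone ?Q"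
      then obtain \<Phi> where \<Phi>: "\<Phi> \<in> pos_cone ?X" "C = ?cos \<Phi>" unfolding cone by (elim imageE)
      have H: "\<Phi> \<in> ?H" and nonneg: "\<forall>x\<in>mats_pos n UNIV. \<Phi> x \<in> \<real>\<^sub>\<ge>\<^sub>0"
        using \<Phi>(1) unfolding pos_cone_dual_h_iff by (rule conjunct1, rule conjunct2)
      have "?r \<Phi> x \<in> \<real>\<^sub>\<ge>\<^sub>0" if x: "x \<in> mats_pos n E" for x
      proof -
        have "x \<in> mats n E" "x \<in> mats_pos n UNIV" using x unfolding mats_pos_iff[of x n E] by blast+
        then show ?thesis using nonneg by (simp add: restrict_functional_def)
      qed
      then have "?r \<Phi> \<in> pos_cone ?Y" unfolding pos_cone_dual_h_iff using r_H[OF H] by blast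
      then show "\<rho> C \<in> pos_cone ?Y" by (simp only: \<Phi>(2) \<rho>_coset[OF H])
    qed
  qed
  have "isometric_order_isomorphism \<rho> ?Q ?Y"
    unfolding isometric_order_isomorphism_def
    by (intro conjI ballI allI bij add scale norm positive)
  then show ?thesis using \<rho>_coset by (intro exI[of _ \<rho>]) simp
qed

theorem theorem2p18:
  fixes E E0 A0 :: "'a::cstar_algebra set"
    and \<Lambda> :: "'i set" and rel :: "'i \<Rightarrow> 'i \<Rightarrow> bool" and e :: "'i \<Rightarrow> 'a"
    and n :: nat
  assumes "star_subspace E" and "closed E"
    and "star_subspace E0" and "star_subspace A0" and "E0 \<subseteq> A0"
    and "E0 \<subseteq> E" and "E \<subseteq> closure E0"
    and "closure A0 = UNIV"
    and "approximate_order_unit A0 \<Lambda> rel e"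
    and "norm_defining A0 \<Lambda> e"
    and "\<forall>l\<in>\<Lambda>. e l \<in> E0"
    and "n \<ge> 1"
  shows "\<exists>\<rho>. (\<forall>\<phi>\<in>vectors (dual_h n UNIV).
                \<rho> (vcoset (dual_h n UNIV) (annihilator_h n E) \<phi>) = restrict_functional n E \<phi>) \<and>
             isometric_order_isomorphism \<rho>
               (quotient_space (dual_h n UNIV) (annihilator_h n E)) (dual_h n E)"
proof (cases "\<exists>N :: 'a mat \<Rightarrow> real. is_cstar_norm n N")
  case True
  then have N: "is_cstar_norm n (mat_norm :: 'a mat \<Rightarrow> real)" using is_cstar_norm_mat_norm by blast
  show ?thesis
  proof (rule restriction_isometric_order_isomorphism[OF assms(1)])
    show "dual_norm n E (restrict_functional n E \<phi>) \<le> dual_norm n UNIV \<phi>"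
      if "\<phi> \<in> hermitian_functionals n UNIV" for \<phi>
      by (rule dual_norm_restrict_le[OF N assms(1) that])
    fix \<psi> assume \<psi>: "\<psi> \<in> hermitian_functionals n E"
    obtain \<Phi> where \<Phi>: "\<Phi> \<in> hermitian_functionals n UNIV" "\<And>x. x \<in> mats n E \<Longrightarrow> \<Phi> x = \<psi> x"
      "dual_norm n UNIV \<Phi> \<le> dual_norm n E \<psi>"
      using hermitian_functional_extension_mats[OF N assms(1) \<psi>] by blast
    have "restrict_functional n E \<Phi> = \<psi>"
      using \<Phi>(2) mat_dual_outside[OF hermitian_functionalsD(1)[OF \<psi>]]
      by (auto simp: restrict_functional_def fun_eq_iff)
    moreover have "\<Phi> \<in> pos_cone (dual_h n UNIV)" if "\<psi> \<in> pos_cone (dual_h n E)"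
      using norm_preserving_extension_positive[OF N assms(4,9,10,12,1,3,5,6,7,11,8) that \<Phi>] .
    ultimately show "\<exists>\<Phi>\<in>hermitian_functionals n UNIV. restrict_functional n E \<Phi> = \<psi> \<and>
        dual_norm n UNIV \<Phi> \<le> dual_norm n E \<psi> \<and>
        (\<psi> \<in> pos_cone (dual_h n E) \<longrightarrow> \<Phi> \<in> pos_cone (dual_h n UNIV))"
      using \<Phi> by blast
  qed
next
  case False
  (* Here the matrix norm vanishes, and with it all bounded functionals. *)
  have "\<Lambda> \<noteq> {}"
    using assms(9) by (simp add: approximate_order_unit_def directed_set_def)
  then have zero_norm: "mat_norm x = 0" if "x \<in> carrier_mat n n" for x :: "'a mat"
    using mat_norm_degenerate[OF assms(4,10) _ assms(12) False that] by blast
  have zero: "\<phi> = (\<lambda>x. 0)" if \<phi>: "\<phi> \<in> hermitian_functionals n V" for \<phi> and V :: "'a set"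
  proof
    fix x
    show "\<phi> x = 0"
    proof (cases "x \<in> mats n V")
      case True
      obtain K where "\<forall>x\<in>mats n V. cmod (\<phi> x) \<le> K * mat_norm x"
        using \<phi> unfolding hermitian_functionals_def mat_dual_def by blast
      then have "cmod (\<phi> x) \<le> K * mat_norm x" using True by blast
      then show ?thesis by (simp add: zero_norm[OF mats_carrier[OF True]])
    qed (rule mat_dual_outside[OF hermitian_functionalsD(1)[OF \<phi>]])
  qed
  have dual_norm_zero: "dual_norm n V (\<lambda>x. 0) = 0" if "star_subspace V" for V :: "'a set"
  proof -
    have "{cmod 0 |x. x \<in> mats n V \<and> mat_norm x \<le> 1} = {0}"
      using mats_zero[OF that, of n] zero_norm[of "0\<^sub>m n n"] by auto
    then show ?thesis by (simp add: dual_norm_def)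
  qed
  have restrict_zero: "restrict_functional n E (\<lambda>x. 0) = (\<lambda>x. 0)"
    by (simp add: restrict_functional_def fun_eq_iff)
  have zero_pos: "(\<lambda>x. 0) \<in> pos_cone (dual_h n (UNIV :: 'a set))"
    using zero_hermitian_functional by (simp add: pos_cone_dual_h_iff)
  show ?thesis
  proof (rule restriction_isometric_order_isomorphism[OF assms(1)])
    show "dual_norm n E (restrict_functional n E \<phi>) \<le> dual_norm n UNIV \<phi>"
      if "\<phi> \<in> hermitian_functionals n UNIV" for \<phi>
      using zero[OF that] dual_norm_zero[OF assms(1)] dual_norm_zero[OF star_subspace_UNIV]
      by (simp add: restrict_zero)
    fix \<psi> assume "\<psi> \<in> hermitian_functionals n E"
    then have "\<psi> = (\<lambda>x. 0)" by (rule zero)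
    then show "\<exists>\<Phi>\<in>hermitian_functionals n UNIV. restrict_functional n E \<Phi> = \<psi> \<and>
        dual_norm n UNIV \<Phi> \<le> dual_norm n E \<psi> \<and>
        (\<psi> \<in> pos_cone (dual_h n E) \<longrightarrow> \<Phi> \<in> pos_cone (dual_h n UNIV))"
      using zero_hermitian_functional[of n UNIV] zero_pos dual_norm_zero[OF assms(1)]
        dual_norm_zero[OF star_subspace_UNIV]
      by (intro bexI[of _ "\<lambda>x. 0"]) (simp_all add: restrict_zero)
  qed
qed

end
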